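(* Let $g\ge 0$ be an integer and let $a\in\mathcal H^g$, with associated rational functions $f,\tilde f$. The following three statements are equivalent: (i) the genus $g$ of $X_a$ is $0$; (ii) $\deg(f)=1$; (iii) $\deg(f)=n(\tilde f)$. Hence for $g>0$ the winding number satisfies $|n(\tilde f)|\le\deg(f)-2$.
   Context: Polynomials. $P^d$ is the space of complex polynomials in $\lambda$ of degree at most $d$, and $P^d_{\mathbb R}\subset P^d$ is the real subspace of those $p(\lambda)=\sum_{i=0}^d p_i\lambda^i$ with $p_{d-i}=\overline{p_i}$ for all $i$. The space $\mathcal H^g$. $\mathcal H^g$ is the set of polynomials $a$ of degree $2g$ such that $a\in P^{2g}_{\mathbb R}$, $\lambda^{-g}a(\lambda)>0$ for all $\lambda\in S^1=\{|\lambda|=1\}$, the highest coefficient of $a$ has absolute value $1$, and the roots of $a$ are pairwise distinct. For $a\in\mathcal H^g$, $X_a$ is the smooth hyperelliptic curve of genus $g$ given by the compactification of $y^2=\lambda a(\lambda)$. The planes $\mathcal B_a$. For $b\in P^{g+1}_{\mathbb R}$ put $\Theta_b=\frac{b(\lambda)\,d\lambda}{\lambda y}$, a meromorphic differential on $X_a$. $\mathcal B_a$ is the real $2$-dimensional vector space of those $b\in P^{g+1}_{\mathbb R}$ for which all periods of $\Theta_b$ are purely imaginary. Each $b\in\mathcal B_a$ is uniquely determined by $b(0)\in\mathbb C$, which can be arbitrary. The functions $f$ and $\tilde f$. For linearly independent $b_1,b_2\in\mathcal B_a$ put $f=b_1/b_2:\mathbb P^1\to\mathbb P^1$; $f$ is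 well defined up to Möbius transformations, so its degree $\deg(f)$ as a map $\mathbb P^1\to\mathbb P^1$ depends only on $a$. Choosing the unique $b_1,b_2\in\mathcal B_a$ with $b_1(0)=1$, $b_2(0)=i$, put $\tilde f=\frac{b_1+ib_2}{b_1-ib_2}$ (common factors cancelled). It maps $S^1$ to $S^1$, and the winding number $n(\tilde f)\in\mathbb Z$ is the topological degree of $\tilde f|_{S^1}:S^1\to S^1$. *)

theory Defs
  imports "HOL-Complex_Analysis.Complex_Analysis" "HOL-Computational_Algebra.Computational_Algebra"
    "HOL-Computational_Algebra.Field_as_Ring"
begin

definition real_polys :: "nat \<Rightarrow> complex poly set" where
  "real_polys d = {p. degree p \<le> d \<and> (\<forall>i\<le>d. coeff p (d - i) = cnj (coeff p i))}"

definition spectral_polys :: "nat \<Rightarrow> complex poly set" where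
  "spectral_polys g = {a. degree a = 2 * g \<and> a \<in> real_polys (2 * g)
     \<and> (\<forall>z\<in>sphere 0 1. \<exists>r>0. poly a z / z ^ g = complex_of_real r)
     \<and> cmod (lead_coeff a) = 1 \<and> rsquarefree a}"

text \<open>The hyperelliptic curve \<open>X\<^sub>a\<close> without its two points over \<open>0\<close> and \<open>\<infinity>\<close>, the only possible
  poles of the differentials considered below.\<close>

definition curve :: "complex poly \<Rightarrow> (complex \<times> complex) set" where
  "curve a = {(x, y). x \<noteq> 0 \<and> y\<^sup>2 = x * poly a x}"

text \<open>The value of \<open>\<Theta>\<^sub>b = b(x) dx / (x y)\<close> at a point \<open>(x, y)\<close> of the curve on a tangent vector
  \<open>(u, v)\<close>. Tangency means \<open>2 y v = (x a)'(x) u\<close>, so that \<open>u / y = 2 v / (x a)'(x)\<close>; the second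
  expression gives the holomorphic extension of \<open>\<Theta>\<^sub>b\<close> to the branch points \<open>y = 0\<close>.\<close>

definition theta :: "complex poly \<Rightarrow> complex poly \<Rightarrow> complex \<times> complex \<Rightarrow> complex \<times> complex \<Rightarrow> complex"
  where
  "theta a b = (\<lambda>(x, y) (u, v).
     poly b x / x * (if y \<noteq> 0 then u / y else 2 * v / poly (pderiv ([:0, 1:] * a)) x))"

definition period :: "complex poly \<Rightarrow> complex poly \<Rightarrow> (real \<Rightarrow> complex \<times> complex) \<Rightarrow> complex" where
  "period a b \<gamma> =
     integral {0..1} (\<lambda>t. theta a b (\<gamma> t) (vector_derivative \<gamma> (at t within {0..1})))"

text \<open>The residues at the points over \<open>0\<close> and \<open>\<infinity>\<close> vanish, because \<open>\<Theta>\<^sub>b\<close> is odd under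
  \<open>(x, y) \<mapsto> (x, -y)\<close>, which fixes both points. Hence loops in the punctured curve yield
  exactly the periods of \<open>\<Theta>\<^sub>b\<close> on the compact curve.\<close>

definition imag_period_polys :: "nat \<Rightarrow> complex poly \<Rightarrow> complex poly set" where
  "imag_period_polys g a = {b \<in> real_polys (g + 1).
     \<forall>\<gamma>. valid_path \<gamma> \<and> path_image \<gamma> \<subseteq> curve a \<and> pathfinish \<gamma> = pathstart \<gamma>
        \<longrightarrow> Re (period a b \<gamma>) = 0}"

definition real_independent :: "complex poly \<Rightarrow> complex poly \<Rightarrow> bool" where
  "real_independent p q \<longleftrightarrow>
     (\<forall>s t :: real. smult (of_real s) p + smult (of_real t) q = 0 \<longrightarrow> s = 0 \<and> t = 0)"

text \<open>A rational function on the Riemann sphere is given by a pair of polynomials, its numerator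
  and denominator, from which common factors are cancelled.\<close>

definition rat_fun :: "complex poly \<Rightarrow> complex poly \<Rightarrow> complex \<Rightarrow> complex" where
  "rat_fun p q z = poly (p div gcd p q) z / poly (q div gcd p q) z"

definition rat_degree :: "complex poly \<Rightarrow> complex poly \<Rightarrow> nat" where
  "rat_degree p q = max (degree (p div gcd p q)) (degree (q div gcd p q))"

text \<open>For a rational function, \<open>rat_degree\<close> is its degree as a map of the Riemann sphere to itself:
  all but finitely many points have exactly this number of preimages, as shown in
  \<open>rat_degree_generic_fibre\<close>.\<close>

lemma card_roots_rsquarefree:
  fixes p :: "complex poly"
  assumes "rsquarefree p"
  shows "card {z. poly p z = 0} = degree p"
proof -
  have p0: "p \<noteq> 0" using assms by (auto simp: rsquarefree_def)
  have "degree p = degree (smult (lead_coeff p) (\<Prod>z|poly p z = 0. [:-z, 1:]))"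
    using complex_poly_decompose_rsquarefree[OF assms] by simp
  also have "\<dots> = card {z. poly p z = 0}"
    using p0 by (simp add: degree_prod_sum_eq)
  finally show ?thesis by simp
qed

lemma generic_fibre_coprime:
  fixes p q :: "complex poly"
  assumes cop: "coprime p q" and q: "q \<noteq> 0"
  shows "finite {w. card {z. poly q z \<noteq> 0 \<and> poly p z / poly q z = w} \<noteq> max (degree p) (degree q)}"
proof (cases "max (degree p) (degree q) = 0")
  case True
  then obtain c d where pq: "p = [:c:]" "q = [:d:]"
    by (metis degree_eq_zeroE max_nat.eq_neutr_iff)
  have "card {z::complex. poly q z \<noteq> 0 \<and> poly p z / poly q z = w} = 0" for w
    using infinite_UNIV_char_0[where 'a=complex] by (auto simp: pq card_eq_0_iff)
  then show ?thesis using True by simp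
next
  case False
  define d where "d = max (degree p) (degree q)"
  define W where "W = pderiv p * q - p * pderiv q"
  have W: "W \<noteq> 0"
  proof
    assume "W = 0"
    then have eq: "pderiv p * q = p * pderiv q" by (simp add: W_def)
    have "q dvd p * pderiv q" by (metis dvd_triv_right eq)
    then have "q dvd pderiv q" using cop by (simp add: coprime_commute coprime_dvd_mult_right_iff)
    then have dq: "degree q = 0" by simp
    have "p dvd pderiv p * q" by (metis dvd_triv_left eq)
    then have "p dvd pderiv p" using cop by (simp add: coprime_dvd_mult_left_iff)
    then have "degree p = 0" by simp
    with dq False show False by simp
  qed
  define B where "B = insert (coeff p d / coeff q d) ((\<lambda>z. poly p z / poly q z) ` {z. poly W z = 0})"
  have "finite B" using W by (simp add: B_def poly_roots_finite)
  moreover have "card {z. poly q z \<noteq> 0 \<and> poly p z / poly q z = w} = d" if w: "w \<notin> B" for w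
  proof -
    define r where "r = p - smult w q"
    have nocommon: "poly q z \<noteq> 0 \<or> poly p z \<noteq> 0" for z
    proof (rule ccontr)
      assume "\<not> ?thesis"
      then have "[:-z, 1:] dvd p" "[:-z, 1:] dvd q" by (auto simp: poly_eq_0_iff_dvd)
      then have "is_unit [:-z, 1:]" using cop coprime_common_divisor by blast
      then show False by (simp add: is_unit_iff_degree)
    qed
    have fib: "{z. poly q z \<noteq> 0 \<and> poly p z / poly q z = w} = {z. poly r z = 0}"
      using nocommon by (auto simp: r_def field_simps)
    have "coeff p d \<noteq> w * coeff q d"
    proof
      assume h: "coeff p d = w * coeff q d"
      show False
      proof (cases "coeff q d = 0")
        case True
        then have "coeff p d = 0" using h by simp
        then show False using True False
          unfolding d_def max_def by (metis leading_coeff_0_iff degree_0)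
      next
        case False
        then have "w = coeff p d / coeff q d" using h by simp
        then show False using w by (simp add: B_def)
      qed
    qed
    then have "d \<le> degree r" by (intro le_degree) (simp add: r_def)
    moreover have "degree r \<le> d"
      unfolding r_def d_def by (meson degree_diff_le degree_smult_le le_trans max.cobounded1 max.cobounded2)
    ultimately have deg: "degree r = d" by simp
    have "rsquarefree r"
      unfolding rsquarefree_roots
    proof (intro allI notI)
      fix z assume z: "poly r z = 0 \<and> poly (pderiv r) z = 0"
      then have 1: "poly p z = w * poly q z" and 2: "poly (pderiv p) z = w * poly (pderiv q) z"
        by (auto simp: r_def pderiv_diff pderiv_smult)
      have "poly W z = 0" by (simp add: W_def 1 2)
      moreover have "w = poly p z / poly q z" using nocommon[of z] 1 by auto
      ultimately show False using w by (auto simp: B_def)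
    qed
    then show ?thesis using card_roots_rsquarefree deg fib by simp
  qed
  ultimately show ?thesis unfolding d_def by (auto intro: finite_subset[of _ B])
qed

lemma rat_degree_generic_fibre:
  assumes "q \<noteq> 0"
  shows "finite {w. card {z. poly (q div gcd p q) z \<noteq> 0 \<and> rat_fun p q z = w} \<noteq> rat_degree p q}"
  unfolding rat_fun_def rat_degree_def
  using assms by (intro generic_fibre_coprime div_gcd_coprime) (auto simp: dvd_div_eq_0_iff)

text \<open>The topological degree of a map of the unit circle to itself.\<close>

definition circle_degree :: "(complex \<Rightarrow> complex) \<Rightarrow> int" where
  "circle_degree h = (THE n. winding_number (h \<circ> circlepath 0 1) 0 = of_int n)"

definition f_tilde :: "complex poly \<Rightarrow> complex poly \<Rightarrow> complex \<Rightarrow> complex" where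
  "f_tilde b\<^sub>1 b\<^sub>2 = rat_fun (b\<^sub>1 + smult \<i> b\<^sub>2) (b\<^sub>1 - smult \<i> b\<^sub>2)"

end

theory Submission
  imports Defs
begin

text \<open>For $b \in \mathcal B_a$ the imaginary periods make $h_b = \mathrm{Re} \int \Theta_b$, taken odd under the
  hyperelliptic involution, a single-valued harmonic function on the curve; it vanishes at the branch
  points other than the two over $0$ and $\infty$, and, by the reflection $\lambda \mapsto 1/\bar\lambda$, over the unit
  circle. By the maximum principle $b$ is determined by $b(0)$, so $b_1, b_2$ may be replaced by $c_1 \pm i c_2$.
  Since $|c_1 + i c_2| = |c_1 - i c_2|$ on the circle, $\tilde f$ is a quotient of Blaschke products with $m \ge 1$ zeros
  (one of them $0$) and $k$ poles in the disc, so $\deg f = m + k$ and $n(\tilde f) = m - k$. If $k = 0$, then $|\tilde f| < 1$ in the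
  disc; as $\partial H / \bar\partial H$ is $\tilde f$ up to a unimodular factor, the map $H = h_{c_1} + i h_{c_2}$ then
  reverses orientation. It has one simple pole over the disc, hence degree one, and this is incompatible
  with a zero of $H$ at a branch point in the disc in addition to the zeros on the circle. So $k = 0$
  forces $g = 0$.\<close>

section \<open>Integrals along paths on the curve\<close>

text \<open>The value of H over x is fixed only up to sign, so F = H^2 is a function on the disc,
  and K = 1/F is the map that is studied. The pole of H over 0, simple in s = sqrt x, becomes a
  simple zero of K, and K tends to infinity at the zeros of H. Hence K is proper, and its fibre over
  0 is a single point. A proper local homeomorphism onto a connected target with a one-point fibre
  is a homeomorphism; this takes the place of a degree theory for maps of surfaces with boundary.
  Local injectivity can fail at zeros of c1 - i c2 in the disc, so the finitely many values of K
  there are removed from the target, which stays connected. The normalisation c1(0) = 1, c2(0) = i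
  makes the pole of H antiholomorphic, conj(A/s), and puts a zero of c1 + i c2 at 0; this is the
  zero behind m >= 1. The constant of integration of h is fixed by taking half the integral from (x,
  -y) to (x, y): oddness is then reversal of paths, and no base point is needed. Since deg f - n =
  2k and deg f + n = 2m, the bound |n| <= deg f - 2 says that m and k are both positive. For g = 0,
  deg f <= g + 1 leaves only m = 1, k = 0.\<close>

definition etale_curve :: "complex poly \<Rightarrow> (complex \<times> complex) set" where
  "etale_curve a = {(x, y) \<in> curve a. y \<noteq> 0}"

definition primitive_at ::
  "complex poly \<Rightarrow> (real \<Rightarrow> complex \<times> complex) \<Rightarrow> (real \<Rightarrow> complex) \<Rightarrow> real \<Rightarrow> bool" where
  "primitive_at b \<gamma> \<phi> t \<longleftrightarrow> (\<exists>u v. (\<gamma> has_vector_derivative (u, v)) (at t) \<and>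
     (\<phi> has_vector_derivative (poly b (fst (\<gamma> t)) / fst (\<gamma> t) * (u / snd (\<gamma> t)))) (at t))"

lemma primitive_atI:
  assumes "(\<gamma> has_vector_derivative (u, v)) (at t)" "(\<phi> has_vector_derivative w) (at t)"
    and "w = poly b (fst (\<gamma> t)) / fst (\<gamma> t) * (u / snd (\<gamma> t))"
  shows "primitive_at b \<gamma> \<phi> t"
  using assms unfolding primitive_at_def by blast

text \<open>Integrals are recorded by a continuous primitive along the path. Joining, reversing and
  reflecting paths is then a matter of the chain rule, and integrability comes for free from the
  fundamental theorem of calculus. The finite set \<open>S\<close> holds the corners of the
  path.\<close>

definition primitive_along ::
  "complex poly \<Rightarrow> (real \<Rightarrow> complex \<times> complex) \<Rightarrow> (real \<Rightarrow> complex) \<Rightarrow> bool" where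
  "primitive_along b \<gamma> \<phi> \<longleftrightarrow>
     path \<phi> \<and> (\<exists>S. finite S \<and> (\<forall>t\<in>{0<..<1} - S. primitive_at b \<gamma> \<phi> t))"

text \<open>A relation, because the value depends on the path: two values with the same endpoints
  differ by a period.\<close>

definition integral_along ::
  "complex poly \<Rightarrow> complex poly \<Rightarrow> complex \<times> complex \<Rightarrow> complex \<times> complex \<Rightarrow> complex \<Rightarrow> bool" where
  "integral_along a b P Q v \<longleftrightarrow> (\<exists>\<gamma> \<phi>. valid_path \<gamma> \<and> path_image \<gamma> \<subseteq> etale_curve a \<and>
     pathstart \<gamma> = P \<and> pathfinish \<gamma> = Q \<and> primitive_along b \<gamma> \<phi> \<and>
     pathfinish \<phi> - pathstart \<phi> = v)"

lemma has_vector_derivative_joinpaths1: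
  assumes "(g has_vector_derivative D) (at (2 * t))" "t < 1/2"
  shows "((g +++ h) has_vector_derivative 2 *\<^sub>R D) (at t)"
proof -
  have "((g \<circ> (\<lambda>t. 2 * t)) has_vector_derivative 2 *\<^sub>R D) (at t)"
    using assms(1) by (intro vector_diff_chain_at) (auto intro!: derivative_eq_intros)
  then show ?thesis
    by (rule has_vector_derivative_transform_within_open[where S = "{..<1/2}"])
       (use assms(2) in \<open>auto simp: joinpaths_def\<close>)
qed

lemma has_vector_derivative_joinpaths2:
  assumes "(h has_vector_derivative D) (at (2 * t - 1))" "t > 1/2"
  shows "((g +++ h) has_vector_derivative 2 *\<^sub>R D) (at t)"
proof -
  have "((h \<circ> (\<lambda>t. 2 * t - 1)) has_vector_derivative 2 *\<^sub>R D) (at t)"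
    using assms(1) by (intro vector_diff_chain_at) (auto intro!: derivative_eq_intros)
  then show ?thesis
    by (rule has_vector_derivative_transform_within_open[where S = "{1/2<..}"])
       (use assms(2) in \<open>auto simp: joinpaths_def\<close>)
qed

lemma has_vector_derivative_reversepath:
  assumes "(g has_vector_derivative D) (at (1 - t))"
  shows "(reversepath g has_vector_derivative - D) (at t)"
proof -
  have "((g \<circ> (\<lambda>t. 1 - t)) has_vector_derivative (-1) *\<^sub>R D) (at t)"
    using assms by (intro vector_diff_chain_at) (auto intro!: derivative_eq_intros)
  then show ?thesis by (simp add: reversepath_def o_def)
qed

lemma primitive_along_join:
  assumes "primitive_along b \<gamma> \<phi>" "primitive_along b \<gamma>' \<phi>'" "pathfinish \<phi> = pathstart \<phi>'"
  shows "primitive_along b (\<gamma> +++ \<gamma>') (\<phi> +++ \<phi>')"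
proof -
  obtain S where S: "finite S" "\<And>t. t \<in> {0<..<1} - S \<Longrightarrow> primitive_at b \<gamma> \<phi> t"
    using assms(1) unfolding primitive_along_def by blast
  obtain S' where S': "finite S'" "\<And>t. t \<in> {0<..<1} - S' \<Longrightarrow> primitive_at b \<gamma>' \<phi>' t"
    using assms(2) unfolding primitive_along_def by blast
  define T where "T = {1/2} \<union> (\<lambda>s. s / 2) ` S \<union> (\<lambda>s. (s + 1) / 2) ` S'"
  have "primitive_at b (\<gamma> +++ \<gamma>') (\<phi> +++ \<phi>') t" if t: "t \<in> {0<..<1} - T" for t
  proof (cases "t < 1/2")
    case True
    have "2 * t \<notin> S"
    proof
      assume "2 * t \<in> S"
      then have "2 * t / 2 \<in> T" unfolding T_def by blast
      then show False using t by simp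
    qed
    then have "primitive_at b \<gamma> \<phi> (2 * t)" using S(2)[of "2 * t"] True t by simp
    then obtain u v where "(\<gamma> has_vector_derivative (u, v)) (at (2 * t))"
      "(\<phi> has_vector_derivative (poly b (fst (\<gamma> (2 * t))) / fst (\<gamma> (2 * t)) * (u / snd (\<gamma> (2 * t))))) (at (2 * t))"
      unfolding primitive_at_def by blast
    note d1 = has_vector_derivative_joinpaths1[OF this(1) True, of \<gamma>']
      and d2 = has_vector_derivative_joinpaths1[OF this(2) True, of \<phi>']
    have "((\<gamma> +++ \<gamma>') has_vector_derivative (2 *\<^sub>R u, 2 *\<^sub>R v)) (at t)"
      using d1 by simp
    then show ?thesis
      by (rule primitive_atI[OF _ d2]) (use True in \<open>simp add: joinpaths_def scaleR_conv_of_real\<close>)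
  next
    case False
    then have gt: "t > 1/2" using t unfolding T_def by auto
    have "2 * t - 1 \<notin> S'"
    proof
      assume "2 * t - 1 \<in> S'"
      then have "((2 * t - 1) + 1) / 2 \<in> T" unfolding T_def by blast
      then show False using t by simp
    qed
    then have "primitive_at b \<gamma>' \<phi>' (2 * t - 1)" using S'(2)[of "2 * t - 1"] gt t by simp
    then obtain u v where "(\<gamma>' has_vector_derivative (u, v)) (at (2 * t - 1))"
      "(\<phi>' has_vector_derivative (poly b (fst (\<gamma>' (2 * t - 1))) / fst (\<gamma>' (2 * t - 1)) * (u / snd (\<gamma>' (2 * t - 1))))) (at (2 * t - 1))"
      unfolding primitive_at_def by blast
    note d1 = has_vector_derivative_joinpaths2[OF this(1) gt, of \<gamma>]
      and d2 = has_vector_derivative_joinpaths2[OF this(2) gt, of \<phi>]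
    have "((\<gamma> +++ \<gamma>') has_vector_derivative (2 *\<^sub>R u, 2 *\<^sub>R v)) (at t)"
      using d1 by simp
    then show ?thesis
      by (rule primitive_atI[OF _ d2]) (use gt in \<open>simp add: joinpaths_def scaleR_conv_of_real\<close>)
  qed
  moreover have "finite T" using S(1) S'(1) by (simp add: T_def)
  moreover have "path (\<phi> +++ \<phi>')" using assms by (simp add: primitive_along_def)
  ultimately show ?thesis unfolding primitive_along_def by blast
qed

lemma primitive_along_reverse:
  assumes "primitive_along b \<gamma> \<phi>"
  shows "primitive_along b (reversepath \<gamma>) (reversepath \<phi>)"
proof -
  obtain S where S: "finite S" "\<And>t. t \<in> {0<..<1} - S \<Longrightarrow> primitive_at b \<gamma> \<phi> t"
    using assms(1) unfolding primitive_along_def by blast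
  define T where "T = (\<lambda>s. 1 - s) ` S"
  have "primitive_at b (reversepath \<gamma>) (reversepath \<phi>) t" if t: "t \<in> {0<..<1} - T" for t
  proof -
    have "1 - t \<notin> S"
    proof
      assume "1 - t \<in> S"
      then have "1 - (1 - t) \<in> T" unfolding T_def by blast
      then show False using t by simp
    qed
    then have "primitive_at b \<gamma> \<phi> (1 - t)" using S(2)[of "1 - t"] t by simp
    then obtain u v where "(\<gamma> has_vector_derivative (u, v)) (at (1 - t))"
      "(\<phi> has_vector_derivative (poly b (fst (\<gamma> (1 - t))) / fst (\<gamma> (1 - t)) * (u / snd (\<gamma> (1 - t))))) (at (1 - t))"
      unfolding primitive_at_def by blast
    from has_vector_derivative_reversepath[OF this(1)] has_vector_derivative_reversepath[OF this(2)]
    show ?thesis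
      by (intro primitive_atI[of "reversepath \<gamma>" "- u" "- v"]) (auto simp: reversepath_def)
  qed
  moreover have "finite T" using S(1) by (simp add: T_def)
  moreover have "path (reversepath \<phi>)" using assms by (simp add: primitive_along_def)
  ultimately show ?thesis unfolding primitive_along_def by blast
qed

lemma primitive_along_add_const:
  assumes "primitive_along b \<gamma> \<phi>"
  shows "primitive_along b \<gamma> (\<lambda>t. \<phi> t + c)"
proof -
  have "path (\<lambda>t. \<phi> t + c)"
    using assms unfolding primitive_along_def path_def by (auto intro!: continuous_intros)
  moreover have "primitive_at b \<gamma> (\<lambda>t. \<phi> t + c) t" if pt: "primitive_at b \<gamma> \<phi> t" for t
  proof -
    obtain u v where 1: "(\<gamma> has_vector_derivative (u, v)) (at t)" and
      2: "(\<phi> has_vector_derivative (poly b (fst (\<gamma> t)) / fst (\<gamma> t) * (u / snd (\<gamma> t)))) (at t)"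
      using pt unfolding primitive_at_def by blast
    then show ?thesis
      using has_vector_derivative_add[OF 2 has_vector_derivative_const[of c]]
      unfolding primitive_at_def by auto
  qed
  ultimately show ?thesis using assms unfolding primitive_along_def by blast
qed

lemma integral_along_trans:
  assumes "integral_along a b P Q v" "integral_along a b Q R w"
  shows "integral_along a b P R (v + w)"
proof -
  obtain \<gamma> \<phi> where 1: "valid_path \<gamma>" "path_image \<gamma> \<subseteq> etale_curve a" "pathstart \<gamma> = P" "pathfinish \<gamma> = Q"
    "primitive_along b \<gamma> \<phi>" "pathfinish \<phi> - pathstart \<phi> = v"
    using assms(1) unfolding integral_along_def by blast
  obtain \<gamma>' \<phi>' where 2: "valid_path \<gamma>'" "path_image \<gamma>' \<subseteq> etale_curve a" "pathstart \<gamma>' = Q" "pathfinish \<gamma>' = R"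
    "primitive_along b \<gamma>' \<phi>'" "pathfinish \<phi>' - pathstart \<phi>' = w"
    using assms(2) unfolding integral_along_def by blast
  \<comment> \<open>The second primitive is shifted to begin where the first one ends; otherwise the
    joined primitive would jump.\<close>
  define \<psi> where "\<psi> = (\<lambda>t. \<phi>' t + (pathfinish \<phi> - pathstart \<phi>'))"
  have \<psi>: "primitive_along b \<gamma>' \<psi>"
    unfolding \<psi>_def using 2 by (intro primitive_along_add_const)
  have ends: "pathstart \<psi> = pathfinish \<phi>" "pathfinish \<psi> = w + pathfinish \<phi>"
    using 2(6) by (auto simp: \<psi>_def pathstart_def pathfinish_def)
  show ?thesis unfolding integral_along_def
    using 1 2 \<psi> ends
    by (intro exI[of _ "\<gamma> +++ \<gamma>'"] exI[of _ "\<phi> +++ \<psi>"] conjI primitive_along_join)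
       (auto simp: valid_path_join path_image_join)
qed

lemma integral_along_sym:
  assumes "integral_along a b P Q v"
  shows "integral_along a b Q P (- v)"
proof -
  obtain \<gamma> \<phi> where 1: "valid_path \<gamma>" "path_image \<gamma> \<subseteq> etale_curve a" "pathstart \<gamma> = P" "pathfinish \<gamma> = Q"
    "primitive_along b \<gamma> \<phi>" "pathfinish \<phi> - pathstart \<phi> = v"
    using assms(1) unfolding integral_along_def by blast
  then show ?thesis unfolding integral_along_def
    by (intro exI[of _ "reversepath \<gamma>"] exI[of _ "reversepath \<phi>"] conjI primitive_along_reverse) auto
qed

text \<open>Away from y = 0 the form \<open>theta\<close> uses only its first branch, so the
  fundamental theorem of calculus with finitely many exceptional points applies. This connects
  primitives with the \<open>period\<close> that occurs in \<open>imag_period_polys\<close>.\<close>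

lemma integral_along_period:
  assumes "integral_along a b P P v"
  obtains \<gamma> where "valid_path \<gamma>" "path_image \<gamma> \<subseteq> curve a" "pathfinish \<gamma> = pathstart \<gamma>" "period a b \<gamma> = v"
proof -
  obtain \<gamma> \<phi> where 1: "valid_path \<gamma>" "path_image \<gamma> \<subseteq> etale_curve a" "pathstart \<gamma> = P" "pathfinish \<gamma> = P"
    "primitive_along b \<gamma> \<phi>" "pathfinish \<phi> - pathstart \<phi> = v"
    using assms(1) unfolding integral_along_def by blast
  obtain S where S: "finite S" "\<And>t. t \<in> {0<..<1} - S \<Longrightarrow> primitive_at b \<gamma> \<phi> t"
    using 1(5) unfolding primitive_along_def by blast
  have "((\<lambda>t. theta a b (\<gamma> t) (vector_derivative \<gamma> (at t within {0..1}))) has_integral \<phi> 1 - \<phi> 0) {0..1}"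
  proof (rule fundamental_theorem_of_calculus_interior_strong[OF S(1)])
    show "continuous_on {0..1} \<phi>" using 1(5) by (simp add: primitive_along_def path_def)
    fix t :: real assume t: "t \<in> {0<..<1} - S"
    then obtain u v where uv: "(\<gamma> has_vector_derivative (u, v)) (at t)"
     "(\<phi> has_vector_derivative (poly b (fst (\<gamma> t)) / fst (\<gamma> t) * (u / snd (\<gamma> t)))) (at t)"
      using S(2)[of t] unfolding primitive_at_def by blast
    have "\<gamma> t \<in> etale_curve a" using 1(2) t by (auto simp: path_image_def image_subset_iff)
    then have "snd (\<gamma> t) \<noteq> 0" by (auto simp: etale_curve_def)
    moreover have "vector_derivative \<gamma> (at t within {0..1}) = (u, v)"
      using t uv(1) by (intro vector_derivative_at_within_ivl) auto
    ultimately show "(\<phi> has_vector_derivative theta a b (\<gamma> t) (vector_derivative \<gamma> (at t within {0..1}))) (at t)"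
      using uv(2) by (simp add: theta_def case_prod_beta mult.commute)
  qed simp
  then have "period a b \<gamma> = v"
    using 1(6) unfolding period_def by (auto simp: pathstart_def pathfinish_def dest: integral_unique)
  with 1 show ?thesis by (intro that[of \<gamma>]) (auto simp: etale_curve_def)
qed

lemma C1_differentiable_on_Pair:
  assumes "f C1_differentiable_on S" "h C1_differentiable_on S"
  shows "(\<lambda>t. (f t, h t)) C1_differentiable_on S"
proof -
  obtain D E where "\<forall>x\<in>S. (f has_vector_derivative D x) (at x)" "continuous_on S D"
    "\<forall>x\<in>S. (h has_vector_derivative E x) (at x)" "continuous_on S E"
    using assms unfolding C1_differentiable_on_def by blast
  then show ?thesis unfolding C1_differentiable_on_def
    by (intro exI[of _ "\<lambda>x. (D x, E x)"]) (auto intro!: has_vector_derivative_Pair continuous_on_Pair)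
qed

lemma valid_path_Pair:
  assumes "valid_path f" "valid_path h"
  shows "valid_path (\<lambda>t. (f t, h t))"
proof -
  obtain S T where "finite S" "f C1_differentiable_on {0..1} - S" "finite T" "h C1_differentiable_on {0..1} - T"
    "continuous_on {0..1} f" "continuous_on {0..1} h"
    using assms unfolding valid_path_def piecewise_C1_differentiable_on_def by blast
  then show ?thesis
    unfolding valid_path_def piecewise_C1_differentiable_on_def
    by (intro conjI exI[of _ "S \<union> T"] continuous_on_Pair C1_differentiable_on_Pair)
       (auto intro: C1_differentiable_on_subset)
qed

text \<open>Lifts a path from a parameter domain to the curve. It serves for the sheets, where x
  itself is the parameter, and for the neighbourhoods of branch points, where x = \<alpha> +
  s^2.\<close>

lemma integral_along_param:
  assumes U: "open U" and hol: "X holomorphic_on U" "Y holomorphic_on U"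
    and curve: "\<And>s. s \<in> U \<Longrightarrow> (X s, Y s) \<in> etale_curve a"
    and \<Phi>: "\<And>s. s \<in> U \<Longrightarrow> (\<Phi> has_field_derivative poly b (X s) * deriv X s / (X s * Y s)) (at s)"
    and \<sigma>: "valid_path \<sigma>" "path_image \<sigma> \<subseteq> U"
  shows "integral_along a b (X (pathstart \<sigma>), Y (pathstart \<sigma>)) (X (pathfinish \<sigma>), Y (pathfinish \<sigma>))
           (\<Phi> (pathfinish \<sigma>) - \<Phi> (pathstart \<sigma>))"
proof -
  have in_U: "\<sigma> t \<in> U" if "t \<in> {0..1}" for t using \<sigma>(2) that by (auto simp: path_image_def)
  have vX: "valid_path (X \<circ> \<sigma>)" "valid_path (Y \<circ> \<sigma>)"
    using valid_path_compose_holomorphic[OF \<sigma>(1) _ U \<sigma>(2)] hol by blast+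
  define \<gamma> where "\<gamma> = (\<lambda>t. ((X \<circ> \<sigma>) t, (Y \<circ> \<sigma>) t))"
  have "valid_path \<gamma>" unfolding \<gamma>_def by (intro valid_path_Pair vX)
  moreover have "path_image \<gamma> \<subseteq> etale_curve a"
    using in_U curve by (auto simp: path_image_def \<gamma>_def)
  moreover have "primitive_along b \<gamma> (\<Phi> \<circ> \<sigma>)"
  proof -
    have "continuous_on U \<Phi>" using \<Phi> by (meson DERIV_continuous continuous_at_imp_continuous_on)
    then have "path (\<Phi> \<circ> \<sigma>)"
      using valid_path_imp_path[OF \<sigma>(1)] \<sigma>(2) by (intro path_continuous_image) (auto intro: continuous_on_subset)
    moreover obtain S D where S: "finite S" "\<forall>t\<in>{0..1} - S. (\<sigma> has_vector_derivative D t) (at t)"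
      using \<sigma>(1) unfolding valid_path_def piecewise_C1_differentiable_on_def C1_differentiable_on_def by blast
    moreover have "primitive_at b \<gamma> (\<Phi> \<circ> \<sigma>) t"
      if t: "t \<in> {0<..<1} - S" for t
    proof -
      have d: "(\<sigma> has_vector_derivative D t) (at t)" using S(2) t by auto
      have inU: "\<sigma> t \<in> U" using t in_U by auto
      have "((X \<circ> \<sigma>) has_vector_derivative D t * deriv X (\<sigma> t)) (at t)"
        "((Y \<circ> \<sigma>) has_vector_derivative D t * deriv Y (\<sigma> t)) (at t)"
        using hol U inU d
        by (auto intro!: field_vector_diff_chain_at holomorphic_derivI)
      then have "(\<gamma> has_vector_derivative (D t * deriv X (\<sigma> t), D t * deriv Y (\<sigma> t))) (at t)"
        unfolding \<gamma>_def by (rule has_vector_derivative_Pair)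
      moreover have "((\<Phi> \<circ> \<sigma>) has_vector_derivative D t * (poly b (X (\<sigma> t)) * deriv X (\<sigma> t) / (X (\<sigma> t) * Y (\<sigma> t)))) (at t)"
        by (intro field_vector_diff_chain_at d \<Phi> inU)
      ultimately show ?thesis
        by (rule primitive_atI) (simp add: \<gamma>_def field_simps)
    qed
    ultimately show ?thesis unfolding primitive_along_def by blast
  qed
  ultimately show ?thesis unfolding integral_along_def
    by (intro exI[of _ \<gamma>] exI[of _ "\<Phi> \<circ> \<sigma>"]) (auto simp: \<gamma>_def pathstart_def pathfinish_def)
qed

section \<open>The antiholomorphic reflection of the curve\<close>

lemma valid_path_fst: "valid_path \<gamma> \<Longrightarrow> valid_path (fst \<circ> \<gamma>)"
  and valid_path_snd: "valid_path \<gamma> \<Longrightarrow> valid_path (snd \<circ> \<gamma>)"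
  for \<gamma> :: "real \<Rightarrow> 'a::real_normed_vector \<times> 'b::real_normed_vector"
proof -
  assume "valid_path \<gamma>"
  then obtain S D where S: "finite S" "\<And>t. t \<in> {0..1} - S \<Longrightarrow> (\<gamma> has_vector_derivative D t) (at t)"
    "continuous_on ({0..1} - S) D" "continuous_on {0..1} \<gamma>"
    unfolding valid_path_def piecewise_C1_differentiable_on_def C1_differentiable_on_def by blast
  have "((fst \<circ> \<gamma>) has_vector_derivative fst (D t)) (at t)"
    "((snd \<circ> \<gamma>) has_vector_derivative snd (D t)) (at t)" if "t \<in> {0..1} - S" for t
    unfolding o_def using S(2)[OF that]
    by (auto intro: bounded_linear.has_vector_derivative[OF bounded_linear_fst]
        bounded_linear.has_vector_derivative[OF bounded_linear_snd])
  then show "valid_path (fst \<circ> \<gamma>)" "valid_path (snd \<circ> \<gamma>)"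
    unfolding valid_path_def piecewise_C1_differentiable_on_def C1_differentiable_on_def
    using S(1,3,4)
    by (auto intro!: exI[of _ S] exI[of _ "\<lambda>t. fst (D t)"] exI[of _ "\<lambda>t. snd (D t)"]
        continuous_on_fst continuous_on_snd simp: o_def)
qed

lemma valid_path_mult:
  fixes f h :: "real \<Rightarrow> complex"
  assumes "valid_path f" "valid_path h"
  shows "valid_path (\<lambda>t. f t * h t)"
proof -
  obtain S T where "finite S" "f C1_differentiable_on {0..1} - S" "finite T" "h C1_differentiable_on {0..1} - T"
    "continuous_on {0..1} f" "continuous_on {0..1} h"
    using assms unfolding valid_path_def piecewise_C1_differentiable_on_def by blast
  then show ?thesis
    unfolding valid_path_def piecewise_C1_differentiable_on_def
    by (intro conjI exI[of _ "S \<union> T"] continuous_on_mult C1_differentiable_on_mult)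
       (auto intro: C1_differentiable_on_subset)
qed

text \<open>Reversing the order of summation turns the symmetry of the coefficients into a
  functional equation for x -> 1 / cnj x.\<close>

lemma poly_real_polys_reflect:
  assumes "b \<in> real_polys d" "x \<noteq> 0"
  shows "poly b (inverse (cnj x)) = cnj (poly b x) / cnj x ^ d"
proof -
  have deg: "degree b \<le> d" and sym: "\<And>i. i \<le> d \<Longrightarrow> coeff b (d - i) = cnj (coeff b i)"
    using assms(1) by (auto simp: real_polys_def)
  have expand: "poly b z = (\<Sum>i\<le>d. coeff b i * z ^ i)" for z
    unfolding poly_altdef using deg by (intro sum.mono_neutral_left) (auto simp: coeff_eq_0)
  have "poly b (inverse (cnj x)) * cnj x ^ d = (\<Sum>i\<le>d. coeff b i * cnj x ^ (d - i))"
    unfolding expand sum_distrib_right using assms(2)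
    by (intro sum.cong) (auto simp: power_diff field_simps power_inverse)
  also have "\<dots> = (\<Sum>i\<le>d. coeff b (d - i) * cnj x ^ i)"
    by (rule sum.reindex_bij_witness[of _ "\<lambda>i. d - i" "\<lambda>i. d - i"]) auto
  also have "\<dots> = cnj (poly b x)"
    unfolding expand by (simp add: sym)
  finally show ?thesis using assms(2) by (simp add: field_simps)
qed

lemma etale_curve_iff: "(x, y) \<in> etale_curve a \<longleftrightarrow> y\<^sup>2 = x * poly a x \<and> x * poly a x \<noteq> 0"
  by (auto simp: etale_curve_def curve_def)

text \<open>The map (x, y) -> (1 / cnj x, cnj y / cnj x ^ (g+1)) preserves the curve and pulls
  Theta_b back to - cnj Theta_b: the weights g+1 of b and y cancel, and dx / x becomes its negative
  conjugate.\<close>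

lemma integral_along_reflect:
  assumes a: "a \<in> real_polys (2 * g)" and b: "b \<in> real_polys (g + 1)"
    and int: "integral_along a b (x0, y0) (x1, y1) v"
  shows "integral_along a b (inverse (cnj x0), cnj y0 * inverse (cnj x0) ^ (g + 1))
    (inverse (cnj x1), cnj y1 * inverse (cnj x1) ^ (g + 1)) (- cnj v)"
proof -
  obtain \<gamma> \<phi> where 1: "valid_path \<gamma>" "path_image \<gamma> \<subseteq> etale_curve a" "pathstart \<gamma> = (x0, y0)"
    "pathfinish \<gamma> = (x1, y1)" "primitive_along b \<gamma> \<phi>" "pathfinish \<phi> - pathstart \<phi> = v"
    using int unfolding integral_along_def by blast
  define \<xi> where "\<xi> = (\<lambda>t. inverse (cnj (fst (\<gamma> t))))"
  define \<eta> where "\<eta> = (\<lambda>t. cnj (snd (\<gamma> t)) * \<xi> t ^ (g + 1))"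
  define \<gamma>' where "\<gamma>' = (\<lambda>t. (\<xi> t, \<eta> t))"
  have on: "snd (\<gamma> t) \<noteq> 0" "fst (\<gamma> t) \<noteq> 0" "(snd (\<gamma> t))\<^sup>2 = fst (\<gamma> t) * poly a (fst (\<gamma> t))"
    if "t \<in> {0..1}" for t
  proof -
    have "\<gamma> t \<in> etale_curve a" using 1(2) that by (auto simp: path_image_def)
    then have "(fst (\<gamma> t), snd (\<gamma> t)) \<in> etale_curve a" by simp
    then show "snd (\<gamma> t) \<noteq> 0" "fst (\<gamma> t) \<noteq> 0" "(snd (\<gamma> t))\<^sup>2 = fst (\<gamma> t) * poly a (fst (\<gamma> t))"
      unfolding etale_curve_iff by auto
  qed
  have vx: "valid_path (cnj \<circ> (fst \<circ> \<gamma>))" "valid_path (cnj \<circ> (snd \<circ> \<gamma>))"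
    using 1(1) by (auto simp: valid_path_cnj intro: valid_path_fst valid_path_snd)
  have im: "path_image (cnj \<circ> (fst \<circ> \<gamma>)) \<subseteq> - {0}"
    using on by (auto simp: path_image_def)
  have "valid_path (inverse \<circ> (cnj \<circ> (fst \<circ> \<gamma>)))" "valid_path ((\<lambda>x. inverse x ^ (g + 1)) \<circ> (cnj \<circ> (fst \<circ> \<gamma>)))"
    by (rule valid_path_compose_holomorphic[OF vx(1) _ _ im]; force intro!: holomorphic_intros)+
  from this(1) valid_path_mult[OF vx(2) this(2)] have "valid_path \<xi>" "valid_path \<eta>"
    unfolding \<xi>_def \<eta>_def by (simp_all add: o_def)
  then have v': "valid_path \<gamma>'" unfolding \<gamma>'_def by (rule valid_path_Pair)
  have curve': "path_image \<gamma>' \<subseteq> etale_curve a"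
  proof -
    have "(\<xi> t, \<eta> t) \<in> etale_curve a" if t: "t \<in> {0..1}" for t
    proof -
      have "cnj (fst (\<gamma> t)) \<noteq> 0" "cnj (snd (\<gamma> t)) \<noteq> 0" using on[OF t] by auto
      moreover have "cnj ((snd (\<gamma> t))\<^sup>2) = cnj (fst (\<gamma> t) * poly a (fst (\<gamma> t)))"
        using on(3)[OF t] by simp
      then have "(cnj (snd (\<gamma> t)))\<^sup>2 = cnj (fst (\<gamma> t)) * cnj (poly a (fst (\<gamma> t)))" by simp
      ultimately have "(\<eta> t)\<^sup>2 = \<xi> t * poly a (\<xi> t)" "\<eta> t \<noteq> 0" "\<xi> t \<noteq> 0"
        using poly_real_polys_reflect[OF a on(2)[OF t]] unfolding \<xi>_def \<eta>_def
        by (auto simp: power_mult_distrib power_mult power_inverse field_simps power_even_eq power2_eq_square)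
      then show ?thesis unfolding etale_curve_iff by force
    qed
    then show ?thesis by (auto simp: path_image_def \<gamma>'_def)
  qed
  have prim': "primitive_along b \<gamma>' (\<lambda>t. - cnj (\<phi> t))"
  proof -
    obtain S where S: "finite S" "\<And>t. t \<in> {0<..<1} - S \<Longrightarrow> primitive_at b \<gamma> \<phi> t" and path: "path \<phi>"
      using 1(5) unfolding primitive_along_def by blast
    have "primitive_at b \<gamma>' (\<lambda>t. - cnj (\<phi> t)) t" if t: "t \<in> {0<..<1} - S" for t
    proof -
      obtain u v where uv: "(\<gamma> has_vector_derivative (u, v)) (at t)"
        "(\<phi> has_vector_derivative (poly b (fst (\<gamma> t)) / fst (\<gamma> t) * (u / snd (\<gamma> t)))) (at t)"
        using S(2)[OF t] unfolding primitive_at_def by blast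
      have t01: "t \<in> {0..1}" using t by auto
      have nz: "cnj (fst (\<gamma> t)) \<noteq> 0" "cnj (snd (\<gamma> t)) \<noteq> 0" using on[OF t01] by auto
      have x: "((\<lambda>t. cnj (fst (\<gamma> t))) has_vector_derivative cnj u) (at t)"
        using bounded_linear.has_vector_derivative[OF bounded_linear_fst uv(1)]
        by (auto intro!: has_vector_derivative_cnj)
      have y: "((\<lambda>t. cnj (snd (\<gamma> t))) has_vector_derivative cnj v) (at t)"
        using bounded_linear.has_vector_derivative[OF bounded_linear_snd uv(1)]
        by (auto intro!: has_vector_derivative_cnj)
      have "(inverse has_field_derivative (- (inverse (cnj (fst (\<gamma> t))))\<^sup>2)) (at (cnj (fst (\<gamma> t))))"
        using nz(1) by (auto intro!: derivative_eq_intros simp: power2_eq_square)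
      from field_vector_diff_chain_at[OF x this]
      have \<xi>': "(\<xi> has_vector_derivative cnj u * (- (inverse (cnj (fst (\<gamma> t))))\<^sup>2)) (at t)"
        unfolding \<xi>_def o_def .
      \<comment> \<open>Theta_b sees only the x-component of the velocity, so for the y-component it
        is enough that some derivative \<open>w\<close> exists.\<close>
      have "((\<lambda>z. z ^ (g + 1)) has_field_derivative deriv (\<lambda>z. z ^ (g + 1)) (\<xi> t)) (at (\<xi> t))"
        by (rule holomorphic_derivI[of _ UNIV]) (auto intro!: holomorphic_intros)
      from has_vector_derivative_mult[OF y field_vector_diff_chain_at[OF \<xi>' this]]
      obtain w where "(\<eta> has_vector_derivative w) (at t)"
        unfolding \<eta>_def o_def by blast
      with \<xi>' have "(\<gamma>' has_vector_derivative (cnj u * (- (inverse (cnj (fst (\<gamma> t))))\<^sup>2), w)) (at t)"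
        unfolding \<gamma>'_def by (rule has_vector_derivative_Pair)
      moreover have "((\<lambda>t. - cnj (\<phi> t)) has_vector_derivative
          - cnj (poly b (fst (\<gamma> t)) / fst (\<gamma> t) * (u / snd (\<gamma> t)))) (at t)"
        using uv(2) by (intro has_vector_derivative_minus has_vector_derivative_cnj)
      ultimately show ?thesis
        by (rule primitive_atI)
           (use nz poly_real_polys_reflect[OF b on(2)[OF t01]] in
             \<open>simp add: \<gamma>'_def \<eta>_def \<xi>_def field_simps power2_eq_square power_inverse\<close>)
    qed
    moreover have "path (\<lambda>t. - cnj (\<phi> t))"
      using path unfolding path_def by (intro continuous_intros)
    ultimately show ?thesis using S(1) unfolding primitive_along_def by blast
  qed
  have "pathstart \<gamma>' = (inverse (cnj x0), cnj y0 * inverse (cnj x0) ^ (g + 1))"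
    "pathfinish \<gamma>' = (inverse (cnj x1), cnj y1 * inverse (cnj x1) ^ (g + 1))"
    using 1(3,4) by (auto simp: \<gamma>'_def \<xi>_def \<eta>_def pathstart_def pathfinish_def)
  moreover have "pathfinish (\<lambda>t. - cnj (\<phi> t)) - pathstart (\<lambda>t. - cnj (\<phi> t)) = - cnj v"
    using 1(6) by (auto simp: pathstart_def pathfinish_def)
  ultimately show ?thesis unfolding integral_along_def using v' curve' prim' by blast
qed

text \<open>Segments stay in the convex set and lift by \<open>q\<close> or by \<open>- q\<close>.
  On the second sheet the form, hence the primitive, changes sign.\<close>

lemma integral_along_sheet:
  assumes B: "convex B" "open B" and q: "q holomorphic_on B"
    and sq: "\<forall>x\<in>B. (x, q x) \<in> etale_curve a"
    and \<Phi>: "\<forall>x\<in>B. (\<Phi> has_field_derivative poly b x / (x * q x)) (at x)"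
    and xx': "x \<in> B" "x' \<in> B"
  shows "integral_along a b (x, q x) (x', q x') (\<Phi> x' - \<Phi> x)"
    and "integral_along a b (x, - q x) (x', - q x') (\<Phi> x - \<Phi> x')"
proof -
  have seg: "path_image (linepath x x') \<subseteq> B"
    using B(1) xx' by (simp add: closed_segment_subset)
  have "integral_along a b (id (pathstart (linepath x x')), q (pathstart (linepath x x')))
     (id (pathfinish (linepath x x')), q (pathfinish (linepath x x')))
     (\<Phi> (pathfinish (linepath x x')) - \<Phi> (pathstart (linepath x x')))"
    by (rule integral_along_param[OF B(2) _ q])
       (use sq \<Phi> seg in \<open>auto simp: etale_curve_iff id_def intro!: holomorphic_intros\<close>)
  then show "integral_along a b (x, q x) (x', q x') (\<Phi> x' - \<Phi> x)" by simp
  have "integral_along a b (id (pathstart (linepath x x')), - q (pathstart (linepath x x')))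
     (id (pathfinish (linepath x x')), - q (pathfinish (linepath x x')))
     (- \<Phi> (pathfinish (linepath x x')) - - \<Phi> (pathstart (linepath x x')))"
  proof (rule integral_along_param[OF B(2), where Y = "\<lambda>x. - q x" and \<Phi> = "\<lambda>x. - \<Phi> x"])
    fix s assume s: "s \<in> B"
    show "((\<lambda>x. - \<Phi> x) has_field_derivative poly b (id s) * deriv id s / (id s * - q s)) (at s)"
      using DERIV_minus[OF \<Phi>[rule_format, OF s]] by (simp add: id_def)
  qed (use sq seg q in \<open>auto simp: etale_curve_iff id_def intro!: holomorphic_intros\<close>)
  then show "integral_along a b (x, - q x) (x', - q x') (\<Phi> x - \<Phi> x')" by simp
qed

text \<open>The segment from - s to s would run through 0, which is the branch point in the
  coordinate s and is not on \<open>etale_curve\<close>.\<close>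

lemma punctured_ball_path:
  fixes s s' :: complex
  assumes "s \<in> ball 0 r - {0}" "s' \<in> ball 0 r - {0}"
  obtains \<sigma> where "valid_path \<sigma>" "path_image \<sigma> \<subseteq> ball 0 r - {0}" "pathstart \<sigma> = s" "pathfinish \<sigma> = s'"
proof -
  have "open (ball 0 r - {0::complex})" "connected (ball 0 r - {0::complex})"
    using connected_punctured_ball[of "0::complex" r] by (auto simp: open_delete)
  from connected_open_polynomial_connected[OF this assms]
  show ?thesis using that valid_path_polynomial_function by blast
qed

text \<open>The points $0$ and the simple roots of $a$ are the branch points of the curve; near such a point
  $\alpha$, $s = \sqrt{x - \alpha}$ is a coordinate on the curve.\<close>

lemma integral_along_branch:
  assumes e: "e holomorphic_on ball \<alpha> r" and r: "r \<le> 1"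
    and sq: "\<And>x. x \<in> ball \<alpha> r \<Longrightarrow> x * poly a x = (x - \<alpha>) * (e x)\<^sup>2 \<and> e x \<noteq> 0"
    and \<Phi>: "\<And>s. s \<in> ball 0 r - {0} \<Longrightarrow>
      (\<Phi> has_field_derivative 2 * poly b (\<alpha> + s\<^sup>2) / ((\<alpha> + s\<^sup>2) * e (\<alpha> + s\<^sup>2))) (at s)"
    and s: "s \<in> ball 0 r - {0}"
  shows "integral_along a b (\<alpha> + s\<^sup>2, - (s * e (\<alpha> + s\<^sup>2))) (\<alpha> + s\<^sup>2, s * e (\<alpha> + s\<^sup>2)) (\<Phi> s - \<Phi> (- s))"
proof -
  \<comment> \<open>This is the purpose of \<open>r \<le> 1\<close>: squaring maps the disc of
    radius r into itself.\<close>
  have ball: "\<alpha> + s\<^sup>2 \<in> ball \<alpha> r" if "s \<in> ball 0 r" for s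
  proof -
    have "norm s * norm s \<le> norm s * 1" using that r by (intro mult_left_mono) auto
    then show ?thesis using that by (simp add: dist_norm norm_power power2_eq_square norm_mult)
  qed
  obtain \<sigma> where \<sigma>: "valid_path \<sigma>" "path_image \<sigma> \<subseteq> ball 0 r - {0}" "pathstart \<sigma> = - s" "pathfinish \<sigma> = s"
    by (rule punctured_ball_path[of "- s" r s]) (use s in auto)
  have "integral_along a b (\<alpha> + (pathstart \<sigma>)\<^sup>2, pathstart \<sigma> * e (\<alpha> + (pathstart \<sigma>)\<^sup>2))
     (\<alpha> + (pathfinish \<sigma>)\<^sup>2, pathfinish \<sigma> * e (\<alpha> + (pathfinish \<sigma>)\<^sup>2)) (\<Phi> (pathfinish \<sigma>) - \<Phi> (pathstart \<sigma>))"
  \<comment> \<open>Here dx = 2 s ds and y = s e(x). The factor s cancels, so the form in the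
    coordinate s has no singularity coming from y = 0.\<close>
  proof (rule integral_along_param[OF _ _ _ _ _ \<sigma>(1,2), where X = "\<lambda>s. \<alpha> + s\<^sup>2" and Y = "\<lambda>s. s * e (\<alpha> + s\<^sup>2)"])
    show "open (ball 0 r - {0::complex})" by (simp add: open_delete)
    show "(\<lambda>s. s * e (\<alpha> + s\<^sup>2)) holomorphic_on ball 0 r - {0}"
      using ball by (auto intro!: holomorphic_intros holomorphic_on_compose_gen[OF _ e, unfolded o_def])
    fix s :: complex assume s: "s \<in> ball 0 r - {0}"
    have "\<alpha> + s\<^sup>2 \<in> ball \<alpha> r" using s ball by auto
    from sq[OF this] s show "(\<alpha> + s\<^sup>2, s * e (\<alpha> + s\<^sup>2)) \<in> etale_curve a"
      by (auto simp: etale_curve_iff power_mult_distrib)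
    have "((\<lambda>s. \<alpha> + s\<^sup>2) has_field_derivative 2 * s) (at s)" by (auto intro!: derivative_eq_intros)
    then have "deriv (\<lambda>s. \<alpha> + s\<^sup>2) s = 2 * s" by (rule DERIV_imp_deriv)
    then show "(\<Phi> has_field_derivative poly b (\<alpha> + s\<^sup>2) * deriv (\<lambda>s. \<alpha> + s\<^sup>2) s /
        ((\<alpha> + s\<^sup>2) * (s * e (\<alpha> + s\<^sup>2)))) (at s)"
      using \<Phi>[OF s] s by (simp add: mult.left_commute[of _ s] mult.commute[of _ 2])
  qed (auto intro!: holomorphic_intros)
  then show ?thesis using \<sigma>(3,4) by simp
qed

section \<open>Harmonic potentials\<close>

text \<open>The properties of $h = h_b$ that survive real linear combinations: oddness, local primitives of $\Theta_b$,
  zeros at the branch points and over the circle, and the expansion in $s = \sqrt x$ at the point over $0$.\<close>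

definition potential :: "complex poly \<Rightarrow> complex poly \<Rightarrow> (complex \<times> complex \<Rightarrow> real) \<Rightarrow> bool" where
  "potential a b h \<longleftrightarrow>
     (\<forall>x y. (x, y) \<in> etale_curve a \<longrightarrow> h (x, - y) = - h (x, y)) \<and>
     (\<forall>B q. convex B \<longrightarrow> open B \<longrightarrow> q holomorphic_on B \<longrightarrow> (\<forall>x\<in>B. (x, q x) \<in> etale_curve a) \<longrightarrow>
        (\<exists>\<Phi>. \<forall>x\<in>B. (\<Phi> has_field_derivative poly b x / (x * q x)) (at x) \<and> h (x, q x) = Re (\<Phi> x))) \<and>
     (\<forall>\<alpha>. poly a \<alpha> = 0 \<longrightarrow> ((\<lambda>x. h (x, csqrt (x * poly a x))) \<longlongrightarrow> 0) (at \<alpha>)) \<and>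
     (\<forall>x y. (x, y) \<in> etale_curve a \<longrightarrow> norm x = 1 \<longrightarrow> h (x, y) = 0) \<and>
     (\<forall>e r. r \<le> 1 \<longrightarrow> e holomorphic_on ball 0 r \<longrightarrow> (\<forall>x\<in>ball 0 r. (e x)\<^sup>2 = poly a x \<and> e x \<noteq> 0) \<longrightarrow>
        (\<exists>M. M holomorphic_on ball 0 r \<and> (\<forall>s\<in>ball 0 r - {0}.
           h (s\<^sup>2, s * e (s\<^sup>2)) = Re (M s - 2 * poly b 0 / (e 0 * s)))))"

lemma potentialD:
  assumes "potential a b h"
  shows "\<And>x y. (x, y) \<in> etale_curve a \<Longrightarrow> h (x, - y) = - h (x, y)"
    and "\<And>B q. \<lbrakk>convex B; open B; q holomorphic_on B; \<forall>x\<in>B. (x, q x) \<in> etale_curve a\<rbrakk> \<Longrightarrow>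
        \<exists>\<Phi>. \<forall>x\<in>B. (\<Phi> has_field_derivative poly b x / (x * q x)) (at x) \<and> h (x, q x) = Re (\<Phi> x)"
    and "\<And>\<alpha>. poly a \<alpha> = 0 \<Longrightarrow> ((\<lambda>x. h (x, csqrt (x * poly a x))) \<longlongrightarrow> 0) (at \<alpha>)"
    and "\<And>x y. (x, y) \<in> etale_curve a \<Longrightarrow> norm x = 1 \<Longrightarrow> h (x, y) = 0"
    and "\<And>e r. \<lbrakk>r \<le> 1; e holomorphic_on ball 0 r; \<forall>x\<in>ball 0 r. (e x)\<^sup>2 = poly a x \<and> e x \<noteq> 0\<rbrakk> \<Longrightarrow>
        \<exists>M. M holomorphic_on ball 0 r \<and> (\<forall>s\<in>ball 0 r - {0}.
           h (s\<^sup>2, s * e (s\<^sup>2)) = Re (M s - 2 * poly b 0 / (e 0 * s)))"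
proof -
  note D = assms[unfolded potential_def]
  note D1 = D[THEN conjunct1, rule_format]
    and D2 = D[THEN conjunct2, THEN conjunct1, rule_format]
    and D3 = D[THEN conjunct2, THEN conjunct2, THEN conjunct1, rule_format]
    and D4 = D[THEN conjunct2, THEN conjunct2, THEN conjunct2, THEN conjunct1, rule_format]
    and D5 = D[THEN conjunct2, THEN conjunct2, THEN conjunct2, THEN conjunct2, rule_format]
  show "\<And>x y. (x, y) \<in> etale_curve a \<Longrightarrow> h (x, - y) = - h (x, y)" by (rule D1)
  show "\<And>B q. \<lbrakk>convex B; open B; q holomorphic_on B; \<forall>x\<in>B. (x, q x) \<in> etale_curve a\<rbrakk> \<Longrightarrow>
        \<exists>\<Phi>. \<forall>x\<in>B. (\<Phi> has_field_derivative poly b x / (x * q x)) (at x) \<and> h (x, q x) = Re (\<Phi> x)"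
    by (rule D2) auto
  show "\<And>\<alpha>. poly a \<alpha> = 0 \<Longrightarrow> ((\<lambda>x. h (x, csqrt (x * poly a x))) \<longlongrightarrow> 0) (at \<alpha>)" by (rule D3)
  show "\<And>x y. (x, y) \<in> etale_curve a \<Longrightarrow> norm x = 1 \<Longrightarrow> h (x, y) = 0" by (rule D4)
  show "\<And>e r. \<lbrakk>r \<le> 1; e holomorphic_on ball 0 r; \<forall>x\<in>ball 0 r. (e x)\<^sup>2 = poly a x \<and> e x \<noteq> 0\<rbrakk> \<Longrightarrow>
        \<exists>M. M holomorphic_on ball 0 r \<and> (\<forall>s\<in>ball 0 r - {0}.
           h (s\<^sup>2, s * e (s\<^sup>2)) = Re (M s - 2 * poly b 0 / (e 0 * s)))"
    by (rule D5) auto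
qed

lemma potential_lincomb:
  fixes s t :: real
  assumes 1: "potential a b h" and 2: "potential a c k"
  shows "potential a (smult (of_real s) b + smult (of_real t) c) (\<lambda>P. s * h P + t * k P)"
  unfolding potential_def
proof (intro conjI allI impI)
  fix x y :: complex assume xy: "(x, y) \<in> etale_curve a"
  show "s * h (x, - y) + t * k (x, - y) = - (s * h (x, y) + t * k (x, y))"
    using potentialD(1)[OF 1 xy] potentialD(1)[OF 2 xy] by simp
next
  fix B q assume B: "convex B" "open B" "q holomorphic_on B" "\<forall>x\<in>B. (x, q x) \<in> etale_curve a"
  obtain \<Phi> where \<Phi>: "\<forall>x\<in>B. (\<Phi> has_field_derivative poly b x / (x * q x)) (at x) \<and> h (x, q x) = Re (\<Phi> x)"
    using potentialD(2)[OF 1 B] by blast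
  obtain \<Psi> where \<Psi>: "\<forall>x\<in>B. (\<Psi> has_field_derivative poly c x / (x * q x)) (at x) \<and> k (x, q x) = Re (\<Psi> x)"
    using potentialD(2)[OF 2 B] by blast
  have "((\<lambda>x. of_real s * \<Phi> x + of_real t * \<Psi> x) has_field_derivative
      poly (smult (of_real s) b + smult (of_real t) c) x / (x * q x)) (at x) \<and>
      s * h (x, q x) + t * k (x, q x) = Re (of_real s * \<Phi> x + of_real t * \<Psi> x)" if "x \<in> B" for x
  proof -
    have "(\<Phi> has_field_derivative poly b x / (x * q x)) (at x)"
      "(\<Psi> has_field_derivative poly c x / (x * q x)) (at x)" using \<Phi> \<Psi> that by auto
    then have "((\<lambda>x. of_real s * \<Phi> x + of_real t * \<Psi> x) has_field_derivative
      of_real s * (poly b x / (x * q x)) + of_real t * (poly c x / (x * q x))) (at x)"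
      by (intro DERIV_add DERIV_cmult)
    then show ?thesis using \<Phi> \<Psi> that by (simp add: add_divide_distrib)
  qed
  then show "\<exists>\<Phi>. \<forall>x\<in>B. (\<Phi> has_field_derivative
      poly (smult (of_real s) b + smult (of_real t) c) x / (x * q x)) (at x) \<and>
      s * h (x, q x) + t * k (x, q x) = Re (\<Phi> x)" by blast
next
  fix \<alpha> assume \<alpha>: "poly a \<alpha> = 0"
  show "((\<lambda>x. s * h (x, csqrt (x * poly a x)) + t * k (x, csqrt (x * poly a x))) \<longlongrightarrow> 0) (at \<alpha>)"
    using tendsto_add[OF tendsto_mult_left[OF potentialD(3)[OF 1 \<alpha>], of s] tendsto_mult_left[OF potentialD(3)[OF 2 \<alpha>], of t]]
    by simp
next
  fix x y :: complex assume xy: "(x, y) \<in> etale_curve a" "norm x = 1"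
  show "s * h (x, y) + t * k (x, y) = 0"
    using potentialD(4)[OF 1 xy] potentialD(4)[OF 2 xy] by simp
next
  fix e r assume e: "r \<le> (1::real)" "e holomorphic_on ball 0 r" "\<forall>x\<in>ball 0 r. (e x)\<^sup>2 = poly a x \<and> e x \<noteq> 0"
  obtain M where M: "M holomorphic_on ball 0 r"
    "\<forall>s\<in>ball 0 r - {0}. h (s\<^sup>2, s * e (s\<^sup>2)) = Re (M s - 2 * poly b 0 / (e 0 * s))"
    using potentialD(5)[OF 1 e] by blast
  obtain N where N: "N holomorphic_on ball 0 r"
    "\<forall>s\<in>ball 0 r - {0}. k (s\<^sup>2, s * e (s\<^sup>2)) = Re (N s - 2 * poly c 0 / (e 0 * s))"
    using potentialD(5)[OF 2 e] by blast
  have "(\<lambda>z. of_real s * M z + of_real t * N z) holomorphic_on ball 0 r"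
    using M N by (auto intro!: holomorphic_intros)
  moreover have "\<forall>z\<in>ball 0 r - {0}. s * h (z\<^sup>2, z * e (z\<^sup>2)) + t * k (z\<^sup>2, z * e (z\<^sup>2)) =
      Re ((of_real s * M z + of_real t * N z) -
        2 * poly (smult (of_real s) b + smult (of_real t) c) 0 / (e 0 * z))"
  proof
    fix z :: complex assume z: "z \<in> ball 0 r - {0}"
    have "Re (of_real s * M z + of_real t * N z - 2 * poly (smult (of_real s) b + smult (of_real t) c) 0 / (e 0 * z))
      = Re (of_real s * (M z - 2 * poly b 0 / (e 0 * z)) + of_real t * (N z - 2 * poly c 0 / (e 0 * z)))"
      by (simp only: poly_add poly_smult) (simp add: algebra_simps add_divide_distrib)
    also have "\<dots> = s * h (z\<^sup>2, z * e (z\<^sup>2)) + t * k (z\<^sup>2, z * e (z\<^sup>2))"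
      using M(2) N(2) z by (simp del: minus_complex.sel)
    finally show "s * h (z\<^sup>2, z * e (z\<^sup>2)) + t * k (z\<^sup>2, z * e (z\<^sup>2)) =
      Re ((of_real s * M z + of_real t * N z) -
        2 * poly (smult (of_real s) b + smult (of_real t) c) 0 / (e 0 * z))" by simp
  qed
  ultimately show "\<exists>M. M holomorphic_on ball 0 r \<and>
      (\<forall>z\<in>ball 0 r - {0}. s * h (z\<^sup>2, z * e (z\<^sup>2)) + t * k (z\<^sup>2, z * e (z\<^sup>2)) =
        Re (M z - 2 * poly (smult (of_real s) b + smult (of_real t) c) 0 / (e 0 * z)))" by blast
qed

section \<open>Connecting the two sheets, and existence of the potential\<close>

lemma spectral_polys_basic:
  assumes "a \<in> spectral_polys g"
  shows "a \<noteq> 0" "poly a 0 \<noteq> 0" "a \<in> real_polys (2 * g)" "degree a = 2 * g" "rsquarefree a"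
proof -
  show a: "a \<noteq> 0" "a \<in> real_polys (2 * g)" "degree a = 2 * g" "rsquarefree a"
    using assms by (auto simp: spectral_polys_def)
  have "coeff a (2 * g - 0) = cnj (coeff a 0)"
    using a(2) unfolding real_polys_def by blast
  then show "poly a 0 \<noteq> 0" using a(1,3)
    by (metis complex_cnj_zero diff_zero leading_coeff_0_iff poly_0_coeff_0)
qed

lemma local_sqrt:
  fixes f :: "complex \<Rightarrow> complex"
  assumes "f holomorphic_on UNIV" "f x0 \<noteq> 0"
  shows "\<exists>r q. 0 < r \<and> r \<le> 1 \<and> q holomorphic_on ball x0 r \<and> (\<forall>x\<in>ball x0 r. (q x)\<^sup>2 = f x \<and> q x \<noteq> 0)"
proof -
  have "continuous_on UNIV f" using assms(1) by (rule holomorphic_on_imp_continuous_on)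
  then have "open (f -` (- {0}))" using continuous_on_open_vimage[of UNIV f] by auto
  then obtain r0 where r0: "r0 > 0" "ball x0 r0 \<subseteq> f -` (- {0})"
    using assms(2) open_contains_ball by (metis ComplI insertE empty_iff vimageI2)
  define r where "r = min r0 1"
  have r: "r > 0" "r \<le> 1" "\<And>x. x \<in> ball x0 r \<Longrightarrow> f x \<noteq> 0"
    using r0 by (auto simp: r_def subset_iff)
  obtain q where q: "q holomorphic_on ball x0 r" "\<And>x. x \<in> ball x0 r \<Longrightarrow> f x = (q x)\<^sup>2"
    using contractible_imp_holomorphic_sqrt[OF holomorphic_on_subset[OF assms(1) subset_UNIV]
        convex_imp_contractible[OF convex_ball] r(3)] by metis
  moreover have "(q x)\<^sup>2 = f x \<and> q x \<noteq> 0" if "x \<in> ball x0 r" for x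
    using q(2)[OF that] r(3)[OF that] by auto
  ultimately show ?thesis using r(1,2) by blast
qed

text \<open>In the coordinate s = sqrt x the form is 2 b(s^2) / (s^2 e(s^2)) ds. It is even, so its
  double pole at 0 has no residue and integrates to the odd term - 2 b(0) / (e(0) s) plus a
  holomorphic part.\<close>

lemma branch_zero_primitive:
  fixes e :: "complex \<Rightarrow> complex"
  assumes e: "e holomorphic_on ball 0 r" and r: "0 < r" "r \<le> 1" and nz: "\<And>x. x \<in> ball 0 r \<Longrightarrow> e x \<noteq> 0"
  shows "\<exists>M. M holomorphic_on ball 0 r \<and> (\<forall>s. M (- s) = - M s) \<and>
    (\<forall>s\<in>ball 0 r - {0}. ((\<lambda>s. M s - 2 * poly b 0 / (e 0 * s)) has_field_derivative
      2 * poly b (0 + s\<^sup>2) / ((0 + s\<^sup>2) * e (0 + s\<^sup>2))) (at s))"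
proof -
  define f where "f = (\<lambda>x. poly b x / e x)"
  have holf: "f holomorphic_on ball 0 r"
    unfolding f_def using e nz by (intro holomorphic_intros) auto
  \<comment> \<open>The difference quotient of f = b / e at 0, so that f(x) / x = m(x) + f(0) / x
    with m holomorphic.\<close>
  define m where "m = (\<lambda>z. if z = 0 then deriv f 0 else (f z - f 0) / (z - 0))"
  have holm: "m holomorphic_on ball 0 r"
    unfolding m_def by (intro pole_lemma_open holf) auto
  have ball: "s\<^sup>2 \<in> ball 0 r" if "s \<in> ball 0 r" for s :: complex
  proof -
    have "norm s * norm s \<le> norm s * 1" using that r by (intro mult_left_mono) auto
    then show ?thesis using that by (simp add: norm_power power2_eq_square norm_mult)
  qed
  have "(\<lambda>s. 2 * m (s\<^sup>2)) holomorphic_on ball 0 r"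
    using ball by (intro holomorphic_intros holomorphic_on_compose_gen[OF _ holm, unfolded o_def]) auto
  from holomorphic_convex_primitive'[OF _ _ this]
  obtain N where N: "\<And>s. s \<in> ball 0 r \<Longrightarrow> (N has_field_derivative 2 * m (s\<^sup>2)) (at s within ball 0 r)"
    by (metis convex_ball open_ball)
  have N: "(N has_field_derivative 2 * m (s\<^sup>2)) (at s)" if "s \<in> ball 0 r" for s
    using N[OF that] at_within_open[OF that open_ball] by simp
  \<comment> \<open>The odd part is again a primitive because the integrand is even. Oddness fixes
    the constant and makes the integral from - s to s twice the value at s.\<close>
  define M where "M = (\<lambda>s. (N s - N (- s)) / 2)"
  have M: "(M has_field_derivative 2 * m (s\<^sup>2)) (at s)" if s: "s \<in> ball 0 r" for s
  proof -
    have "- s \<in> ball 0 r" using s by simp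
    from DERIV_chain2[OF N[OF this] DERIV_minus[OF DERIV_ident]]
    have "((\<lambda>s. N (- s)) has_field_derivative - (2 * m (s\<^sup>2))) (at s)" by simp
    from DERIV_cdivide[OF DERIV_diff[OF N[OF s] this], of 2]
    show ?thesis by (simp add: M_def)
  qed
  show ?thesis
  proof (intro exI[of _ M] conjI allI ballI)
    show "M holomorphic_on ball 0 r"
      unfolding holomorphic_on_open[OF open_ball] using M by blast
    show "M (- s) = - M s" for s by (simp add: M_def field_simps)
    fix s :: complex assume s: "s \<in> ball 0 r - {0}"
    have e0: "e 0 \<noteq> 0" "e (s\<^sup>2) \<noteq> 0" using nz r ball[of s] s by auto
    have "((\<lambda>s. 2 * poly b 0 / (e 0 * s)) has_field_derivative - (2 * poly b 0 / (e 0 * s\<^sup>2))) (at s)"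
      using s e0 by (auto intro!: derivative_eq_intros simp: field_simps power2_eq_square)
    from DERIV_diff[OF M this] s
    have "((\<lambda>s. M s - 2 * poly b 0 / (e 0 * s)) has_field_derivative
        2 * m (s\<^sup>2) + 2 * poly b 0 / (e 0 * s\<^sup>2)) (at s)" by simp
    also have "2 * m (s\<^sup>2) + 2 * poly b 0 / (e 0 * s\<^sup>2) = 2 * poly b (0 + s\<^sup>2) / ((0 + s\<^sup>2) * e (0 + s\<^sup>2))"
      using s e0 by (simp add: m_def f_def field_simps)
    finally show "((\<lambda>s. M s - 2 * poly b 0 / (e 0 * s)) has_field_derivative
      2 * poly b (0 + s\<^sup>2) / ((0 + s\<^sup>2) * e (0 + s\<^sup>2))) (at s)" .
  qed
qed

lemma integral_along_branch_zero:
  fixes e :: "complex \<Rightarrow> complex"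
  assumes e: "e holomorphic_on ball 0 r" and r: "0 < r" "r \<le> 1"
    and sq: "\<forall>x\<in>ball 0 r. (e x)\<^sup>2 = poly a x \<and> e x \<noteq> 0"
  shows "\<exists>M. M holomorphic_on ball 0 r \<and> (\<forall>s\<in>ball 0 r - {0}.
     integral_along a b (s\<^sup>2, - (s * e (s\<^sup>2))) (s\<^sup>2, s * e (s\<^sup>2)) (2 * (M s - 2 * poly b 0 / (e 0 * s))))"
proof -
  have nz: "\<And>x. x \<in> ball 0 r \<Longrightarrow> e x \<noteq> 0" using sq by blast
  obtain M where M: "M holomorphic_on ball 0 r" "\<And>s. M (- s) = - M s"
    "\<And>s. s \<in> ball 0 r - {0} \<Longrightarrow> ((\<lambda>s. M s - 2 * poly b 0 / (e 0 * s)) has_field_derivative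
      2 * poly b (0 + s\<^sup>2) / ((0 + s\<^sup>2) * e (0 + s\<^sup>2))) (at s)"
    using branch_zero_primitive[OF e r nz, of b] by blast
  show ?thesis
  proof (intro exI[of _ M] conjI ballI M(1))
    fix s :: complex assume s: "s \<in> ball 0 r - {0}"
    have "integral_along a b (0 + s\<^sup>2, - (s * e (0 + s\<^sup>2))) (0 + s\<^sup>2, s * e (0 + s\<^sup>2))
       ((M s - 2 * poly b 0 / (e 0 * s)) - (M (- s) - 2 * poly b 0 / (e 0 * (- s))))"
      by (rule integral_along_branch[OF e r(2) _ M(3) s]) (use sq in auto)
    then show "integral_along a b (s\<^sup>2, - (s * e (s\<^sup>2))) (s\<^sup>2, s * e (s\<^sup>2))
       (2 * (M s - 2 * poly b 0 / (e 0 * s)))" by (simp add: M(2) mult.commute)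
  qed
qed

lemma finite_branch_points:
  assumes "a \<noteq> (0 :: complex poly)"
  shows "finite {x. x * poly a x = 0}"
proof -
  have "{x. x * poly a x = 0} = insert 0 {x. poly a x = 0}" by auto
  then show ?thesis using poly_roots_finite[OF assms] by simp
qed

text \<open>Near the branch point 0 a half turn in s = sqrt x joins (x, -y) to (x, y). The x for
  which such a path exists propagate along local sheets over the plane without the finitely many
  branch points, which is connected.\<close>

lemma integral_along_flip:
  assumes a: "a \<in> spectral_polys g" and xy: "(x, y) \<in> etale_curve a"
  obtains v where "integral_along a b (x, - y) (x, y) v"
proof -
  define S where "S = - {x. x * poly a x = 0}"
  define P where "P = (\<lambda>x. \<forall>y. (x, y) \<in> etale_curve a \<longrightarrow> (\<exists>v. integral_along a b (x, - y) (x, y) v))"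
  have fin: "finite {x. x * poly a x = 0}" by (rule finite_branch_points[OF spectral_polys_basic(1)[OF a]])
  have conn: "connected S"
    unfolding S_def using path_connected_complement_countable[OF _ countable_finite[OF fin]]
    by (simp add: path_connected_imp_connected)
  have openS: "open S" unfolding S_def using fin by (simp add: finite_imp_closed open_closed)
  have PI: "P x" if "(x, y) \<in> etale_curve a" "integral_along a b (x, - y) (x, y) v" for x y v
    unfolding P_def
  proof (intro allI impI)
    fix y' assume "(x, y') \<in> etale_curve a"
    then have "y' = y \<or> y' = - y" using that(1) by (simp add: etale_curve_iff power2_eq_iff[symmetric])
    then show "\<exists>v. integral_along a b (x, - y') (x, y') v"
      using that(2) integral_along_sym[OF that(2)] by auto
  qed
  have hol: "poly a holomorphic_on UNIV" "(\<lambda>x. x * poly a x) holomorphic_on UNIV"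
    by (auto intro!: holomorphic_intros)
  obtain e r where e: "0 < r" "r \<le> 1" "e holomorphic_on ball 0 r"
    "\<And>x. x \<in> ball 0 r \<Longrightarrow> (e x)\<^sup>2 = poly a x \<and> e x \<noteq> 0"
    using local_sqrt[OF hol(1) spectral_polys_basic(2)[OF a]] by blast
  have e4: "\<forall>x\<in>ball 0 r. (e x)\<^sup>2 = poly a x \<and> e x \<noteq> 0" using e(4) by blast
  obtain M where M: "M holomorphic_on ball 0 r"
    "\<And>s. s \<in> ball 0 r - {0} \<Longrightarrow> integral_along a b (s\<^sup>2, - (s * e (s\<^sup>2))) (s\<^sup>2, s * e (s\<^sup>2))
       (2 * (M s - 2 * poly b 0 / (e 0 * s)))"
    using integral_along_branch_zero[OF e(3,1,2) e4, of b] by blast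
  define s :: complex where "s = of_real (r / 2)"
  have s: "s \<in> ball 0 r - {0}" using e(1) by (simp add: s_def)
  have "norm s * norm s \<le> norm s * 1" using s e(2) by (intro mult_left_mono) auto
  moreover have "norm (s\<^sup>2) = norm s * norm s" "norm s < r" using s by (auto simp: norm_mult power2_eq_square)
  ultimately have "norm (s\<^sup>2) < r" by linarith
  then have s2: "s\<^sup>2 \<in> ball 0 r" by simp
  have on: "(s\<^sup>2, s * e (s\<^sup>2)) \<in> etale_curve a"
    using e(4)[OF s2] s by (auto simp: etale_curve_iff power_mult_distrib)
  have Ps: "P (s\<^sup>2)" by (rule PI[OF on M(2)[OF s]])
  have s2S: "s\<^sup>2 \<in> S" using on by (simp add: S_def etale_curve_iff)
  have xS: "x \<in> S" using xy by (simp add: S_def etale_curve_iff)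
  have loc: "\<exists>T. openin (top_of_set S) T \<and> x0 \<in> T \<and> (\<forall>x\<in>T. \<forall>x'\<in>T. P x \<longrightarrow> P x')" if x0: "x0 \<in> S" for x0
  proof -
    have x0': "x0 * poly a x0 \<noteq> 0" using x0 by (simp add: S_def)
    obtain \<rho> q where q: "0 < \<rho>" "\<rho> \<le> 1" "q holomorphic_on ball x0 \<rho>"
      "\<forall>x\<in>ball x0 \<rho>. (q x)\<^sup>2 = x * poly a x \<and> q x \<noteq> 0"
      using local_sqrt[OF hol(2) x0'] by blast
    have qq: "(q x)\<^sup>2 = x * poly a x \<and> x * poly a x \<noteq> 0" if "x \<in> ball x0 \<rho>" for x
      using q(4) that by (metis power_not_zero)
    have "(\<lambda>x. poly b x / (x * q x)) holomorphic_on ball x0 \<rho>"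
      using q(3,4) qq by (intro holomorphic_intros) auto
    from holomorphic_convex_primitive'[OF _ _ this]
    obtain \<Phi> where "\<And>x. x \<in> ball x0 \<rho> \<Longrightarrow> (\<Phi> has_field_derivative poly b x / (x * q x)) (at x within ball x0 \<rho>)"
      by (metis convex_ball open_ball)
    then have \<Phi>: "\<forall>x\<in>ball x0 \<rho>. (\<Phi> has_field_derivative poly b x / (x * q x)) (at x)"
      using at_within_open[OF _ open_ball] by metis
    have on_q: "\<forall>x\<in>ball x0 \<rho>. (x, q x) \<in> etale_curve a" using qq by (simp add: etale_curve_iff)
    have "P x'" if that3: "x \<in> ball x0 \<rho>" "x' \<in> ball x0 \<rho>" "P x" for x x'
    proof -
      have on: "(x, q x) \<in> etale_curve a" "(x', q x') \<in> etale_curve a"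
        using that qq by (auto simp: etale_curve_iff)
      then obtain v where v: "integral_along a b (x, - q x) (x, q x) v"
        using that3(3) unfolding P_def by blast
      note sheet = integral_along_sheet[OF convex_ball open_ball q(3) on_q \<Phi>]
      \<comment> \<open>The path goes from (x', - q x') to (x, - q x) on one sheet, then flips over
        x, and returns to (x', q x') on the other sheet.\<close>
      show ?thesis
        by (rule PI[OF on(2) integral_along_trans[OF integral_along_trans[OF
              sheet(2)[OF that3(2,1)] v] sheet(1)[OF that3(1,2)]]])
    qed
    moreover have "ball x0 \<rho> \<subseteq> S" using qq unfolding S_def by blast
    then have "openin (top_of_set S) (ball x0 \<rho>)" using openS by (simp add: openin_open_eq)
    moreover have "x0 \<in> ball x0 \<rho>" using q(1) by simp
    ultimately show ?thesis by blast
  qed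
  have "P x" using connected_induction_simple[of S "s\<^sup>2" x P, OF conn s2S xS Ps loc] .
  then show ?thesis using xy that unfolding P_def by blast
qed

lemma etale_curve_csqrt: "x * poly a x \<noteq> 0 \<Longrightarrow> (x, csqrt (x * poly a x)) \<in> etale_curve a"
  by (simp add: etale_curve_iff)

lemma etale_curve_fibre:
  assumes "(x, y) \<in> etale_curve a" "(x, y') \<in> etale_curve a"
  shows "y' = y \<or> y' = - y"
  using assms by (simp add: etale_curve_iff power2_eq_iff[symmetric])

lemma imag_period_polys_closed:
  assumes "b \<in> imag_period_polys g a" "integral_along a b P P v"
  shows "Re v = 0"
proof -
  obtain \<gamma> where "valid_path \<gamma>" "path_image \<gamma> \<subseteq> curve a" "pathfinish \<gamma> = pathstart \<gamma>" "period a b \<gamma> = v"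
    using integral_along_period[OF assms(2)] by metis
  then show ?thesis using assms(1) unfolding imag_period_polys_def by blast
qed

text \<open>Positivity of a(x) / x^g = r enters here. It gives y^2 = r x^(g+1) and |y|^2 = r, so the
  reflection fixes each point over the circle instead of exchanging the two.\<close>

lemma unit_circle_reflect:
  assumes a: "a \<in> spectral_polys g" and xy: "(x, y) \<in> etale_curve a" "norm x = 1"
  shows "inverse (cnj x) = x" "cnj y * inverse (cnj x) ^ (g + 1) = y"
proof -
  have xc: "x * cnj x = 1" using xy(2) complex_norm_square[of x] by simp
  then have "inverse (cnj x) * (x * cnj x) = inverse (cnj x)" by simp
  moreover have "cnj x \<noteq> 0" using xc by auto
  ultimately show inv: "inverse (cnj x) = x" by (simp add: field_simps)
  obtain r where r: "r > 0" "poly a x / x ^ g = complex_of_real r"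
  proof -
    have "x \<in> sphere 0 1" using xy(2) by simp
    then show ?thesis using a that unfolding spectral_polys_def by blast
  qed
  have x0: "x \<noteq> 0" and y2: "y\<^sup>2 = x * poly a x" using xy(1) by (auto simp: etale_curve_iff)
  have y2': "y\<^sup>2 = of_real r * x ^ (g + 1)" using r(2) x0 y2 by (simp add: field_simps)
  then have "norm (y\<^sup>2) = norm (of_real r * x ^ (g + 1))" by simp
  then have "(norm y)\<^sup>2 = r" using r(1) xy(2) by (simp add: norm_mult norm_power)
  then have "y * cnj y = of_real r" by (metis complex_norm_square)
  then have "of_real r * (cnj y * x ^ (g + 1)) = of_real r * y"
    using y2' by (metis mult.assoc mult.commute power2_eq_square)
  then show "cnj y * inverse (cnj x) ^ (g + 1) = y" using r(1) inv by simp
qed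

text \<open>The half-integral from (x, -y) to (x, y) has a real part independent of the path, since
  two paths differ by a loop with imaginary period. Near a root of a these paths can be taken short,
  hence the limit 0.\<close>

lemma potential_exists:
  assumes a: "a \<in> spectral_polys g" and b: "b \<in> imag_period_polys g a"
  shows "\<exists>h. potential a b h"
proof -
  define h where "h = (\<lambda>P :: complex \<times> complex. Re (SOME v. integral_along a b (fst P, - snd P) P v) / 2)"
  have h: "h (x, y) = Re v / 2" if v: "integral_along a b (x, - y) (x, y) v" for x y v
  proof -
    define w where "w = (SOME v. integral_along a b (x, - y) (x, y) v)"
    have "integral_along a b (x, - y) (x, y) w" unfolding w_def using v by (rule someI)
    from imag_period_polys_closed[OF b integral_along_trans[OF v integral_along_sym[OF this]]]
    show ?thesis by (simp add: h_def w_def)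
  qed
  have flip: "h (x, - y) = - h (x, y)" if xy: "(x, y) \<in> etale_curve a" for x y
  proof -
    obtain v where v: "integral_along a b (x, - y) (x, y) v" using integral_along_flip[OF a xy] by metis
    have "integral_along a b (x, - (- y)) (x, - y) (- v)" using integral_along_sym[OF v] by simp
    from h[OF this] h[OF v] show ?thesis by simp
  qed
  show ?thesis
  proof (rule exI[of _ h], unfold potential_def, intro conjI allI impI)
    fix x y :: complex assume "(x, y) \<in> etale_curve a"
    then show "h (x, - y) = - h (x, y)" by (rule flip)
  next
    fix B q assume B: "convex B" "open B" "q holomorphic_on B" "\<forall>x\<in>B. (x, q x) \<in> etale_curve a"
    show "\<exists>\<Phi>. \<forall>x\<in>B. (\<Phi> has_field_derivative poly b x / (x * q x)) (at x) \<and> h (x, q x) = Re (\<Phi> x)"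
    proof (cases "B = {}")
      case False
      then obtain x0 where x0: "x0 \<in> B" by blast
      have nz: "x * q x \<noteq> 0" if "x \<in> B" for x using B(4) that by (auto simp: etale_curve_iff)
      have "(\<lambda>x. poly b x / (x * q x)) holomorphic_on B"
        using B(3) nz by (intro holomorphic_intros) auto
      from holomorphic_convex_primitive'[OF B(1,2) this]
      obtain \<Psi> where "\<And>x. x \<in> B \<Longrightarrow> (\<Psi> has_field_derivative poly b x / (x * q x)) (at x within B)" by metis
      then have \<Psi>: "\<forall>x\<in>B. (\<Psi> has_field_derivative poly b x / (x * q x)) (at x)"
        using at_within_open[OF _ B(2)] by metis
      obtain v where v: "integral_along a b (x0, - q x0) (x0, q x0) v"
        using integral_along_flip[OF a] B(4) x0 by metis
      \<comment> \<open>The constant makes the value at \<open>x0\<close> equal to v / 2. The path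
        through \<open>x0\<close> picks up \<Psi> x - \<Psi> x0 once on each sheet, so half its
        integral is \<Phi> x.\<close>
      define \<Phi> where "\<Phi> = (\<lambda>x. \<Psi> x + (v / 2 - \<Psi> x0))"
      note sheet = integral_along_sheet[OF B \<Psi>]
      have "(\<Phi> has_field_derivative poly b x / (x * q x)) (at x) \<and> h (x, q x) = Re (\<Phi> x)" if x: "x \<in> B" for x
      proof
        show "(\<Phi> has_field_derivative poly b x / (x * q x)) (at x)"
          unfolding \<Phi>_def using DERIV_add[OF \<Psi>[rule_format, OF x] DERIV_const] by simp
        from h[OF integral_along_trans[OF integral_along_trans[OF sheet(2)[OF x x0] v] sheet(1)[OF x0 x]]]
        show "h (x, q x) = Re (\<Phi> x)" by (simp add: \<Phi>_def)
      qed
      then show ?thesis by blast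
    qed auto
  next
    fix \<alpha> assume \<alpha>: "poly a \<alpha> = 0"
    have \<alpha>0: "\<alpha> \<noteq> 0" using spectral_polys_basic(2)[OF a] \<alpha> by auto
    have "order \<alpha> a = 1"
      by (rule rsquarefree_root_order[OF spectral_polys_basic(5)[OF a] \<alpha> spectral_polys_basic(1)[OF a]])
    then obtain c where c: "a = [:- \<alpha>, 1:] ^ 1 * c" "\<not> [:- \<alpha>, 1:] dvd c"
      using order_decomp[OF spectral_polys_basic(1)[OF a], of \<alpha>] by auto
    have "\<alpha> * poly c \<alpha> \<noteq> 0" using c(2) \<alpha>0 by (simp add: poly_eq_0_iff_dvd)
    moreover have "(\<lambda>x. x * poly c x) holomorphic_on UNIV" by (auto intro!: holomorphic_intros)
    ultimately obtain r e where e: "0 < r" "r \<le> 1" "e holomorphic_on ball \<alpha> r"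
      "\<forall>x\<in>ball \<alpha> r. (e x)\<^sup>2 = x * poly c x \<and> e x \<noteq> 0"
      using local_sqrt[of "\<lambda>x. x * poly c x" \<alpha>] by blast
    have sq: "x * poly a x = (x - \<alpha>) * (e x)\<^sup>2 \<and> e x \<noteq> 0" "x \<noteq> 0" if x: "x \<in> ball \<alpha> r" for x
    proof -
      have "(e x)\<^sup>2 = x * poly c x" "e x \<noteq> 0" using e(4) x by auto
      then show "x * poly a x = (x - \<alpha>) * (e x)\<^sup>2 \<and> e x \<noteq> 0" "x \<noteq> 0" by (auto simp: c(1) algebra_simps)
    qed
    have ball: "\<alpha> + s\<^sup>2 \<in> ball \<alpha> r" if "s \<in> ball 0 r" for s
    proof -
      have "norm s * norm s \<le> norm s * 1" using that e(2) by (intro mult_left_mono) auto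
      then show ?thesis using that by (simp add: dist_norm norm_power power2_eq_square norm_mult)
    qed
    have "(\<lambda>s. 2 * poly b (\<alpha> + s\<^sup>2) / ((\<alpha> + s\<^sup>2) * e (\<alpha> + s\<^sup>2))) holomorphic_on ball 0 r"
      using ball sq by (intro holomorphic_intros holomorphic_on_compose_gen[OF _ e(3), unfolded o_def]) auto
    from holomorphic_convex_primitive'[OF _ _ this]
    obtain \<Phi> where "\<And>s. s \<in> ball 0 r \<Longrightarrow> (\<Phi> has_field_derivative
        2 * poly b (\<alpha> + s\<^sup>2) / ((\<alpha> + s\<^sup>2) * e (\<alpha> + s\<^sup>2))) (at s within ball 0 r)"
      by (metis convex_ball open_ball)
    then have \<Phi>: "\<And>s. s \<in> ball 0 r \<Longrightarrow> (\<Phi> has_field_derivative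
        2 * poly b (\<alpha> + s\<^sup>2) / ((\<alpha> + s\<^sup>2) * e (\<alpha> + s\<^sup>2))) (at s)"
      using at_within_open[OF _ open_ball] by metis
    \<comment> \<open>\<open>csqrt\<close> may select either point over x and jumps along a cut. The
      absolute value of the odd function h does not notice, and \<open>G 0 = 0\<close>.\<close>
    define G where "G = (\<lambda>s. \<bar>Re (\<Phi> s - \<Phi> (- s)) / 2\<bar>)"
    have hG: "\<bar>h (x, csqrt (x * poly a x))\<bar> = G (csqrt (x - \<alpha>))" if x: "x \<in> ball \<alpha> (r\<^sup>2)" "x \<noteq> \<alpha>" for x
    proof -
      define s where "s = csqrt (x - \<alpha>)"
      have "cmod (x - \<alpha>) < r\<^sup>2" using x(1) by (simp add: dist_norm norm_minus_commute)
      then have "norm s < r" using e(1) by (simp add: s_def norm_csqrt real_less_lsqrt)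
      then have s: "s \<in> ball 0 r - {0}" using x(2) by (auto simp: s_def)
      have xs: "\<alpha> + s\<^sup>2 = x" by (simp add: s_def)
      have "integral_along a b (\<alpha> + s\<^sup>2, - (s * e (\<alpha> + s\<^sup>2))) (\<alpha> + s\<^sup>2, s * e (\<alpha> + s\<^sup>2)) (\<Phi> s - \<Phi> (- s))"
        by (rule integral_along_branch[OF e(3,2) sq(1) \<Phi> s]) auto
      then have hs: "h (x, s * e x) = Re (\<Phi> s - \<Phi> (- s)) / 2" unfolding xs by (rule h)
      have "x \<in> ball \<alpha> r" using ball[of s] s xs by simp
      from sq(1)[OF this] x(2) have eq: "x * poly a x = (s * e x)\<^sup>2" and nz: "x * poly a x \<noteq> 0"
        by (auto simp: power_mult_distrib s_def)
      have on: "(x, s * e x) \<in> etale_curve a" using eq nz by (simp add: etale_curve_iff)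
      have "csqrt (x * poly a x) = s * e x \<or> csqrt (x * poly a x) = - (s * e x)"
        using etale_curve_fibre[OF on etale_curve_csqrt[OF nz]] .
      then have "\<bar>h (x, csqrt (x * poly a x))\<bar> = \<bar>h (x, s * e x)\<bar>" using flip[OF on] by auto
      then show ?thesis unfolding G_def s_def[symmetric] by (simp add: hs)
    qed
    have "continuous_on (ball 0 r) \<Phi>"
      using \<Phi> by (meson DERIV_continuous continuous_at_imp_continuous_on)
    then have cont: "isCont \<Phi> 0" using e(1) by (simp add: continuous_on_eq_continuous_at)
    have "isCont (\<lambda>s. \<Phi> (- s)) 0"
      by (rule isCont_o2[where g = \<Phi>]) (use cont in auto)
    then have "isCont G 0" unfolding G_def using cont by (intro continuous_intros) auto
    moreover have "((\<lambda>x. csqrt (x - \<alpha>)) \<longlongrightarrow> 0) (at \<alpha>)"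
    proof (rule tendsto_norm_zero_cancel)
      have "((\<lambda>x. sqrt (norm (x - \<alpha>))) \<longlongrightarrow> sqrt (norm (\<alpha> - \<alpha>))) (at \<alpha>)"
        by (intro tendsto_intros)
      then show "((\<lambda>x. norm (csqrt (x - \<alpha>))) \<longlongrightarrow> 0) (at \<alpha>)" by (simp add: norm_csqrt)
    qed
    ultimately have "((\<lambda>x. G (csqrt (x - \<alpha>))) \<longlongrightarrow> G 0) (at \<alpha>)"
      by (rule isCont_tendsto_compose)
    then have "((\<lambda>x. G (csqrt (x - \<alpha>))) \<longlongrightarrow> 0) (at \<alpha>)" by (simp add: G_def)
    moreover have "eventually (\<lambda>x. G (csqrt (x - \<alpha>)) = \<bar>h (x, csqrt (x * poly a x))\<bar>) (at \<alpha>)"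
      unfolding eventually_at_topological
      by (intro exI[of _ "ball \<alpha> (r\<^sup>2)"]) (use e(1) hG in auto)
    ultimately have "((\<lambda>x. \<bar>h (x, csqrt (x * poly a x))\<bar>) \<longlongrightarrow> 0) (at \<alpha>)"
      by (rule Lim_transform_eventually)
    then show "((\<lambda>x. h (x, csqrt (x * poly a x))) \<longlongrightarrow> 0) (at \<alpha>)" by (rule tendsto_rabs_zero_cancel)
  next
    fix x y :: complex assume xy: "(x, y) \<in> etale_curve a" "norm x = 1"
    obtain v where v: "integral_along a b (x, - y) (x, y) v" using integral_along_flip[OF a xy(1)] by metis
    have b': "b \<in> real_polys (g + 1)" using b by (simp add: imag_period_polys_def)
    have "(x, - y) \<in> etale_curve a" using xy(1) by (simp add: etale_curve_iff)
    \<comment> \<open>The reflection fixes both endpoints, so v and - cnj v are integrals between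
      the same points. Half the real part of either is h (x, y), which must therefore be its own
      negative.\<close>
    from unit_circle_reflect[OF a this xy(2)] unit_circle_reflect[OF a xy]
      integral_along_reflect[OF spectral_polys_basic(3)[OF a] b' v]
    have "integral_along a b (x, - y) (x, y) (- cnj v)" by simp
    from h[OF v] h[OF this] show "h (x, y) = 0" by simp
  next
    fix e r assume e: "r \<le> (1::real)" "e holomorphic_on ball 0 r" "\<forall>x\<in>ball 0 r. (e x)\<^sup>2 = poly a x \<and> e x \<noteq> 0"
    show "\<exists>M. M holomorphic_on ball 0 r \<and> (\<forall>s\<in>ball 0 r - {0}.
           h (s\<^sup>2, s * e (s\<^sup>2)) = Re (M s - 2 * poly b 0 / (e 0 * s)))"
    proof (cases "0 < r")
      case True
      obtain M where M: "M holomorphic_on ball 0 r" "\<forall>s\<in>ball 0 r - {0}.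
         integral_along a b (s\<^sup>2, - (s * e (s\<^sup>2))) (s\<^sup>2, s * e (s\<^sup>2)) (2 * (M s - 2 * poly b 0 / (e 0 * s)))"
        using integral_along_branch_zero[OF e(2) True e(1,3), of b] by blast
      have half: "Re (2 * w) / 2 = Re w" for w by simp
      have "h (s\<^sup>2, s * e (s\<^sup>2)) = Re (M s - 2 * poly b 0 / (e 0 * s))" if "s \<in> ball 0 r - {0}" for s
        using h[OF M(2)[rule_format, OF that]] unfolding half .
      then show ?thesis using M(1) by blast
    next
      case False
      then have empty: "ball (0::complex) r = {}" by simp
      show ?thesis unfolding empty by (auto simp: holomorphic_on_def)
    qed
  qed
qed

text \<open>Squaring removes the sign ambiguity of the odd function $h + i k$, so that it descends to the plane.\<close>

definition squared_potential ::
  "complex poly \<Rightarrow> (complex \<times> complex \<Rightarrow> real) \<Rightarrow> (complex \<times> complex \<Rightarrow> real) \<Rightarrow> complex \<Rightarrow> complex" where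
  "squared_potential a h k x = (if x * poly a x = 0 then 0
     else (Complex (h (x, csqrt (x * poly a x))) (k (x, csqrt (x * poly a x))))\<^sup>2)"

lemma squared_potential_eq:
  assumes h: "potential a b h" and k: "potential a c k" and xy: "(x, y) \<in> etale_curve a"
  shows "squared_potential a h k x = (Complex (h (x, y)) (k (x, y)))\<^sup>2"
proof -
  have nz: "x * poly a x \<noteq> 0" using xy by (simp add: etale_curve_iff)
  have "csqrt (x * poly a x) = y \<or> csqrt (x * poly a x) = - y"
    using etale_curve_fibre[OF xy etale_curve_csqrt[OF nz]] .
  moreover have "Complex (- u) (- v) = - Complex u v" for u v by (simp add: complex_eq_iff)
  ultimately show ?thesis
    using nz potentialD(1)[OF h xy] potentialD(1)[OF k xy]
    by (auto simp: squared_potential_def)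
qed

lemma squared_potential_local:
  assumes h: "potential a b h" and k: "potential a c k" and x0: "x0 * poly a x0 \<noteq> 0"
    and U: "open U" "x0 \<in> U"
  shows "\<exists>r q \<Phi> \<Psi>. 0 < r \<and> ball x0 r \<subseteq> U \<and> q holomorphic_on ball x0 r \<and>
    (\<forall>x\<in>ball x0 r. (x, q x) \<in> etale_curve a \<and>
      (\<Phi> has_field_derivative poly b x / (x * q x)) (at x) \<and>
      (\<Psi> has_field_derivative poly c x / (x * q x)) (at x) \<and>
      h (x, q x) = Re (\<Phi> x) \<and> k (x, q x) = Re (\<Psi> x) \<and>
      squared_potential a h k x = (Complex (Re (\<Phi> x)) (Re (\<Psi> x)))\<^sup>2)"
proof -
  have hol: "(\<lambda>x. x * poly a x) holomorphic_on UNIV" by (auto intro!: holomorphic_intros)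
  obtain r0 q where q: "0 < r0" "q holomorphic_on ball x0 r0"
    "\<forall>x\<in>ball x0 r0. (q x)\<^sup>2 = x * poly a x \<and> q x \<noteq> 0"
    using local_sqrt[OF hol x0] by blast
  obtain r1 where r1: "r1 > 0" "ball x0 r1 \<subseteq> U" using U open_contains_ball by blast
  define r where "r = min r0 r1"
  have r: "0 < r" "ball x0 r \<subseteq> U" "ball x0 r \<subseteq> ball x0 r0" using q r1 by (auto simp: r_def)
  have on: "\<forall>x\<in>ball x0 r. (x, q x) \<in> etale_curve a"
    using q(3) r(3) unfolding etale_curve_iff by (metis power_not_zero subset_eq)
  have holq: "q holomorphic_on ball x0 r" using q(2) r(3) by (rule holomorphic_on_subset)
  obtain \<Phi> where \<Phi>: "\<forall>x\<in>ball x0 r. (\<Phi> has_field_derivative poly b x / (x * q x)) (at x) \<and> h (x, q x) = Re (\<Phi> x)"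
    using potentialD(2)[OF h convex_ball open_ball holq on] by blast
  obtain \<Psi> where \<Psi>: "\<forall>x\<in>ball x0 r. (\<Psi> has_field_derivative poly c x / (x * q x)) (at x) \<and> k (x, q x) = Re (\<Psi> x)"
    using potentialD(2)[OF k convex_ball open_ball holq on] by blast
  have "squared_potential a h k x = (Complex (Re (\<Phi> x)) (Re (\<Psi> x)))\<^sup>2" if x: "x \<in> ball x0 r" for x
    using squared_potential_eq[OF h k on[rule_format, OF x]] \<Phi> \<Psi> x by simp
  then show ?thesis using r(1,2) holq on \<Phi> \<Psi> by blast
qed

lemma squared_potential_tendsto_zero:
  assumes a: "a \<noteq> 0" and h: "((\<lambda>x. h (x, csqrt (x * poly a x))) \<longlongrightarrow> 0) (at x0)"
    and k: "((\<lambda>x. k (x, csqrt (x * poly a x))) \<longlongrightarrow> 0) (at x0)"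
  shows "(squared_potential a h k \<longlongrightarrow> 0) (at x0)"
proof -
  have "((\<lambda>x. of_real (h (x, csqrt (x * poly a x))) + \<i> * of_real (k (x, csqrt (x * poly a x)))) \<longlongrightarrow> of_real 0 + \<i> * of_real 0) (at x0)"
    by (intro tendsto_intros h k)
  from tendsto_power[OF this, of 2]
  have "((\<lambda>x. (Complex (h (x, csqrt (x * poly a x))) (k (x, csqrt (x * poly a x))))\<^sup>2) \<longlongrightarrow> 0) (at x0)"
    by (simp add: Complex_eq)
  moreover have "eventually (\<lambda>x. (Complex (h (x, csqrt (x * poly a x))) (k (x, csqrt (x * poly a x))))\<^sup>2 =
      squared_potential a h k x) (at x0)"
    unfolding eventually_at_topological
  proof (intro exI conjI ballI impI)
    \<comment> \<open>Other branch points are left out, because there the function is 0 by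
      definition and not by the displayed square.\<close>
    show "open (- ({x. x * poly a x = 0} - {x0}))"
      using finite_branch_points[OF a] by (intro open_Compl finite_imp_closed finite_Diff)
  qed (auto simp: squared_potential_def)
  ultimately show ?thesis by (rule Lim_transform_eventually)
qed

text \<open>The point 0 is excluded because the function is unbounded there unless b and c both
  vanish at 0.\<close>

lemma isCont_squared_potential:
  assumes a: "a \<noteq> 0" and h: "potential a b h" and k: "potential a c k" and x0: "x0 \<noteq> 0"
  shows "isCont (squared_potential a h k) x0"
proof (cases "poly a x0 = 0")
  case True
  have "(squared_potential a h k \<longlongrightarrow> 0) (at x0)"
    by (intro squared_potential_tendsto_zero a potentialD(3)[OF h True] potentialD(3)[OF k True])
  then show ?thesis using True by (simp add: isCont_def squared_potential_def)
next
  case False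
  obtain r q \<Phi> \<Psi> where r: "0 < r" and loc: "\<forall>x\<in>ball x0 r. (x, q x) \<in> etale_curve a \<and>
      (\<Phi> has_field_derivative poly b x / (x * q x)) (at x) \<and>
      (\<Psi> has_field_derivative poly c x / (x * q x)) (at x) \<and>
      h (x, q x) = Re (\<Phi> x) \<and> k (x, q x) = Re (\<Psi> x) \<and>
      squared_potential a h k x = (Complex (Re (\<Phi> x)) (Re (\<Psi> x)))\<^sup>2"
    using squared_potential_local[OF h k _ open_UNIV, of x0] x0 False by auto
  have "continuous_on (ball x0 r) \<Phi>" "continuous_on (ball x0 r) \<Psi>"
    using loc by (meson DERIV_continuous continuous_at_imp_continuous_on)+
  then have "continuous_on (ball x0 r) (\<lambda>x. (Complex (Re (\<Phi> x)) (Re (\<Psi> x)))\<^sup>2)"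
    unfolding Complex_eq by (intro continuous_intros)
  then have "continuous_on (ball x0 r) (squared_potential a h k)"
    using loc by (subst continuous_on_cong[OF refl]) auto
  then show ?thesis using r by (simp add: continuous_on_eq_continuous_at)
qed

lemma squared_potential_circle:
  assumes h: "potential a b h" and k: "potential a c k" and x: "norm x = 1"
  shows "squared_potential a h k x = 0"
  using potentialD(4)[OF h etale_curve_csqrt[of x a] x] potentialD(4)[OF k etale_curve_csqrt[of x a] x]
  by (simp add: squared_potential_def Complex_eq)

lemma etale_curve_near_zero:
  fixes r :: real
  assumes r: "r \<le> 1" and e: "\<forall>x\<in>ball 0 r. (e x)\<^sup>2 = poly a x \<and> e x \<noteq> 0" and s: "s \<in> ball 0 r - {0}"
  shows "(s\<^sup>2, s * e (s\<^sup>2)) \<in> etale_curve a"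
proof -
  have "norm s * norm s \<le> norm s * 1" using s r by (intro mult_left_mono) auto
  moreover have "norm (s\<^sup>2) = norm s * norm s" "norm s < r" using s by (auto simp: norm_mult power2_eq_square)
  ultimately have "norm (s\<^sup>2) < r" by linarith
  then have s2: "s\<^sup>2 \<in> ball 0 r" by simp
  then show ?thesis using e[rule_format, OF s2] s by (auto simp: etale_curve_iff power_mult_distrib)
qed

text \<open>The parameter - s belongs to the other point over s^2, and the pole term is odd in s; so
  the oddness of h passes to Re M.\<close>

lemma potential_near_zero:
  assumes h: "potential a b h" and r: "r \<le> 1" and e: "e holomorphic_on ball 0 r"
    "\<forall>x\<in>ball 0 r. (e x)\<^sup>2 = poly a x \<and> e x \<noteq> 0"
  shows "\<exists>M. M holomorphic_on ball 0 r \<and> (\<forall>s\<in>ball 0 r - {0}.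
     h (s\<^sup>2, s * e (s\<^sup>2)) = Re (M s - 2 * poly b 0 / (e 0 * s)) \<and> Re (M (- s)) = - Re (M s))"
proof -
  obtain M where M: "M holomorphic_on ball 0 r" "\<forall>s\<in>ball 0 r - {0}.
     h (s\<^sup>2, s * e (s\<^sup>2)) = Re (M s - 2 * poly b 0 / (e 0 * s))"
    using potentialD(5)[OF h r e] by blast
  have "Re (M (- s)) = - Re (M s)" if s: "s \<in> ball 0 r - {0}" for s
  proof -
    have s': "- s \<in> ball 0 r - {0}" using s by simp
    have "Re (M (- s) - 2 * poly b 0 / (e 0 * - s)) = h (s\<^sup>2, - (s * e (s\<^sup>2)))"
      using M(2)[rule_format, OF s'] by simp
    then show ?thesis
      using potentialD(1)[OF h etale_curve_near_zero[OF r e(2) s]] M(2)[rule_format, OF s] by simp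
  qed
  then show ?thesis using M by blast
qed

lemma squared_potential_near_zero:
  assumes a: "a \<in> spectral_polys g" and h: "potential a b h" and k: "potential a c k"
  shows "\<exists>r e M N. 0 < r \<and> e \<noteq> 0 \<and> M holomorphic_on ball 0 r \<and> N holomorphic_on ball 0 r \<and>
    (\<forall>s\<in>ball 0 r - {0}. squared_potential a h k (s\<^sup>2) =
       (Complex (Re (M s - 2 * poly b 0 / (e * s))) (Re (N s - 2 * poly c 0 / (e * s))))\<^sup>2 \<and>
       Re (M (- s)) = - Re (M s) \<and> Re (N (- s)) = - Re (N s))"
proof -
  have hol: "poly a holomorphic_on UNIV" by (auto intro!: holomorphic_intros)
  obtain r e where e: "0 < r" "r \<le> 1" "e holomorphic_on ball 0 r"
    "\<forall>x\<in>ball 0 r. (e x)\<^sup>2 = poly a x \<and> e x \<noteq> 0"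
    using local_sqrt[OF hol spectral_polys_basic(2)[OF a]] by blast
  obtain M where M: "M holomorphic_on ball 0 r" "\<forall>s\<in>ball 0 r - {0}.
     h (s\<^sup>2, s * e (s\<^sup>2)) = Re (M s - 2 * poly b 0 / (e 0 * s)) \<and> Re (M (- s)) = - Re (M s)"
    using potential_near_zero[OF h e(2,3,4)] by blast
  obtain N where N: "N holomorphic_on ball 0 r" "\<forall>s\<in>ball 0 r - {0}.
     k (s\<^sup>2, s * e (s\<^sup>2)) = Re (N s - 2 * poly c 0 / (e 0 * s)) \<and> Re (N (- s)) = - Re (N s)"
    using potential_near_zero[OF k e(2,3,4)] by blast
  have "squared_potential a h k (s\<^sup>2) =
     (Complex (Re (M s - 2 * poly b 0 / (e 0 * s))) (Re (N s - 2 * poly c 0 / (e 0 * s))))\<^sup>2 \<and>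
     Re (M (- s)) = - Re (M s) \<and> Re (N (- s)) = - Re (N s)"
    if s: "s \<in> ball 0 r - {0}" for s
    using squared_potential_eq[OF h k etale_curve_near_zero[OF e(2,4) s]]
      M(2)[rule_format, OF s] N(2)[rule_format, OF s] by metis
  moreover have "e 0 \<noteq> 0" using e(1,4) by simp
  ultimately show ?thesis using e(1) M(1) N(1) by blast
qed

text \<open>Without the pole term h is Re M in the coordinate s = sqrt x, and an odd function with a
  limit at s = 0 has limit 0. The point over 0 then behaves like the other branch points.\<close>

lemma potential_tendsto_zero:
  assumes a: "a \<in> spectral_polys g" and h: "potential a b h" and b0: "poly b 0 = 0"
  shows "((\<lambda>x. h (x, csqrt (x * poly a x))) \<longlongrightarrow> 0) (at 0)"
proof -
  have hol: "poly a holomorphic_on UNIV" by (auto intro!: holomorphic_intros)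
  obtain r e where e: "0 < r" "r \<le> 1" "e holomorphic_on ball 0 r"
    "\<forall>x\<in>ball 0 r. (e x)\<^sup>2 = poly a x \<and> e x \<noteq> 0"
    using local_sqrt[OF hol spectral_polys_basic(2)[OF a]] by blast
  obtain M where M: "M holomorphic_on ball 0 r" "\<forall>s\<in>ball 0 r - {0}.
     h (s\<^sup>2, s * e (s\<^sup>2)) = Re (M s - 2 * poly b 0 / (e 0 * s)) \<and> Re (M (- s)) = - Re (M s)"
    using potential_near_zero[OF h e(2,3,4)] by blast
  have hM: "h (s\<^sup>2, s * e (s\<^sup>2)) = Re (M s)" and odd: "Re (M s) + Re (M (- s)) = 0"
    if "s \<in> ball 0 r - {0}" for s
    using M(2)[rule_format, OF that] b0 by simp_all
  note on = etale_curve_near_zero[OF e(2,4)]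
  have cont: "isCont M 0" using e(1) holomorphic_on_imp_continuous_on[OF M(1)] by (simp add: continuous_on_eq_continuous_at)
  have lim: "((\<lambda>s. Re (M s)) \<longlongrightarrow> Re (M 0)) (at 0)" using cont by (intro tendsto_intros) (simp add: isCont_def)
  have "((\<lambda>s. M (- s)) \<longlongrightarrow> M 0) (at 0)"
    by (rule isCont_tendsto_compose[OF cont]) (auto intro!: tendsto_eq_intros)
  then have lim': "((\<lambda>s. Re (M (- s))) \<longlongrightarrow> Re (M 0)) (at 0)" by (intro tendsto_intros)
  have "eventually (\<lambda>s. Re (M s) + Re (M (- s)) = 0) (at 0)"
    unfolding eventually_at_topological by (rule exI[of _ "ball 0 r"]) (use e(1) odd in auto)
  then have "((\<lambda>s. Re (M s) + Re (M (- s))) \<longlongrightarrow> 0) (at 0)" by (rule tendsto_eventually)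
  from LIM_unique[OF this tendsto_add[OF lim lim']] have M0: "Re (M 0) = 0" by simp
  have hG: "\<bar>h (x, csqrt (x * poly a x))\<bar> = \<bar>Re (M (csqrt x))\<bar>" if x: "x \<in> ball 0 (r\<^sup>2)" "x \<noteq> 0" for x
  proof -
    have "norm (csqrt x) < r" using x(1) e(1) by (simp add: norm_csqrt real_less_lsqrt)
    then have s: "csqrt x \<in> ball 0 r - {0}" using x(2) by simp
    have nz: "x * poly a x \<noteq> 0" and on': "(x, csqrt x * e x) \<in> etale_curve a"
      using on[OF s] by (auto simp: etale_curve_iff)
    have "csqrt (x * poly a x) = csqrt x * e x \<or> csqrt (x * poly a x) = - (csqrt x * e x)"
      using etale_curve_fibre[OF on' etale_curve_csqrt[OF nz]] .
    then have "\<bar>h (x, csqrt (x * poly a x))\<bar> = \<bar>h (x, csqrt x * e x)\<bar>"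
      using potentialD(1)[OF h on'] by auto
    then show ?thesis using hM[OF s] by simp
  qed
  have "((\<lambda>x. csqrt x) \<longlongrightarrow> 0) (at 0)"
  proof (rule tendsto_norm_zero_cancel)
    have "((\<lambda>x::complex. sqrt (norm x)) \<longlongrightarrow> sqrt (norm (0::complex))) (at 0)" by (intro tendsto_intros)
    then show "((\<lambda>x. norm (csqrt x)) \<longlongrightarrow> 0) (at 0)" by (simp add: norm_csqrt)
  qed
  from isCont_tendsto_compose[OF cont this]
  have "((\<lambda>x. \<bar>Re (M (csqrt x))\<bar>) \<longlongrightarrow> \<bar>Re (M 0)\<bar>) (at 0)" by (intro tendsto_intros)
  then have "((\<lambda>x. \<bar>Re (M (csqrt x))\<bar>) \<longlongrightarrow> 0) (at 0)" by (simp add: M0)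
  moreover have "eventually (\<lambda>x. \<bar>Re (M (csqrt x))\<bar> = \<bar>h (x, csqrt (x * poly a x))\<bar>) (at 0)"
    unfolding eventually_at_topological
    by (intro exI[of _ "ball 0 (r\<^sup>2)"]) (use e(1) hG in auto)
  ultimately have "((\<lambda>x. \<bar>h (x, csqrt (x * poly a x))\<bar>) \<longlongrightarrow> 0) (at 0)"
    by (rule Lim_transform_eventually)
  then show ?thesis by (rule tendsto_rabs_zero_cancel)
qed

section \<open>Maximum principle and uniqueness\<close>

lemma constant_if_Re_abs_maximal:
  assumes B: "open B" "connected B" "x0 \<in> B"
    and \<Phi>: "\<And>x. x \<in> B \<Longrightarrow> (\<Phi> has_field_derivative d x) (at x)"
    and max: "\<And>x. x \<in> B \<Longrightarrow> \<bar>Re (\<Phi> x)\<bar> \<le> \<bar>Re (\<Phi> x0)\<bar>"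
    and x: "x \<in> B"
  shows "d x = 0"
proof -
  \<comment> \<open>The sign makes \<sigma> Re(\<Phi> x0) = |Re(\<Phi> x0)|, so that |exp(\<sigma>
    \<Phi>)| is largest at x0 and the maximum modulus principle applies.\<close>
  define \<sigma> :: real where "\<sigma> = (if Re (\<Phi> x0) \<ge> 0 then 1 else - 1)"
  define E where "E = (\<lambda>x. exp (of_real \<sigma> * \<Phi> x))"
  have E: "(E has_field_derivative E x * (of_real \<sigma> * d x)) (at x)" if "x \<in> B" for x
    unfolding E_def using \<Phi>[OF that] by (auto intro!: derivative_eq_intros)
  have hol: "E holomorphic_on B" unfolding holomorphic_on_open[OF B(1)] using E by blast
  have "norm (E x) \<le> norm (E x0)" if "x \<in> B" for x
    using max[OF that] by (auto simp: E_def \<sigma>_def split: if_splits)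
  then have "E constant_on B"
    using maximum_modulus_principle[OF hol B(1,2) B(1) subset_refl B(3)] by blast
  then obtain c where "\<And>x. x \<in> B \<Longrightarrow> E x = c" unfolding constant_on_def by blast
  then have "(E has_field_derivative 0) (at x)"
    using has_field_derivative_transform_within_open[OF DERIV_const[of c "at x"] B(1) x] by simp
  then have "E x * (of_real \<sigma> * d x) = 0" using E[OF x] DERIV_unique by blast
  then show ?thesis by (auto simp: E_def \<sigma>_def split: if_splits)
qed

lemma poly_zero_on_ball:
  fixes p :: "complex poly"
  assumes "0 < r" "\<And>x. x \<in> ball x0 r \<Longrightarrow> poly p x = 0"
  shows "p = 0"
proof (rule ccontr)
  assume "p \<noteq> 0"
  then have "finite (ball x0 r)"
    using assms(2) by (intro finite_subset[OF _ poly_roots_finite]) auto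
  moreover have "infinite (ball x0 r)"
    using assms(1) uncountable_ball[of r x0] countable_finite by blast
  ultimately show False by blast
qed

text \<open>Pairing h with itself gives a function F on the plane with |F| = 2 h^2, continuous also
  at 0 since the pole is absent. It vanishes on the circle and at the branch points, so a maximum
  over the closed disc is found at an ordinary interior point; there \<Phi> is locally constant, and
  b vanishes on a ball.\<close>

lemma potential_zero:
  assumes a: "a \<in> spectral_polys g" and h: "potential a b h" and b0: "poly b 0 = 0"
  shows "b = 0"
proof -
  have a0: "a \<noteq> 0" by (rule spectral_polys_basic(1)[OF a])
  define F where "F = squared_potential a h h"
  have "isCont F x" for x
  proof (cases "x = 0")
    case True
    have "(F \<longlongrightarrow> 0) (at 0)"
      unfolding F_def by (intro squared_potential_tendsto_zero a0 potential_tendsto_zero[OF a h b0])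
    then show ?thesis using True by (simp add: isCont_def F_def squared_potential_def)
  qed (use isCont_squared_potential[OF a0 h h] in \<open>simp add: F_def\<close>)
  then have "continuous_on (cball 0 1) (\<lambda>x. norm (F x))"
    by (intro continuous_intros continuous_at_imp_continuous_on) auto
  from continuous_attains_sup[OF compact_cball _ this]
  obtain xm where xm: "xm \<in> cball 0 1" "\<forall>x\<in>cball 0 1. norm (F x) \<le> norm (F xm)" by auto
  \<comment> \<open>If the maximum is 0, every point of the disc is a maximum point and any one off
    the branch points will do.\<close>
  obtain x0 where x0: "x0 \<in> ball 0 1" "x0 * poly a x0 \<noteq> 0" "\<forall>x\<in>cball 0 1. norm (F x) \<le> norm (F x0)"
  proof (cases "F xm = 0")
    case True
    have "infinite (ball (0::complex) 1)"
      using uncountable_ball[of 1 "0::complex"] countable_finite by auto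
    then obtain x0 :: complex where "x0 \<in> ball 0 1" "x0 \<notin> {x. x * poly a x = 0}"
      using finite_branch_points[OF a0] by (meson finite_subset subsetI)
    moreover have "\<forall>x\<in>cball 0 1. norm (F x) \<le> norm (F x0)" using xm(2) True by (auto intro: order_trans)
    ultimately show ?thesis using that by blast
  next
    case False
    have "norm xm \<noteq> 1" using squared_potential_circle[OF h h] False by (auto simp: F_def)
    moreover have "xm * poly a xm \<noteq> 0" using False by (auto simp: F_def squared_potential_def)
    ultimately show ?thesis using xm by (intro that[of xm]) auto
  qed
  obtain r q \<Phi> \<Psi> where loc: "0 < r" "ball x0 r \<subseteq> ball 0 1"
     "\<forall>x\<in>ball x0 r. (x, q x) \<in> etale_curve a \<and>
      (\<Phi> has_field_derivative poly b x / (x * q x)) (at x) \<and>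
      (\<Psi> has_field_derivative poly b x / (x * q x)) (at x) \<and>
      h (x, q x) = Re (\<Phi> x) \<and> h (x, q x) = Re (\<Psi> x) \<and>
      F x = (Complex (Re (\<Phi> x)) (Re (\<Psi> x)))\<^sup>2"
    using squared_potential_local[OF h h x0(2) open_ball x0(1)] unfolding F_def by blast
  have F: "norm (F x) = 2 * (Re (\<Phi> x))\<^sup>2" if "x \<in> ball x0 r" for x
  proof -
    have "F x = (Complex (Re (\<Phi> x)) (Re (\<Phi> x)))\<^sup>2" using loc(3) that by metis
    then show ?thesis by (simp add: norm_power cmod_power2)
  qed
  have "poly b x = 0" if x: "x \<in> ball x0 r" for x
  proof -
    have "poly b x / (x * q x) = 0"
    proof (rule constant_if_Re_abs_maximal[OF open_ball connected_ball _ _ _ x])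
      show "x0 \<in> ball x0 r" using loc(1) by simp
      show "(\<Phi> has_field_derivative poly b x / (x * q x)) (at x)" if "x \<in> ball x0 r" for x
        using loc(3) that by blast
      show "\<bar>Re (\<Phi> x)\<bar> \<le> \<bar>Re (\<Phi> x0)\<bar>" if "x \<in> ball x0 r" for x
      proof -
        have "norm (F x) \<le> norm (F x0)" using x0(3) loc(2) that by (auto simp: subset_iff)
        then have "(Re (\<Phi> x))\<^sup>2 \<le> (Re (\<Phi> x0))\<^sup>2" using F[OF that] F[of x0] loc(1) by simp
        then show ?thesis by (simp add: abs_le_square_iff)
      qed
    qed
    moreover have "(x, q x) \<in> etale_curve a" using loc(3) x by blast
    then have "x * q x \<noteq> 0" by (auto simp: etale_curve_iff)
    ultimately show ?thesis by simp
  qed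
  then show ?thesis by (rule poly_zero_on_ball[OF loc(1)])
qed

section \<open>Proper maps of degree one\<close>

text \<open>Properness controls sets only inside compact subsets of Y. By local compactness this
  suffices for relative closedness in Y.\<close>

lemma open_diff_if_compactly_closed:
  fixes Y S :: "'a::heine_borel set"
  assumes Y: "open Y" and closed: "\<And>C. compact C \<Longrightarrow> C \<subseteq> Y \<Longrightarrow> closed (S \<inter> C)"
  shows "open (Y - S)"
proof (rule Topological_Spaces.openI)
  fix y assume y: "y \<in> Y - S"
  then obtain e where e: "e > 0" "cball y e \<subseteq> Y" using Y open_contains_cball by blast
  have "open (ball y e - (S \<inter> cball y e))"
    by (intro open_Diff open_ball closed compact_cball e(2))
  moreover have "ball y e - (S \<inter> cball y e) \<subseteq> Y - S"
    using e(2) by (auto simp: subset_iff)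
  ultimately show "\<exists>T. open T \<and> y \<in> T \<and> T \<subseteq> Y - S" using y e(1) by (intro exI conjI) auto
qed

text \<open>A proper local homeomorphism onto a connected space that takes one value exactly once is
  injective, since the values taken at least twice form an open and closed set.\<close>

lemma proper_local_homeo_degree_one:
  fixes f :: "'a::euclidean_space \<Rightarrow> 'a"
  assumes X: "open X" and f: "continuous_on X f" and Y: "open Y" "connected Y" and fXY: "f ` X \<subseteq> Y"
    and proper: "\<And>C. compact C \<Longrightarrow> C \<subseteq> Y \<Longrightarrow> compact {x \<in> X. f x \<in> C}"
    and inj: "\<And>x. x \<in> X \<Longrightarrow> \<exists>r>0. inj_on f (X \<inter> ball x r)"
    and one: "x0 \<in> X" "\<And>x. x \<in> X \<Longrightarrow> f x = f x0 \<Longrightarrow> x = x0"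
  shows "inj_on f X" "f ` X = Y"
proof -
  have clopen: "S = {} \<or> S = Y" if S: "S \<subseteq> Y" "open S" "\<And>C. compact C \<Longrightarrow> C \<subseteq> Y \<Longrightarrow> closed (S \<inter> C)" for S
  proof -
    have "open (Y - S)" by (rule open_diff_if_compactly_closed[OF Y(1) S(3)])
    with S(1,2) Y(2) have "S \<inter> Y = {} \<or> (Y - S) \<inter> Y = {}"
      by (intro connectedD) auto
    then show ?thesis using S(1) by auto
  qed
  \<comment> \<open>Openness of f comes from local injectivity by invariance of domain.\<close>
  have open_map: "\<exists>T. open T \<and> f x \<in> T \<and> T \<subseteq> f ` V" if V: "open V" "x \<in> V" "V \<subseteq> X" for V x
  proof -
    obtain r where r: "r > 0" "inj_on f (X \<inter> ball x r)" using inj V by blast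
    have "V \<inter> ball x r \<subseteq> X \<inter> ball x r" using V(3) by blast
    then have "open (f ` (V \<inter> ball x r))"
      using V f r(2) by (intro invariance_of_domain) (auto intro: continuous_on_subset inj_on_subset)
    then show ?thesis using V(2) r(1) by (intro exI[of _ "f ` (V \<inter> ball x r)"]) auto
  qed
  define D where "D = {y. \<exists>x\<in>X. \<exists>x'\<in>X. x \<noteq> x' \<and> f x = y \<and> f x' = y}"
  have "D \<subseteq> Y" using fXY by (auto simp: D_def)
  moreover have "open D"
  proof (rule Topological_Spaces.openI)
    fix y assume "y \<in> D"
    then obtain x x' where x: "x \<in> X" "x' \<in> X" "x \<noteq> x'" "f x = y" "f x' = y" by (auto simp: D_def)
    obtain U U' where U: "open U" "open U'" "x \<in> U" "x' \<in> U'" "U \<inter> U' = {}" using hausdorff[OF x(3)] by blast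
    obtain T where T: "open T" "f x \<in> T" "T \<subseteq> f ` (X \<inter> U)"
      using open_map[of "X \<inter> U" x] X U x by auto
    obtain T' where T': "open T'" "f x' \<in> T'" "T' \<subseteq> f ` (X \<inter> U')"
      using open_map[of "X \<inter> U'" x'] X U x by auto
    have "T \<inter> T' \<subseteq> D"
    proof
      fix w assume w: "w \<in> T \<inter> T'"
      obtain u where u: "u \<in> X" "u \<in> U" "w = f u" using w T(3) by auto
      obtain u' where u': "u' \<in> X" "u' \<in> U'" "w = f u'" using w T'(3) by auto
      have "u \<noteq> u'" using u(2) u'(2) U(5) by auto
      then show "w \<in> D" unfolding D_def using u u' by auto
    qed
    then show "\<exists>T. open T \<and> y \<in> T \<and> T \<subseteq> D"
      using T T' x by (intro exI[of _ "T \<inter> T'"]) auto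
  qed
  moreover have "closed (D \<inter> C)" if C: "compact C" "C \<subseteq> Y" for C
    unfolding closed_sequential_limits
  proof (intro allI impI, elim conjE)
    fix y l assume y: "\<forall>n. y n \<in> D \<inter> C" and lim: "y \<longlonglongrightarrow> l"
    have "closed C" using C(1) by (rule compact_imp_closed)
    then have lC: "l \<in> C" using y lim unfolding closed_sequential_limits by blast
    have "\<forall>n. \<exists>x x'. x \<in> X \<and> x' \<in> X \<and> x \<noteq> x' \<and> f x = y n \<and> f x' = y n"
    proof
      fix n
      have "y n \<in> D" using y by blast
      then show "\<exists>x x'. x \<in> X \<and> x' \<in> X \<and> x \<noteq> x' \<and> f x = y n \<and> f x' = y n"
        unfolding D_def by blast
    qed
    then obtain u u' where u: "\<And>n. u n \<in> X" "\<And>n. u' n \<in> X" "\<And>n. u n \<noteq> u' n" "\<And>n. f (u n) = y n" "\<And>n. f (u' n) = y n"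
      by metis
    define Z where "Z = {x \<in> X. f x \<in> C}"
    have Z: "compact Z" unfolding Z_def by (rule proper[OF C])
    have uZ: "u n \<in> Z" "u' n \<in> Z" for n using u y by (auto simp: Z_def)
    have "\<exists>l\<in>Z \<times> Z. \<exists>s. strict_mono s \<and> ((\<lambda>n. (u n, u' n)) \<circ> s) \<longlonglongrightarrow> l"
      by (rule compact_Times[OF Z Z, unfolded compact_def, rule_format]) (use uZ in simp)
    then obtain p s where p: "p \<in> Z \<times> Z" "strict_mono (s :: nat \<Rightarrow> nat)" "((\<lambda>n. (u n, u' n)) \<circ> s) \<longlonglongrightarrow> p"
      by blast
    obtain x x' where xx: "p = (x, x')" by (cases p)
    have xZ: "x \<in> Z" "x' \<in> Z" using p xx by auto
    have lx: "(\<lambda>n. u (s n)) \<longlonglongrightarrow> x" "(\<lambda>n. u' (s n)) \<longlonglongrightarrow> x'"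
      using tendsto_fst[OF p(3)] tendsto_snd[OF p(3)] by (simp_all add: xx o_def)
    have ly: "(\<lambda>n. y (s n)) \<longlonglongrightarrow> l" using LIMSEQ_subseq_LIMSEQ[OF lim p(2)] by (simp add: o_def)
    have fx: "f x = l"
    proof -
      have "(\<lambda>n. f (u (s n))) \<longlonglongrightarrow> f x"
        by (rule continuous_on_tendsto_compose[OF f lx(1)]) (use xZ u in \<open>simp_all add: Z_def\<close>)
      then have "(\<lambda>n. y (s n)) \<longlonglongrightarrow> f x" by (simp add: u(4))
      then show ?thesis using ly by (rule LIMSEQ_unique)
    qed
    have fx': "f x' = l"
    proof -
      have "(\<lambda>n. f (u' (s n))) \<longlonglongrightarrow> f x'"
        by (rule continuous_on_tendsto_compose[OF f lx(2)]) (use xZ u in \<open>simp_all add: Z_def\<close>)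
      then have "(\<lambda>n. y (s n)) \<longlonglongrightarrow> f x'" by (simp add: u(5))
      then show ?thesis using ly by (rule LIMSEQ_unique)
    qed
    \<comment> \<open>If the two sequences of preimages merged in the limit, they would finally lie
      in a ball on which f is injective.\<close>
    have "x \<noteq> x'"
    proof
      assume eq: "x = x'"
      obtain r where r: "r > 0" "inj_on f (X \<inter> ball x r)" using inj xZ by (auto simp: Z_def)
      have "eventually (\<lambda>n. u (s n) \<in> ball x r) sequentially"
        by (rule topological_tendstoD[OF lx(1)]) (use r in auto)
      moreover have "eventually (\<lambda>n. u' (s n) \<in> ball x r) sequentially"
        by (rule topological_tendstoD[OF lx(2)[folded eq]]) (use r in auto)
      ultimately have "eventually (\<lambda>n. False) sequentially"
      proof eventually_elim
        case (elim n)
        then have "u (s n) = u' (s n)" using u(1,2) by - (rule inj_onD[OF r(2)], simp_all add: u(4,5))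
        then show False using u(3) by blast
      qed
      then show False by simp
    qed
    moreover have "x \<in> X" "x' \<in> X" using xZ by (simp_all add: Z_def)
    ultimately have "l \<in> D" unfolding D_def using fx fx' by blast
    then show "l \<in> D \<inter> C" using lC by blast
  qed
  ultimately have "D = {} \<or> D = Y" by (rule clopen)
  moreover have "f x0 \<notin> D" using one by (auto simp: D_def)
  moreover have "f x0 \<in> Y" using one(1) fXY by blast
  ultimately have "D = {}" by blast
  then show "inj_on f X" unfolding D_def inj_on_def by blast
  have "f ` X = {} \<or> f ` X = Y"
  proof (rule clopen[OF fXY])
    show "open (f ` X)"
    proof (rule Topological_Spaces.openI)
      fix y assume "y \<in> f ` X"
      then obtain x where x: "x \<in> X" "y = f x" by blast
      show "\<exists>T. open T \<and> y \<in> T \<and> T \<subseteq> f ` X"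
        using open_map[OF X x(1) subset_refl] unfolding x(2) .
    qed
  next
    fix C assume C: "compact C" "C \<subseteq> Y"
    have "f ` X \<inter> C = f ` {x \<in> X. f x \<in> C}" by auto
    moreover have "compact (f ` {x \<in> X. f x \<in> C})"
      using proper[OF C] f by (intro compact_continuous_image) (auto intro: continuous_on_subset)
    ultimately show "closed (f ` X \<inter> C)" by (simp add: compact_imp_closed)
  qed
  then show "f ` X = Y" using one(1) by blast
qed

text \<open>Degree one makes f a homeomorphism onto Y, again by invariance of domain, so the
  preimage of A is the image of A under a continuous inverse.\<close>

lemma proper_local_homeo_connected_vimage:
  fixes f :: "'a::euclidean_space \<Rightarrow> 'a"
  assumes X: "open X" and f: "continuous_on X f" and Y: "open Y" "connected Y" and fXY: "f ` X \<subseteq> Y"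
    and proper: "\<And>C. compact C \<Longrightarrow> C \<subseteq> Y \<Longrightarrow> compact {x \<in> X. f x \<in> C}"
    and inj: "\<And>x. x \<in> X \<Longrightarrow> \<exists>r>0. inj_on f (X \<inter> ball x r)"
    and one: "x0 \<in> X" "\<And>x. x \<in> X \<Longrightarrow> f x = f x0 \<Longrightarrow> x = x0"
    and A: "connected A" "A \<subseteq> Y"
  shows "connected {x \<in> X. f x \<in> A}"
proof -
  have deg: "inj_on f X" "f ` X = Y"
    by (rule proper_local_homeo_degree_one[OF X f Y fXY]; fact)+
  obtain h where h: "homeomorphism X (f ` X) f h"
    using invariance_of_domain_homeomorphism[OF X f order_refl deg(1)] by blast
  have hY: "h ` Y = X" "continuous_on Y h" and hf: "\<And>x. x \<in> X \<Longrightarrow> h (f x) = x"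
    and fh: "\<And>y. y \<in> Y \<Longrightarrow> f (h y) = y"
  proof -
    have h: "homeomorphism X Y f h" using h unfolding deg(2) .
    show "h ` Y = X" "continuous_on Y h" using h by (simp_all add: homeomorphism_def)
    show "h (f x) = x" if "x \<in> X" for x using h that by (simp add: homeomorphism_def)
    show "f (h y) = y" if "y \<in> Y" for y using h that by (simp add: homeomorphism_def)
  qed
  have "connected (h ` A)"
    by (rule connected_continuous_image[OF continuous_on_subset[OF hY(2) A(2)] A(1)])
  moreover have "h ` A = {x \<in> X. f x \<in> A}"
  proof (intro subset_antisym subsetI)
    fix x assume "x \<in> h ` A"
    then obtain y where "y \<in> A" "x = h y" by blast
    then show "x \<in> {x \<in> X. f x \<in> A}" using fh[of y] hY(1) A(2) by auto
  next
    fix x assume "x \<in> {x \<in> X. f x \<in> A}"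
    then have "h (f x) = x" "f x \<in> A" using hf[of x] by auto
    then show "x \<in> h ` A" by (metis imageI)
  qed
  ultimately show ?thesis by simp
qed

text \<open>Equal values at x and y force |A x - A y| = |B x - B y|. Near x0 the left side is nearly
  |A'(x0)| |x - y|, while the right side is at most slightly more than |B'(x0)| |x - y|.\<close>

lemma harmonic_locally_injective:
  fixes A B :: "complex \<Rightarrow> complex"
  assumes r: "0 < r" and A: "A holomorphic_on ball x0 r" and B: "B holomorphic_on ball x0 r"
    and lt: "norm (deriv B x0) < norm (deriv A x0)"
  shows "\<exists>r'>0. r' \<le> r \<and> inj_on (\<lambda>x. A x + cnj (B x)) (ball x0 r')"
proof -
  \<comment> \<open>One third of the gap: the errors for A and for B cost \<delta> each, leaving the
    contradiction 3 \<delta> <= 2 \<delta>.\<close>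
  define \<delta> where "\<delta> = (norm (deriv A x0) - norm (deriv B x0)) / 3"
  have \<delta>: "\<delta> > 0" using lt by (simp add: \<delta>_def)
  have "continuous_on (ball x0 r) (deriv A)" "continuous_on (ball x0 r) (deriv B)"
    using A B by (auto intro!: holomorphic_on_imp_continuous_on holomorphic_deriv)
  then have "isCont (deriv A) x0" "isCont (deriv B) x0"
    using r by (auto simp: continuous_on_eq_continuous_at)
  then obtain r1 r2 where r12: "r1 > 0" "\<And>x. dist x x0 < r1 \<Longrightarrow> dist (deriv A x) (deriv A x0) < \<delta>"
      "r2 > 0" "\<And>x. dist x x0 < r2 \<Longrightarrow> dist (deriv B x) (deriv B x0) < \<delta>"
    using \<delta> unfolding continuous_at_eps_delta by metis
  define r' where "r' = min r (min r1 r2)"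
  have r': "r' > 0" "r' \<le> r" using r r12 by (auto simp: r'_def)
  have "inj_on (\<lambda>x. A x + cnj (B x)) (ball x0 r')"
  proof (rule inj_onI, rule ccontr)
    fix x y assume x: "x \<in> ball x0 r'" and y: "y \<in> ball x0 r'"
      and eq: "A x + cnj (B x) = A y + cnj (B y)" and neq: "x \<noteq> y"
    have dA: "(A has_field_derivative deriv A z) (at z)" and dB: "(B has_field_derivative deriv B z) (at z)"
      and bA: "norm (deriv A z - deriv A x0) \<le> \<delta>" and bB: "norm (deriv B z) \<le> norm (deriv B x0) + \<delta>"
      if "z \<in> ball x0 r'" for z
    proof -
      have z: "z \<in> ball x0 r" "dist z x0 < r1" "dist z x0 < r2" using that by (auto simp: r'_def dist_commute)
      show "(A has_field_derivative deriv A z) (at z)" "(B has_field_derivative deriv B z) (at z)"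
        using A B z by (auto intro: holomorphic_derivI)
      show "norm (deriv A z - deriv A x0) \<le> \<delta>" using r12(2)[OF z(2)] by (simp add: dist_norm)
      have "norm (deriv B z - deriv B x0) \<le> \<delta>" using r12(4)[OF z(3)] by (simp add: dist_norm)
      then show "norm (deriv B z) \<le> norm (deriv B x0) + \<delta>" by (smt (verit) norm_triangle_ineq2)
    qed
    have "norm ((A x - deriv A x0 * x) - (A y - deriv A x0 * y)) \<le> \<delta> * norm (x - y)"
    proof (rule field_differentiable_bound[OF convex_ball[of x0 r'] _ _ x y])
      fix z assume z: "z \<in> ball x0 r'"
      show "((\<lambda>z. A z - deriv A x0 * z) has_field_derivative deriv A z - deriv A x0) (at z within ball x0 r')"
        using dA[OF z] by (auto intro!: derivative_eq_intros intro: has_field_derivative_at_within)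
      show "norm (deriv A z - deriv A x0) \<le> \<delta>" by (rule bA[OF z])
    qed
    moreover have "norm (B x - B y) \<le> (norm (deriv B x0) + \<delta>) * norm (x - y)"
    proof (rule field_differentiable_bound[OF convex_ball[of x0 r'] _ _ x y])
      fix z assume z: "z \<in> ball x0 r'"
      show "(B has_field_derivative deriv B z) (at z within ball x0 r')"
        using dB[OF z] by (rule has_field_derivative_at_within)
      show "norm (deriv B z) \<le> norm (deriv B x0) + \<delta>" by (rule bB[OF z])
    qed
    moreover have "norm (A x - A y) = norm (B x - B y)"
    proof -
      have "A x - A y = - cnj (B x - B y)" using eq by (simp add: algebra_simps)
      then show ?thesis by (metis complex_mod_cnj norm_minus_cancel)
    qed
    moreover have "norm (deriv A x0 * (x - y)) \<le> norm (A x - A y) + norm ((A x - deriv A x0 * x) - (A y - deriv A x0 * y))"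
    proof -
      have "deriv A x0 * (x - y) = (A x - A y) - ((A x - deriv A x0 * x) - (A y - deriv A x0 * y))"
        by (simp add: algebra_simps)
      then show ?thesis by (metis norm_triangle_ineq4)
    qed
    ultimately have "norm (deriv A x0 * (x - y)) \<le> (norm (deriv B x0) + \<delta>) * norm (x - y) + \<delta> * norm (x - y)"
      by linarith
    then have "norm (deriv A x0) * norm (x - y) \<le> (norm (deriv B x0) + \<delta> + \<delta>) * norm (x - y)"
      by (simp add: norm_mult distrib_right)
    then have "norm (deriv A x0) \<le> norm (deriv B x0) + \<delta> + \<delta>" using neq by simp
    then show False using \<delta> by (simp add: \<delta>_def field_simps)
  qed
  then show ?thesis using r' by blast
qed

section \<open>The map of the disc given by two potentials\<close>

lemma holomorphic_Lipschitz_near: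
  assumes r: "0 < r" and M: "M holomorphic_on ball 0 r"
  shows "\<exists>r' L. 0 < r' \<and> r' < r \<and> (\<forall>s\<in>ball 0 r'. \<forall>t\<in>ball 0 r'. norm (M s - M t) \<le> L * norm (s - t))"
proof -
  have sub: "cball 0 (r/2) \<subseteq> ball 0 r" using r by auto
  have "continuous_on (cball 0 (r/2)) (deriv M)"
    by (intro holomorphic_on_imp_continuous_on holomorphic_on_subset[OF holomorphic_deriv[OF M open_ball] sub])
  then have "compact (deriv M ` cball 0 (r/2))" by (intro compact_continuous_image compact_cball)
  then obtain L where L: "\<And>z. z \<in> cball 0 (r/2) \<Longrightarrow> norm (deriv M z) \<le> L"
    by (metis bounded_iff compact_imp_bounded imageI)
  have "norm (M s - M t) \<le> L * norm (s - t)" if st: "s \<in> ball 0 (r/2)" "t \<in> ball 0 (r/2)" for s t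
  proof (rule field_differentiable_bound[OF convex_ball[of 0 "r/2"] _ _ st])
    fix z :: complex assume z: "z \<in> ball 0 (r/2)"
    show "(M has_field_derivative deriv M z) (at z within ball 0 (r/2))"
      by (rule has_field_derivative_at_within, rule holomorphic_derivI[OF M]) (use z r in auto)
    show "norm (deriv M z) \<le> L" using L z by auto
  qed
  then show ?thesis using r by (intro exI[of _ "r/2"] exI[of _ L]) auto
qed

text \<open>In s = sqrt x the map is H = cnj (A / s) + m with m Lipschitz. The pole term separates s
  and t by |A| |s - t| / |s t|, which beats the Lipschitz bound for small s and t; so H is injective
  there. As H is odd, H^2 is injective in x = s^2.\<close>

lemma squared_potential_inverse_near_zero:
  assumes a: "a \<in> spectral_polys g" and h: "potential a b h" and k: "potential a c k"
    and b0: "poly b 0 = 1" and c0: "poly c 0 = \<i>"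
  shows "\<exists>r>0. \<exists>C. inj_on (\<lambda>x. inverse (squared_potential a h k x)) (ball 0 r) \<and>
    (\<forall>x\<in>ball 0 r - {0}. squared_potential a h k x \<noteq> 0) \<and>
    (\<forall>x\<in>ball 0 r. norm (inverse (squared_potential a h k x)) \<le> C * norm x)"
proof -
  define F where "F = squared_potential a h k"
  obtain r0 e M N where r0: "0 < r0" and e: "e \<noteq> 0" and MN: "M holomorphic_on ball 0 r0" "N holomorphic_on ball 0 r0"
    and F: "\<forall>s\<in>ball 0 r0 - {0}. F (s\<^sup>2) =
       (Complex (Re (M s - 2 * poly b 0 / (e * s))) (Re (N s - 2 * poly c 0 / (e * s))))\<^sup>2 \<and>
       Re (M (- s)) = - Re (M s) \<and> Re (N (- s)) = - Re (N s)"
    using squared_potential_near_zero[OF a h k] unfolding F_def by blast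
  define A where "A = - 2 / e"
  have A: "A \<noteq> 0" using e by (simp add: A_def)
  define m where "m = (\<lambda>s. Complex (Re (M s)) (Re (N s)))"
  define H where "H = (\<lambda>s. cnj (A / s) + m s)"
  have FH: "F (s\<^sup>2) = (H s)\<^sup>2" and odd: "H (- s) = - H s" if "s \<in> ball 0 r0 - {0}" for s
  proof -
    have "2 * poly b 0 / (e * s) = - (A / s)" "2 * poly c 0 / (e * s) = - (\<i> * (A / s))"
      by (simp_all add: A_def b0 c0)
    \<comment> \<open>The values 1 and i at 0 enter here: Re w + i Re(i w) = cnj w, so the two pole
      terms combine to a single antiholomorphic one.\<close>
    moreover have "Complex (Re (M s - - w)) (Re (N s - - (\<i> * w))) = cnj w + m s" for w
      by (simp add: m_def complex_eq_iff)
    ultimately have "Complex (Re (M s - 2 * poly b 0 / (e * s))) (Re (N s - 2 * poly c 0 / (e * s))) = H s"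
      unfolding H_def by metis
    then show "F (s\<^sup>2) = (H s)\<^sup>2" using F[rule_format, OF that] by metis
    show "H (- s) = - H s" using F[rule_format, OF that] by (simp add: H_def m_def complex_eq_iff)
  qed
  obtain r1 L1 where L1: "0 < r1" "r1 < r0" "\<forall>s\<in>ball 0 r1. \<forall>t\<in>ball 0 r1. norm (M s - M t) \<le> L1 * norm (s - t)"
    using holomorphic_Lipschitz_near[OF r0 MN(1)] by blast
  obtain r2 L2 where L2: "0 < r2" "r2 < r0" "\<forall>s\<in>ball 0 r2. \<forall>t\<in>ball 0 r2. norm (N s - N t) \<le> L2 * norm (s - t)"
    using holomorphic_Lipschitz_near[OF r0 MN(2)] by blast
  define L where "L = max 1 (L1 + L2)"
  have L: "L \<ge> 1" "L1 + L2 \<le> L" by (auto simp: L_def)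
  have Lip: "norm (m s - m t) \<le> L * norm (s - t)" if "s \<in> ball 0 (min r1 r2)" "t \<in> ball 0 (min r1 r2)" for s t
  proof -
    have "norm (m s - m t) \<le> \<bar>Re (M s - M t)\<bar> + \<bar>Re (N s - N t)\<bar>"
      using cmod_le[of "m s - m t"] by (simp add: m_def)
    also have "\<dots> \<le> norm (M s - M t) + norm (N s - N t)" by (intro add_mono abs_Re_le_cmod)
    also have "\<dots> \<le> L1 * norm (s - t) + L2 * norm (s - t)" using L1(3) L2(3) that by (intro add_mono) auto
    also have "\<dots> \<le> L * norm (s - t)" using L(2) by (metis distrib_right mult_right_mono norm_ge_zero)
    finally show ?thesis .
  qed
  define B where "B = norm (m 0) + L"
  have B: "B > 0" using L(1) by (simp add: B_def add_nonneg_pos)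
  \<comment> \<open>\<open>r1\<close>, \<open>r2\<close> are for the Lipschitz bounds; 1 and |A| /
    (2 L) give L |s| |t| <= |A| / 2 for injectivity; |A| / (2 B) keeps |m s| below half of the pole
    term.\<close>
  define \<rho> where "\<rho> = Min {r1, r2, 1, norm A / (2 * L), norm A / (2 * B)}"
  have \<rho>: "\<rho> > 0" using L1 L2 A B L(1) by (auto simp: \<rho>_def)
  have \<rho>le: "\<rho> \<le> r1" "\<rho> \<le> r2" "\<rho> \<le> 1" "\<rho> \<le> norm A / (2 * L)" "\<rho> \<le> norm A / (2 * B)"
    by (auto simp: \<rho>_def)
  have sub: "s \<in> ball 0 (min r1 r2)" "s \<in> ball 0 r0 - {0}" if "s \<in> ball 0 \<rho> - {0}" for s
    using that \<rho>le L1(2) by auto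
  have Hlow: "norm (H s) \<ge> norm A / (2 * norm s)" if s: "s \<in> ball 0 \<rho> - {0}" for s
  proof -
    have "norm (m s) \<le> norm (m 0) + norm (m s - m 0)" by (metis norm_triangle_sub)
    also have "\<dots> \<le> norm (m 0) + L * norm (s - 0)"
      using Lip[OF sub(1)[OF s], of 0] L1(1) L2(1) by simp
    also have "\<dots> \<le> norm (m 0) + L * 1" using s \<rho>le(3) L(1) by (intro add_mono mult_left_mono) auto
    finally have mB: "norm (m s) \<le> B" by (simp add: B_def)
    have "norm s \<le> norm A / (2 * B)" using s \<rho>le(5) by auto
    then have "B \<le> norm A / (2 * norm s)" using B s by (simp add: field_simps)
    moreover have "norm (cnj (A / s)) \<le> norm (H s) + norm (m s)"
      unfolding H_def by (metis add_diff_cancel_right' norm_triangle_ineq4)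
    moreover have "norm (cnj (A / s)) = norm A / (2 * norm s) + norm A / (2 * norm s)"
      by (simp add: norm_divide)
    ultimately show ?thesis using mB by linarith
  qed
  have Hinj: "s = t" if s: "s \<in> ball 0 \<rho> - {0}" and t: "t \<in> ball 0 \<rho> - {0}" and eq: "H s = H t" for s t
  proof (rule ccontr)
    assume neq: "s \<noteq> t"
    have "cnj (A / s - A / t) = m t - m s" using eq by (simp add: H_def algebra_simps)
    then have "norm (A / s - A / t) = norm (m t - m s)" by (metis complex_mod_cnj)
    also have "\<dots> \<le> L * norm (t - s)" by (rule Lip[OF sub(1)[OF t] sub(1)[OF s]])
    also have "A / s - A / t = A * (t - s) / (s * t)" using s t by (simp add: field_simps)
    finally have "norm A * norm (t - s) / (norm s * norm t) \<le> L * norm (t - s)"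
      by (simp only: norm_mult norm_divide)
    moreover have "norm s * norm t > 0" using s t by simp
    ultimately have "norm A * norm (t - s) \<le> L * norm (t - s) * (norm s * norm t)"
      by (simp only: pos_divide_le_eq)
    then have "norm A \<le> L * (norm s * norm t)" using neq by (simp add: mult.assoc mult.left_commute)
    moreover have "norm s * norm t \<le> norm A / (2 * L) * 1"
      using s t \<rho>le(3,4) L(1) by (intro mult_mono) auto
    then have "L * (norm s * norm t) \<le> norm A / 2" using L(1) by (simp add: field_simps)
    moreover have "norm A > 0" using A by simp
    ultimately show False by linarith
  qed
  have root: "csqrt x \<in> ball 0 \<rho> - {0}" if "x \<in> ball 0 (\<rho>\<^sup>2) - {0}" for x
    using that \<rho> by (auto simp: norm_csqrt real_less_lsqrt)
  have low: "norm (F x) \<ge> (norm A)\<^sup>2 / (4 * norm x)" if x: "x \<in> ball 0 (\<rho>\<^sup>2) - {0}" for x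
  proof -
    have "F ((csqrt x)\<^sup>2) = (H (csqrt x))\<^sup>2" by (rule FH[OF sub(2)[OF root[OF x]]])
    then have "norm (F x) = (norm (H (csqrt x)))\<^sup>2" by (simp add: norm_power)
    moreover have "(norm A / (2 * norm (csqrt x)))\<^sup>2 \<le> (norm (H (csqrt x)))\<^sup>2"
      using Hlow[OF root[OF x]] by (intro power_mono) auto
    moreover have "(norm A / (2 * norm (csqrt x)))\<^sup>2 = (norm A)\<^sup>2 / (4 * norm x)"
      by (simp add: power_divide power_mult_distrib norm_csqrt)
    ultimately show ?thesis by linarith
  qed
  have nz: "F x \<noteq> 0" if x: "x \<in> ball 0 (\<rho>\<^sup>2) - {0}" for x
  proof -
    have "(norm A)\<^sup>2 / (4 * norm x) > 0" using A x by simp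
    then show ?thesis using low[OF x] by auto
  qed
  \<comment> \<open>The default value 0 at the pole is wanted: since \<open>inverse 0 = 0\<close>,
    the function 1/F receives its limit 0 there.\<close>
  have F0: "F 0 = 0" by (simp add: F_def squared_potential_def)
  have "norm (inverse (F x)) \<le> 4 / (norm A)\<^sup>2 * norm x" if x: "x \<in> ball 0 (\<rho>\<^sup>2)" for x
  proof (cases "x = 0")
    case False
    have "(norm A)\<^sup>2 / (4 * norm x) > 0" using A False by simp
    then have "inverse (norm (F x)) \<le> inverse ((norm A)\<^sup>2 / (4 * norm x))"
      using low[of x] x False by (intro le_imp_inverse_le) auto
    then show ?thesis by (simp add: norm_inverse)
  qed (simp add: F0)
  moreover have "inj_on (\<lambda>x. inverse (F x)) (ball 0 (\<rho>\<^sup>2))"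
  proof (rule inj_onI)
    fix x y assume x: "x \<in> ball 0 (\<rho>\<^sup>2)" and y: "y \<in> ball 0 (\<rho>\<^sup>2)" and "inverse (F x) = inverse (F y)"
    then have eq: "F x = F y" by simp
    show "x = y"
    proof (cases "x = 0 \<or> y = 0")
      case True
      then show ?thesis using eq nz x y F0 by (metis DiffI singletonD)
    next
      case False
      define s t where "s = csqrt x" and "t = csqrt y"
      have s: "s \<in> ball 0 \<rho> - {0}" and t: "t \<in> ball 0 \<rho> - {0}"
        using root x y False by (auto simp: s_def t_def)
      have st: "x = s\<^sup>2" "y = t\<^sup>2" by (auto simp: s_def t_def)
      have "(H s)\<^sup>2 = (H t)\<^sup>2" using eq FH[OF sub(2)[OF s]] FH[OF sub(2)[OF t]] st by simp
      \<comment> \<open>The sign lost by squaring is absorbed into t, and t and - t lie over the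
        same x.\<close>
      then have "H s = H t \<or> H s = H (- t)" using odd[OF sub(2)[OF t]] by (simp add: power2_eq_iff)
      moreover have "- t \<in> ball 0 \<rho> - {0}" using t by simp
      ultimately have "s = t \<or> s = - t" using Hinj s t by blast
      then show ?thesis using st by auto
    qed
  qed
  ultimately show ?thesis unfolding F_def[symmetric] using \<rho> nz
    by (intro exI[of _ "\<rho>\<^sup>2"] conjI exI[of _ "4 / (norm A)\<^sup>2"]) auto
qed

text \<open>The conjugate of H splits as A + cnj B, where A' and B' are c1 - i c2 and c1 + i c2, for
  the pair b, c, up to the common factor 1 / (2 x y). The inequality is thus the condition under
  which a harmonic map with dominating holomorphic part is locally injective.\<close>

lemma squared_potential_regular_point:
  assumes h: "potential a b h" and k: "potential a c k"
    and x0: "x0 * poly a x0 \<noteq> 0" and lt: "norm (poly (b + smult \<i> c) x0) < norm (poly (b - smult \<i> c) x0)"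
  shows "\<exists>r>0. \<exists>H. inj_on H (ball x0 r) \<and> continuous_on (ball x0 r) H \<and>
    (\<forall>x\<in>ball x0 r. squared_potential a h k x = (H x)\<^sup>2)"
proof -
  obtain r q \<Phi> \<Psi> where r: "0 < r" and loc: "\<forall>x\<in>ball x0 r. (x, q x) \<in> etale_curve a \<and>
      (\<Phi> has_field_derivative poly b x / (x * q x)) (at x) \<and>
      (\<Psi> has_field_derivative poly c x / (x * q x)) (at x) \<and>
      h (x, q x) = Re (\<Phi> x) \<and> k (x, q x) = Re (\<Psi> x) \<and>
      squared_potential a h k x = (Complex (Re (\<Phi> x)) (Re (\<Psi> x)))\<^sup>2"
    using squared_potential_local[OF h k x0 open_UNIV, simplified] by blast
  define A where "A = (\<lambda>x. (\<Phi> x - \<i> * \<Psi> x) / 2)"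
  define B where "B = (\<lambda>x. (\<Phi> x + \<i> * \<Psi> x) / 2)"
  define H where "H = (\<lambda>x. Complex (Re (\<Phi> x)) (Re (\<Psi> x)))"
  have A': "(A has_field_derivative poly (b - smult \<i> c) x / (2 * (x * q x))) (at x)"
    and B': "(B has_field_derivative poly (b + smult \<i> c) x / (2 * (x * q x))) (at x)" if "x \<in> ball x0 r" for x
  proof -
    have d: "(\<Phi> has_field_derivative poly b x / (x * q x)) (at x)"
      "(\<Psi> has_field_derivative poly c x / (x * q x)) (at x)" using loc that by auto
    from DERIV_cdivide[OF DERIV_diff[OF d(1) DERIV_cmult[OF d(2), of \<i>]], of 2]
    show "(A has_field_derivative poly (b - smult \<i> c) x / (2 * (x * q x))) (at x)"
      by (simp add: A_def diff_divide_distrib mult.commute)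
    from DERIV_cdivide[OF DERIV_add[OF d(1) DERIV_cmult[OF d(2), of \<i>]], of 2]
    show "(B has_field_derivative poly (b + smult \<i> c) x / (2 * (x * q x))) (at x)"
      by (simp add: B_def add_divide_distrib mult.commute)
  qed
  have hol: "A holomorphic_on ball x0 r" "B holomorphic_on ball x0 r"
    unfolding holomorphic_on_open[OF open_ball] using A' B' by blast+
  have x0r: "x0 \<in> ball x0 r" using r by simp
  have "(x0, q x0) \<in> etale_curve a" using loc x0r by blast
  then have "x0 * q x0 \<noteq> 0" by (auto simp: etale_curve_iff)
  then have "norm (deriv B x0) < norm (deriv A x0)"
    using lt DERIV_imp_deriv[OF A'[OF x0r]] DERIV_imp_deriv[OF B'[OF x0r]]
    by (simp add: norm_divide norm_mult divide_strict_right_mono)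
  from harmonic_locally_injective[OF r hol this] obtain r' where r': "r' > 0" "r' \<le> r"
    "inj_on (\<lambda>x. A x + cnj (B x)) (ball x0 r')" by blast
  have "A x + cnj (B x) = cnj (H x)" for x by (simp add: A_def B_def H_def complex_eq_iff field_simps)
  then have "inj_on H (ball x0 r')" using r'(3) by (simp add: inj_on_def)
  moreover have "continuous_on (ball x0 r') H"
  proof -
    have "continuous_on (ball x0 r) \<Phi>" "continuous_on (ball x0 r) \<Psi>"
      using loc by (meson DERIV_continuous continuous_at_imp_continuous_on)+
    then have "continuous_on (ball x0 r) H"
      unfolding H_def Complex_eq by (intro continuous_intros)
    then show ?thesis using r'(2) by (auto intro: continuous_on_subset)
  qed
  moreover have "\<forall>x\<in>ball x0 r'. squared_potential a h k x = (H x)\<^sup>2"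
    using loc r'(2) unfolding H_def by (auto simp: subset_iff)
  ultimately show ?thesis using r'(1) by blast
qed

text \<open>Near x0 the values of H lie within |H x0| of H x0, and that disc contains no pair w, -
  w; so squaring identifies nothing.\<close>

lemma inj_on_inverse_square:
  fixes H :: "complex \<Rightarrow> complex"
  assumes r: "0 < r" and inj: "inj_on H (ball x0 r)" and cont: "continuous_on (ball x0 r) H" and nz: "H x0 \<noteq> 0"
  shows "\<exists>r'>0. r' \<le> r \<and> inj_on (\<lambda>x. inverse ((H x)\<^sup>2)) (ball x0 r')"
proof -
  have "isCont H x0" using cont r by (simp add: continuous_on_eq_continuous_at)
  then obtain d where d: "d > 0" "\<And>x. dist x x0 < d \<Longrightarrow> dist (H x) (H x0) < norm (H x0)"
    using nz unfolding continuous_at_eps_delta by (metis zero_less_norm_iff)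
  have "inj_on (\<lambda>x. inverse ((H x)\<^sup>2)) (ball x0 (min r d))"
  proof (rule inj_onI)
    fix x y assume x: "x \<in> ball x0 (min r d)" and y: "y \<in> ball x0 (min r d)"
      and eq: "inverse ((H x)\<^sup>2) = inverse ((H y)\<^sup>2)"
    have "H x \<noteq> - H y"
    proof
      assume "H x = - H y"
      then have "2 * norm (H x0) = norm ((H x0 - H x) + (H x0 - H y))" by (simp add: norm_mult)
      also have "\<dots> \<le> norm (H x0 - H x) + norm (H x0 - H y)" by (rule norm_triangle_ineq)
      also have "\<dots> < norm (H x0) + norm (H x0)"
        using d(2)[of x] d(2)[of y] x y by (intro add_strict_mono) (auto simp: dist_norm norm_minus_commute)
      finally show False by simp
    qed
    then have "H x = H y" using eq by (simp add: power2_eq_iff)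
    then show "x = y" using inj x y by (auto simp: inj_on_def)
  qed
  then show ?thesis using r d(1) by (intro exI[of _ "min r d"]) auto
qed

text \<open>Positivity excludes roots on the circle, and the reflection moves a root outside the
  disc to one inside. This is the only source of g > 0 in the final contradiction.\<close>

lemma root_in_disc:
  assumes a: "a \<in> spectral_polys g" and g: "g > 0"
  shows "\<exists>\<alpha>. poly a \<alpha> = 0 \<and> \<alpha> \<noteq> 0 \<and> norm \<alpha> < 1"
proof -
  have "degree a \<noteq> 0" using spectral_polys_basic(4)[OF a] g by simp
  then have "\<not> constant (poly a)" by (simp add: constant_degree)
  then obtain z where z: "poly a z = 0"
    using Fundamental_Theorem_Algebra.fundamental_theorem_of_algebra by blast
  have z0: "z \<noteq> 0" using z spectral_polys_basic(2)[OF a] by auto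
  have "norm z \<noteq> 1"
  proof
    assume "norm z = 1"
    then have "z \<in> sphere 0 1" by simp
    then obtain r where "r > 0" "poly a z / z ^ g = complex_of_real r"
      using a unfolding spectral_polys_def by blast
    then show False using z by simp
  qed
  then consider "norm z < 1" | "norm z > 1" by linarith
  then show ?thesis
  proof cases
    case 1
    then show ?thesis using z z0 by blast
  next
    case 2
    have "poly a (inverse (cnj z)) = 0"
      using poly_real_polys_reflect[OF spectral_polys_basic(3)[OF a] z0] z by simp
    moreover have "norm (inverse (cnj z)) < 1" using 2 by (simp add: norm_inverse inverse_less_1_iff)
    ultimately show ?thesis using z0 by (intro exI[of _ "inverse (cnj z)"]) simp
  qed
qed

text \<open>Off a finite set H is locally injective, so its zeros are isolated there. Countability
  later permits circles and points that avoid the zeros.\<close>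

lemma squared_potential_zeros_countable:
  assumes a: "a \<in> spectral_polys g" and h: "potential a b h" and k: "potential a c k"
    and Q: "b - smult \<i> c \<noteq> 0"
    and dom: "\<And>x. norm x < 1 \<Longrightarrow> poly (b - smult \<i> c) x \<noteq> 0 \<Longrightarrow>
      norm (poly (b + smult \<i> c) x) < norm (poly (b - smult \<i> c) x)"
  shows "countable {x \<in> ball 0 1. squared_potential a h k x = 0}"
proof -
  define F where "F = squared_potential a h k"
  have a0: "a \<noteq> 0" by (rule spectral_polys_basic(1)[OF a])
  define E where "E = {x. x * poly a x = 0} \<union> {x. poly (b - smult \<i> c) x = 0}"
  have finE: "finite E" unfolding E_def using finite_branch_points[OF a0] poly_roots_finite[OF Q] by simp
  define W where "W = ball 0 1 - E"
  have openW: "open W" unfolding W_def using finE by (intro open_Diff finite_imp_closed) auto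
  have isol: "eventually (\<lambda>y. y \<notin> {x. F x = 0}) (at y)" if y: "y \<in> W" for y
  proof -
    have "y * poly a y \<noteq> 0" "poly (b - smult \<i> c) y \<noteq> 0" "norm y < 1" using y by (auto simp: W_def E_def)
    from squared_potential_regular_point[OF h k this(1) dom[OF this(3,2)]]
    obtain r H where H: "r > 0" "inj_on H (ball y r)" "\<forall>x\<in>ball y r. F x = (H x)\<^sup>2"
      unfolding F_def by blast
    show ?thesis
    \<comment> \<open>Injectivity of H allows at most one zero in the ball. If it is some z other
      than y, the smaller ball around y that stops at z is free of zeros.\<close>
    proof (cases "\<exists>z\<in>ball y r - {y}. F z = 0")
      case True
      then obtain z where z: "z \<in> ball y r - {y}" "F z = 0" by blast
      have "F x \<noteq> 0" if x: "x \<in> ball y (dist y z)" for x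
      proof
        assume "F x = 0"
        moreover have xr: "x \<in> ball y r" using x z by auto
        ultimately have "H x = H z" using H(3) z by (metis DiffD1 zero_eq_power2)
        then have "x = z" using H(2) xr z by (auto simp: inj_on_def)
        then show False using x by simp
      qed
      then show ?thesis unfolding eventually_at_topological
        using z by (intro exI[of _ "ball y (dist y z)"]) auto
    next
      case False
      then show ?thesis unfolding eventually_at_topological
        using H(1) by (intro exI[of _ "ball y r"]) auto
    qed
  qed
  have "{x. F x = 0} sparse_in W" using sparse_in_eventually_iff[OF openW] isol by blast
  then have "countable (W \<inter> {x. F x = 0})" by (rule sparse_imp_countable[OF openW])
  moreover have "{x \<in> ball 0 1. F x = 0} \<subseteq> (W \<inter> {x. F x = 0}) \<union> E" by (auto simp: W_def)
  ultimately show ?thesis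
    unfolding F_def[symmetric] using finE by (meson countable_Un countable_finite countable_subset)
qed

lemma tends_to_zero_near:
  fixes F :: "complex \<Rightarrow> complex"
  assumes "isCont F x" "F x = 0" "0 < \<epsilon>"
  obtains \<delta> where "\<delta> > 0" "\<And>y. y \<in> ball x \<delta> \<Longrightarrow> norm (F y) < \<epsilon>"
proof -
  obtain \<delta> where "\<delta> > 0" "\<And>y. dist y x < \<delta> \<Longrightarrow> dist (F y) (F x) < \<epsilon>"
    using assms(1,3) unfolding continuous_at_eps_delta by metis
  then show ?thesis using that assms(2) by (simp add: dist_commute)
qed

lemma open_avoid_countable:
  fixes U :: "complex set"
  assumes "open U" "U \<noteq> {}" "countable Z"
  obtains x where "x \<in> U" "x \<notin> Z"
proof -
  obtain y r where "r > 0" "ball y r \<subseteq> U" using assms(1,2) open_contains_ball by blast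
  then have "uncountable U" using uncountable_ball[of r y] countable_subset by blast
  then have "\<not> U \<subseteq> Z" using assms(3) countable_subset by blast
  then show ?thesis using that by blast
qed

text \<open>If $|c_1 + i c_2| < |c_1 - i c_2|$ held throughout the disc (off the zeros of $c_1 - i c_2$), then $1/H^2$,
  where $H = h_1 + i h_2$, would be a proper map from a subset of the disc to the plane that is locally injective off finitely many
  fibres and takes the value $0$ once. A neighbourhood of infinity would then have a connected preimage,
  but $H$ vanishes both on the circle and at the branch points in the disc.\<close>

lemma not_dominated_in_disc:
  assumes a: "a \<in> spectral_polys g" and g: "g > 0" and h: "potential a b h" and k: "potential a c k"
    and b0: "poly b 0 = 1" and c0: "poly c 0 = \<i>"
  shows "\<exists>x. norm x < 1 \<and> poly (b - smult \<i> c) x \<noteq> 0 \<and>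
    norm (poly (b - smult \<i> c) x) \<le> norm (poly (b + smult \<i> c) x)"
proof (rule ccontr)
  assume "\<not> ?thesis"
  then have dom: "norm (poly (b + smult \<i> c) x) < norm (poly (b - smult \<i> c) x)"
    if "norm x < 1" "poly (b - smult \<i> c) x \<noteq> 0" for x
    using that not_le by blast
  define F where "F = squared_potential a h k"
  define K where "K = (\<lambda>x. inverse (F x))"
  have a0: "a \<noteq> 0" by (rule spectral_polys_basic(1)[OF a])
  have "poly (b - smult \<i> c) 0 \<noteq> 0" by (simp add: b0 c0)
  then have Q: "b - smult \<i> c \<noteq> 0" by auto
  have F0: "F x = 0" if "x * poly a x = 0" for x using that by (simp add: F_def squared_potential_def)
  have F1: "F x = 0" if "norm x = 1" for x unfolding F_def by (rule squared_potential_circle[OF h k that])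
  have contF: "isCont F x" if "x \<noteq> 0" for x unfolding F_def by (rule isCont_squared_potential[OF a0 h k that])
  obtain r0 C0 where r0: "r0 > 0" "inj_on K (ball 0 r0)" "\<And>x. x \<in> ball 0 r0 - {0} \<Longrightarrow> F x \<noteq> 0"
    "\<And>x. x \<in> ball 0 r0 \<Longrightarrow> norm (K x) \<le> C0 * norm x"
    using squared_potential_inverse_near_zero[OF a h k b0 c0] unfolding K_def F_def by blast
  have K0: "K 0 = 0" by (simp add: K_def F0)
  have contK0: "isCont K 0"
  proof -
    have "((\<lambda>x::complex. C0 * norm x) \<longlongrightarrow> C0 * norm (0::complex)) (at 0)" by (intro tendsto_intros)
    then have "((\<lambda>x. C0 * norm x) \<longlongrightarrow> 0) (at (0::complex))" by simp
    moreover have "eventually (\<lambda>x. norm (K x) \<le> C0 * norm x) (at 0)"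
      unfolding eventually_at_topological using r0(1,4) by (intro exI[of _ "ball 0 r0"]) auto
    ultimately have "(K \<longlongrightarrow> 0) (at 0)" by (rule Lim_null_comparison[rotated])
    then show ?thesis by (simp add: isCont_def K0)
  qed
  \<comment> \<open>At 0 the convention \<open>inverse 0 = 0\<close> gives K its true limit; at the
    other zeros of F it does not, since 1/H^2 tends to infinity there, and these are left
    out.\<close>
  define X where "X = {x \<in> ball 0 1. x = 0 \<or> F x \<noteq> 0}"
  have contK: "isCont K x" if "x \<in> X" for x
  proof (cases "x = 0")
    case False
    then show ?thesis using that unfolding X_def K_def
      by (intro continuous_at_within_inverse contF) auto
  qed (simp add: contK0)
  define T where "T = K ` {x \<in> X. x \<noteq> 0 \<and> poly (b - smult \<i> c) x = 0}"
  have "finite {x \<in> X. x \<noteq> 0 \<and> poly (b - smult \<i> c) x = 0}"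
    by (rule finite_subset[OF _ poly_roots_finite[OF Q]]) auto
  then have finT: "finite T" unfolding T_def by (rule finite_imageI)
  have T0: "0 \<notin> T" by (auto simp: T_def X_def K_def)
  define Y where "Y = - T"
  have openY: "open Y" unfolding Y_def using finT by (simp add: finite_imp_closed open_Compl)
  have connY: "connected Y"
    unfolding Y_def using path_connected_complement_countable[OF _ countable_finite[OF finT]]
    by (simp add: path_connected_imp_connected)
  define X' where "X' = {x \<in> X. K x \<in> Y}"
  have openX: "open X"
    unfolding open_contains_ball
  proof
    fix x assume x: "x \<in> X"
    show "\<exists>e>0. ball x e \<subseteq> X"
    proof (cases "x = 0")
      case True
      have "ball 0 (min r0 1) \<subseteq> X" using r0(3) by (auto simp: X_def)
      then show ?thesis using True r0(1) by (intro exI[of _ "min r0 1"]) auto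
    next
      case False
      then have "F x \<noteq> 0" "norm x < 1" using x by (auto simp: X_def)
      then obtain d where d: "d > 0" "\<And>y. dist x y < d \<Longrightarrow> F y \<noteq> 0"
        using continuous_at_avoid[OF contF[OF False], of 0] by metis
      have "ball x (min d (1 - norm x)) \<subseteq> X"
      proof
        fix y assume y: "y \<in> ball x (min d (1 - norm x))"
        have "norm y \<le> norm x + dist x y" by (metis dist_norm norm_minus_commute norm_triangle_sub)
        then show "y \<in> X" using y d(2) by (auto simp: X_def)
      qed
      then show ?thesis using d(1) \<open>norm x < 1\<close> by (intro exI[of _ "min d (1 - norm x)"]) auto
    qed
  qed
  have contKX: "continuous_on X K" using contK by (auto intro: continuous_at_imp_continuous_on)
  have X'_eq: "X' = X \<inter> K -` Y" by (auto simp: X'_def)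
  have openX': "open X'" unfolding X'_eq using contKX openX openY by (rule continuous_open_preimage)
  have contX': "continuous_on X' K" using contKX by (rule continuous_on_subset) (auto simp: X'_def)
  have KX': "K ` X' \<subseteq> Y" by (auto simp: X'_def)
  have proper: "compact {x \<in> X'. K x \<in> C}" if C: "compact C" "C \<subseteq> Y" for C
  proof -
    define Z where "Z = {x \<in> X. K x \<in> C}"
    have Zeq: "{x \<in> X'. K x \<in> C} = Z" using C(2) by (auto simp: Z_def X'_def)
    have "bounded Z" by (rule bounded_subset[OF bounded_ball[of 0 1]]) (auto simp: Z_def X_def)
    moreover have "closed Z"
      unfolding closed_sequential_limits
    proof (intro allI impI, elim conjE)
      fix u l assume u: "\<forall>n. u n \<in> Z" and l: "u \<longlonglongrightarrow> l"
      have uX: "u n \<in> X" "K (u n) \<in> C" for n using u by (auto simp: Z_def)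
      have closedC: "closed C" using C(1) by (rule compact_imp_closed)
      have lX: "l \<in> X"
      proof (cases "l = 0")
        case False
        obtain B where B: "B > 0" "\<And>y. y \<in> C \<Longrightarrow> norm y \<le> B"
          using compact_imp_bounded[OF C(1)] unfolding bounded_pos by blast
        \<comment> \<open>Values of K in the compact set C are bounded, so F stays away from 0 along
          the sequence. The limit is therefore neither on the circle nor at a zero of F in the
          disc.\<close>
        have low: "norm (F (u n)) \<ge> inverse B" if "u n \<noteq> 0" for n
        proof -
          have "F (u n) \<noteq> 0" using uX(1)[of n] that by (auto simp: X_def)
          moreover have "inverse (norm (F (u n))) \<le> B" using B(2)[OF uX(2)[of n]] by (simp add: K_def norm_inverse)
          ultimately have "inverse B \<le> inverse (inverse (norm (F (u n))))"
            by (intro le_imp_inverse_le) auto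
          then show ?thesis by simp
        qed
        have "eventually (\<lambda>n. u n \<in> - {0}) sequentially"
          by (rule topological_tendstoD[OF l]) (use False in auto)
        then have "eventually (\<lambda>n. inverse B \<le> norm (F (u n))) sequentially"
          by eventually_elim (use low in auto)
        moreover have "(\<lambda>n. norm (F (u n))) \<longlonglongrightarrow> norm (F l)"
          by (intro tendsto_norm isCont_tendsto_compose[OF contF[OF False] l])
        ultimately have "inverse B \<le> norm (F l)"
          by (intro tendsto_lowerbound[OF _ _ sequentially_bot]) auto
        then have Fl: "F l \<noteq> 0" using B(1) by auto
        have "closed (cball (0::complex) 1)" by simp
        moreover have "\<forall>n. u n \<in> cball 0 1" using uX(1) by (auto simp: X_def less_imp_le)
        ultimately have "l \<in> cball 0 1" using l unfolding closed_sequential_limits by blast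
        moreover have "norm l \<noteq> 1" using F1 Fl by blast
        ultimately show ?thesis using Fl by (auto simp: X_def)
      qed (simp add: X_def)
      have lim: "(\<lambda>n. K (u n)) \<longlonglongrightarrow> K l" by (rule isCont_tendsto_compose[OF contK[OF lX] l])
      have "K l \<in> C"
        by (rule Lim_in_closed_set[OF closedC always_eventually sequentially_bot lim]) (use uX(2) in simp)
      then show "l \<in> Z" using lX by (simp add: Z_def)
    qed
    ultimately show ?thesis unfolding Zeq by (simp add: compact_eq_bounded_closed)
  qed
  have inj: "\<exists>r>0. inj_on K (X' \<inter> ball x r)" if x: "x \<in> X'" for x
  proof (cases "x = 0")
    case True
    then show ?thesis using r0(1,2) by (meson inf_le2 inj_on_subset)
  next
    case False
    have xX: "x \<in> X" "K x \<notin> T" using x by (auto simp: X'_def Y_def)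
    then have Fx: "F x \<noteq> 0" "norm x < 1" using False by (auto simp: X_def)
    then have nz: "x * poly a x \<noteq> 0" using F0 by blast
    have "poly (b - smult \<i> c) x \<noteq> 0" using xX False unfolding T_def by blast
    from squared_potential_regular_point[OF h k nz dom[OF Fx(2) this]]
    obtain r H where H: "r > 0" "inj_on H (ball x r)" "continuous_on (ball x r) H" "\<forall>y\<in>ball x r. F y = (H y)\<^sup>2"
      unfolding F_def by blast
    have "x \<in> ball x r" using H(1) by simp
    then have "H x \<noteq> 0" using Fx(1) H(4) by fastforce
    from inj_on_inverse_square[OF H(1-3) this]
    obtain r' where r': "r' > 0" "r' \<le> r" "inj_on (\<lambda>y. inverse ((H y)\<^sup>2)) (ball x r')" by blast
    have "inj_on K (ball x r') = inj_on (\<lambda>y. inverse ((H y)\<^sup>2)) (ball x r')"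
      by (rule inj_on_cong) (use H(4) r'(2) in \<open>auto simp: K_def\<close>)
    then show ?thesis using r'(1,3) by (meson inf_le2 inj_on_subset)
  qed
  have zero: "0 \<in> X'" using T0 by (simp add: X'_def X_def Y_def K0)
  have one: "x = 0" if "x \<in> X'" "K x = K 0" for x
    using that by (auto simp: X'_def X_def K0) (auto simp: K_def)
  obtain \<alpha> where \<alpha>: "poly a \<alpha> = 0" "\<alpha> \<noteq> 0" "norm \<alpha> < 1" using root_in_disc[OF a g] by blast
  define Z where "Z = {x \<in> ball 0 1. F x = 0}"
  have cZ: "countable Z" unfolding Z_def F_def by (rule squared_potential_zeros_countable[OF a h k Q dom])
  \<comment> \<open>Closed discs around the root of smaller radius avoid 0 and stay inside the unit
    disc.\<close>
  define \<rho>0 where "\<rho>0 = min (norm \<alpha>) (1 - norm \<alpha>)"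
  \<comment> \<open>There are uncountably many radii but only countably many zeros, so some circle
    around the root carries no zero of F.\<close>
  have "uncountable {0<..<\<rho>0}" using \<alpha> by (simp add: uncountable_open_interval \<rho>0_def)
  moreover have "countable ((\<lambda>x. dist \<alpha> x) ` Z)" using cZ by simp
  ultimately have "\<not> {0<..<\<rho>0} \<subseteq> (\<lambda>x. dist \<alpha> x) ` Z" using countable_subset by blast
  then obtain \<rho> where "\<rho> \<in> {0<..<\<rho>0}" "\<rho> \<notin> (\<lambda>x. dist \<alpha> x) ` Z" by blast
  then have \<rho>: "0 < \<rho>" "\<rho> < \<rho>0" "\<rho> \<notin> (\<lambda>x. dist \<alpha> x) ` Z" by auto
  have ballD: "norm x < 1" "x \<noteq> 0" if "dist \<alpha> x \<le> \<rho>" for x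
  proof -
    have "norm x \<le> norm \<alpha> + dist \<alpha> x" by (metis dist_norm norm_minus_commute norm_triangle_sub)
    then show "norm x < 1" using that \<rho>(2) by (auto simp: \<rho>0_def)
    show "x \<noteq> 0" using that \<rho>(2) by (auto simp: \<rho>0_def)
  qed
  have sphere_nz: "F x \<noteq> 0" if "x \<in> sphere \<alpha> \<rho>" for x
    using that \<rho>(3) ballD[of x] by (auto simp: Z_def)
  have "continuous_on (sphere \<alpha> \<rho>) (\<lambda>x. norm (F x))"
    using ballD contF by (intro continuous_intros continuous_at_imp_continuous_on) auto
  moreover have "sphere \<alpha> \<rho> \<noteq> {}" using \<rho>(1) by simp
  ultimately obtain w where w: "w \<in> sphere \<alpha> \<rho>" "\<And>x. x \<in> sphere \<alpha> \<rho> \<Longrightarrow> norm (F w) \<le> norm (F x)"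
    using continuous_attains_inf[OF compact_sphere] by blast
  obtain R1 where R1: "R1 > 0" "\<And>t. t \<in> T \<Longrightarrow> norm t \<le> R1"
    using finite_imp_bounded[OF finT] unfolding bounded_pos by blast
  \<comment> \<open>R bounds both the removed values and |K| on the circle around the root: beyond R
    the target is intact, and the preimage of that region cannot meet this circle.\<close>
  define R where "R = max R1 (inverse (norm (F w)))"
  have R: "R > 0" using R1(1) by (simp add: R_def)
  define M where "M = {x \<in> X'. K x \<in> - cball 0 R}"
  have "connected M" unfolding M_def
  proof (rule proper_local_homeo_connected_vimage[OF openX' contX' openY connY KX' proper inj zero one])
    show "connected (- cball (0::complex) R)"
      by (intro connected_complement_bounded_convex) auto
    show "- cball 0 R \<subseteq> Y" using R1(2) by (fastforce simp: Y_def R_def)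
  qed
  have MI: "x \<in> M" if "norm x < 1" "F x \<noteq> 0" "norm (F x) < inverse R" for x
  proof -
    have "inverse (inverse R) < inverse (norm (F x))" using that R by (intro less_imp_inverse_less) auto
    then have KR: "norm (K x) > R" by (simp add: K_def norm_inverse)
    then have "K x \<notin> T" using R1(2)[of "K x"] by (auto simp: R_def)
    then show ?thesis using KR that by (auto simp: M_def X'_def X_def Y_def)
  qed
  have "\<alpha> \<noteq> 0" "F \<alpha> = 0" using \<alpha> F0 by auto
  obtain \<delta> where \<delta>: "\<delta> > 0" "\<And>y. y \<in> ball \<alpha> \<delta> \<Longrightarrow> norm (F y) < inverse R"
    by (rule tends_to_zero_near[OF contF[OF \<open>\<alpha> \<noteq> 0\<close>] \<open>F \<alpha> = 0\<close>, of "inverse R"]) (use R in auto)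
  obtain x1 where x1: "x1 \<in> ball \<alpha> (min \<delta> \<rho>)" "x1 \<notin> Z"
    by (rule open_avoid_countable[of "ball \<alpha> (min \<delta> \<rho>)" Z]) (use \<delta>(1) \<rho>(1) cZ in auto)
  have "x1 \<in> M" using x1 \<delta>(2)[of x1] ballD[of x1] by (intro MI) (auto simp: Z_def)
  moreover have "x1 \<in> ball \<alpha> \<rho>" using x1 by simp
  ultimately have "M \<inter> ball \<alpha> \<rho> \<noteq> {}" by blast
  obtain \<delta>' where \<delta>': "\<delta>' > 0" "\<And>y. y \<in> ball 1 \<delta>' \<Longrightarrow> norm (F y) < inverse R"
    by (rule tends_to_zero_near[OF contF[of 1] F1[of 1], of "inverse R"]) (use R in auto)
  have "1 \<in> closure (ball (0::complex) 1)" by simp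
  moreover have "open (ball 1 \<delta>' \<inter> - cball \<alpha> \<rho>)" by (intro open_Int open_Compl) auto
  moreover have "1 \<in> ball 1 \<delta>' \<inter> - cball \<alpha> \<rho>" using \<delta>'(1) ballD(1)[of 1] by auto
  ultimately have "ball 0 1 \<inter> (ball 1 \<delta>' \<inter> - cball \<alpha> \<rho>) \<noteq> {}"
    using open_Int_closure_eq_empty by blast
  then obtain x2 where x2: "x2 \<in> ball 0 1 \<inter> (ball 1 \<delta>' \<inter> - cball \<alpha> \<rho>)" "x2 \<notin> Z"
    using open_avoid_countable[of "ball 0 1 \<inter> (ball 1 \<delta>' \<inter> - cball \<alpha> \<rho>)" Z] cZ
    by (metis open_Compl open_Int open_ball closed_cball)
  have "x2 \<in> M" using x2 \<delta>'(2)[of x2] by (intro MI) (auto simp: Z_def)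
  moreover have "x2 \<notin> ball \<alpha> \<rho>" using x2 by auto
  ultimately have "M - ball \<alpha> \<rho> \<noteq> {}" by blast
  \<comment> \<open>The connected preimage M has points near the root, inside the circle around it,
    and points near 1, outside; so it has to cross the circle.\<close>
  from connected_Int_frontier[OF \<open>connected M\<close> \<open>M \<inter> ball \<alpha> \<rho> \<noteq> {}\<close> this]
  have "M \<inter> sphere \<alpha> \<rho> \<noteq> {}" using \<rho>(1) by (simp add: frontier_ball)
  then obtain x3 where x3: "x3 \<in> M" "x3 \<in> sphere \<alpha> \<rho>" by blast
  have "norm (K x3) > R" using x3(1) by (simp add: M_def)
  moreover have "norm (K x3) \<le> inverse (norm (F w))"
    using w(2)[OF x3(2)] sphere_nz[OF w(1)] unfolding K_def norm_inverse by (intro le_imp_inverse_le) auto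
  ultimately show False by (simp add: R_def)
qed

section \<open>Blaschke products and the topological degree\<close>

text \<open>The integrand is the logarithmic derivative of (z - r) / (1 - cnj r z). For |r| < 1 only
  the zero r is inside the circle; for |r| > 1 only the pole 1 / cnj r is.\<close>

lemma mobius_log_derivative_integral:
  fixes r :: complex
  assumes r: "norm r \<noteq> 1"
  shows "((\<lambda>z. 1 / (z - r) + cnj r / (1 - cnj r * z)) has_contour_integral
    2 * of_real pi * \<i> * (if norm r < 1 then 1 else - 1)) (circlepath 0 1)"
proof -
  have cauchy: "((\<lambda>z. 1 / (z - w)) has_contour_integral 2 * of_real pi * \<i>) (circlepath 0 1)" if "norm w < 1" for w
    using Cauchy_integral_circlepath_simple[of "\<lambda>_. 1" 0 1 w] that by simp
  have zero: "(h has_contour_integral 0) (circlepath 0 1)" if "h holomorphic_on cball 0 1" for h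
    by (rule Cauchy_theorem_convex_simple[OF that]) auto
  show ?thesis
  proof (cases "norm r < 1")
    case True
    have "1 - cnj r * z \<noteq> 0" if "z \<in> cball 0 1" for z
    proof
      assume "1 - cnj r * z = 0"
      then have "norm (cnj r * z) = 1" by simp
      moreover have "norm r * norm z \<le> norm r * 1" using that by (intro mult_left_mono) auto
      ultimately show False using True by (simp add: norm_mult)
    qed
    then have "(\<lambda>z. cnj r / (1 - cnj r * z)) holomorphic_on cball 0 1" by (intro holomorphic_intros) auto
    from has_contour_integral_add[OF cauchy[OF True] zero[OF this]] show ?thesis using True by simp
  next
    case False
    then have gt: "norm r > 1" using r by simp
    then have r0: "r \<noteq> 0" by auto
    have "z - r \<noteq> 0" if "z \<in> cball 0 1" for z using that gt by auto
    then have "(\<lambda>z. 1 / (z - r)) holomorphic_on cball 0 1" by (intro holomorphic_intros) auto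
    note out = zero[OF this]
    have "norm (inverse (cnj r)) < 1" using gt by (simp add: norm_inverse inverse_less_1_iff)
    from has_contour_integral_add[OF out has_contour_integral_neg[OF cauchy[OF this]]]
    have "((\<lambda>z. 1 / (z - r) + - (1 / (z - inverse (cnj r)))) has_contour_integral 0 + - (2 * of_real pi * \<i>)) (circlepath 0 1)" .
    \<comment> \<open>At the pole itself both sides are 0 by the convention for division by
      zero.\<close>
    moreover have "- (1 / (z - inverse (cnj r))) = cnj r / (1 - cnj r * z)" for z
      using r0 by (cases "1 - cnj r * z = 0") (auto simp: field_simps)
    ultimately show ?thesis using False by simp
  qed
qed

lemma mobius_denominator_nz:
  assumes "norm r \<noteq> 1" "norm z = 1"
  shows "1 - cnj r * z \<noteq> 0" "z - r \<noteq> 0"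
proof -
  show "1 - cnj r * z \<noteq> 0"
  proof
    assume "1 - cnj r * z = 0"
    then have "norm (cnj r * z) = 1" by simp
    then show False using assms by (simp add: norm_mult)
  qed
  show "z - r \<noteq> 0" using assms by auto
qed

text \<open>The winding number around 0 is the integral of the logarithmic derivative, which the
  product rule splits into one summand per factor.\<close>

lemma winding_number_blaschke:
  fixes r :: "nat \<Rightarrow> complex"
  assumes r: "\<And>i. i < N \<Longrightarrow> norm (r i) \<noteq> 1" and \<kappa>: "\<kappa> \<noteq> 0"
  defines "f \<equiv> \<lambda>z. \<kappa> * (\<Prod>i<N. (z - r i) / (1 - cnj (r i) * z))"
  shows "winding_number (f \<circ> circlepath 0 1) 0 = of_int (\<Sum>i<N. if norm (r i) < 1 then 1 else - 1)"
proof -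
  define F where "F = (\<lambda>n z. \<kappa> * (\<Prod>i<n. (z - r i) / (1 - cnj (r i) * z)))"
  define D where "D = (\<lambda>n z. \<Sum>i<n. 1 / (z - r i) + cnj (r i) / (1 - cnj (r i) * z))"
  have nz: "1 - cnj (r i) * z \<noteq> 0" "z - r i \<noteq> 0" if "i < N" "norm z = 1" for i z
    using mobius_denominator_nz[OF r that(2)] that(1) by auto
  have Fnz: "F n z \<noteq> 0" if "n \<le> N" "norm z = 1" for n z
    using nz that \<kappa> by (auto simp: F_def)
  have F': "(F n has_field_derivative F n z * D n z) (at z)" if z: "norm z = 1" and "n \<le> N" for n z
    using that(2)
  proof (induction n)
    case 0
    show ?case by (simp add: F_def D_def)
  next
    case (Suc n)
    have n: "n < N" using Suc.prems by simp
    define m where "m = (\<lambda>z. (z - r n) / (1 - cnj (r n) * z))"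
    have m: "(m has_field_derivative m z * (1 / (z - r n) + cnj (r n) / (1 - cnj (r n) * z))) (at z)"
    proof -
      have "((\<lambda>z. z - r n) has_field_derivative 1) (at z)"
        "((\<lambda>z. 1 - cnj (r n) * z) has_field_derivative - cnj (r n)) (at z)"
        by (auto intro!: derivative_eq_intros)
      from DERIV_divide[OF this nz(1)[OF n z]]
      have "(m has_field_derivative (1 * (1 - cnj (r n) * z) - (z - r n) * - cnj (r n)) /
          ((1 - cnj (r n) * z) * (1 - cnj (r n) * z))) (at z)" by (simp add: m_def)
      moreover have "(1 * B - A * - c) / (B * B) = A / B * (1 / A + c / B)" if "A \<noteq> 0" "B \<noteq> 0" for A B c :: complex
        using that by (simp add: add_divide_distrib distrib_left)
      ultimately show ?thesis unfolding m_def using nz[OF n z] by metis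
    qed
    have FS: "F (Suc n) = (\<lambda>z. F n z * m z)" by (auto simp: F_def m_def)
    from DERIV_mult[OF Suc.IH m] n
    show ?case unfolding FS by (simp add: D_def algebra_simps)
  qed
  have Dint: "(D n has_contour_integral 2 * of_real pi * \<i> * (\<Sum>i<n. if norm (r i) < 1 then 1 else - 1)) (circlepath 0 1)"
    if "n \<le> N" for n
    using that
  proof (induction n)
    case 0
    show ?case by (simp add: D_def has_contour_integral_0)
  next
    case (Suc n)
    have "D (Suc n) = (\<lambda>z. D n z + (1 / (z - r n) + cnj (r n) / (1 - cnj (r n) * z)))"
      by (auto simp: D_def)
    moreover have "(D n has_contour_integral 2 * of_real pi * \<i> * (\<Sum>i<n. if norm (r i) < 1 then 1 else - 1)) (circlepath 0 1)"
      using Suc by simp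
    ultimately show ?case
      using has_contour_integral_add[OF _ mobius_log_derivative_integral[OF r[of n]]] Suc.prems
      by (simp only: sum.lessThan_Suc distrib_left)
  qed
  have ana: "F N analytic_on sphere 0 1"
    unfolding F_def using nz by (intro analytic_intros) auto
  have vp: "valid_path (F N \<circ> circlepath 0 1)"
    by (rule valid_path_compose_analytic[OF _ ana]) auto
  have notin: "0 \<notin> path_image (F N \<circ> circlepath 0 1)"
    using Fnz[of N] by (auto simp: path_image_compose)
  have "winding_number (F N \<circ> circlepath 0 1) 0 =
      1 / (2 * of_real pi * \<i>) * contour_integral (F N \<circ> circlepath 0 1) (\<lambda>w. 1 / (w - 0))"
    using winding_number_valid_path[OF vp notin] by simp
  also have "contour_integral (F N \<circ> circlepath 0 1) (\<lambda>w. 1 / (w - 0)) =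
      contour_integral (circlepath 0 1) (\<lambda>w. deriv (F N) w * (1 / (F N w - 0)))"
    by (rule contour_integral_comp_analyticW[OF ana]) auto
  also have "\<dots> = contour_integral (circlepath 0 1) (D N)"
  proof (rule contour_integral_eq)
    fix z :: complex assume "z \<in> path_image (circlepath 0 1)"
    then have z: "norm z = 1" by simp
    show "deriv (F N) z * (1 / (F N z - 0)) = D N z"
      using DERIV_imp_deriv[OF F'[OF z order_refl]] Fnz[OF order_refl z] by simp
  qed
  also have "\<dots> = 2 * of_real pi * \<i> * (\<Sum>i<N. if norm (r i) < 1 then 1 else - 1)"
    using Dint[OF order_refl] by (rule contour_integral_unique)
  finally have "winding_number (F N \<circ> circlepath 0 1) 0 = (\<Sum>i<N. if norm (r i) < 1 then 1 else - 1)"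
    by (simp add: o_def)
  moreover have "f = F N" by (simp add: f_def F_def)
  moreover have "(of_int (\<Sum>i<N. if norm (r i) < 1 then 1 else - 1) :: complex) =
      (\<Sum>i<N. if norm (r i) < 1 then 1 else - 1)"
    unfolding of_int_sum by (intro sum.cong) auto
  ultimately show ?thesis by simp
qed

section \<open>Polynomials of equal modulus on the circle\<close>

lemma poly_eq_on_circle:
  fixes p q :: "complex poly"
  assumes "\<And>z. norm z = 1 \<Longrightarrow> poly p z = poly q z"
  shows "p = q"
proof (rule ccontr)
  assume "p \<noteq> q"
  then have "finite {z. poly (p - q) z = 0}" by (intro poly_roots_finite) simp
  moreover have "sphere 0 1 \<subseteq> {z. poly (p - q) z = 0}" using assms by auto
  moreover have "infinite (sphere (0::complex) 1)"
  proof
    assume fin: "finite (sphere (0::complex) 1)"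
    have "connected (sphere (0::complex) 1)" by (rule connected_sphere) simp
    with fin have "(\<exists>x. sphere (0::complex) 1 = {x})"
      using connected_finite_iff_sing[of "sphere (0::complex) 1"] by auto
    moreover have "1 \<in> sphere (0::complex) 1" "- 1 \<in> sphere (0::complex) 1" by auto
    ultimately show False by (metis one_neq_neg_one singletonD)
  qed
  ultimately show False using finite_subset by blast
qed

text \<open>The polynomial with conjugated coefficients in reversed order, using 1/z = cnj z on the
  circle. Any N above the degree is allowed, so that two polynomials can be reflected with the same
  power of z.\<close>

lemma circle_reflection:
  fixes q :: "complex poly"
  assumes "degree q \<le> N"
  shows "\<exists>t. degree t \<le> N \<and> (\<forall>z. norm z = 1 \<longrightarrow> poly t z = z ^ N * cnj (poly q z))"
proof -
  define t where "t = (\<Sum>i\<le>N. monom (cnj (coeff q i)) (N - i))"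
  have "degree t \<le> N" unfolding t_def by (intro degree_sum_le) (auto intro: order_trans[OF degree_monom_le])
  moreover have "poly t z = z ^ N * cnj (poly q z)" if z: "norm z = 1" for z
  proof -
    have zc: "z * cnj z = 1" using z complex_norm_square[of z] by simp
    have "z ^ (N - i) = z ^ N * cnj z ^ i" if "i \<le> N" for i
    proof -
      have "z ^ N * cnj z ^ i = z ^ (N - i) * (z ^ i * cnj z ^ i)"
        using that by (metis le_add_diff_inverse2 mult.assoc power_add)
      then show ?thesis using zc by (simp add: power_mult_distrib[symmetric])
    qed
    then have "poly t z = (\<Sum>i\<le>N. z ^ N * cnj (coeff q i * z ^ i))"
      by (simp add: t_def poly_sum poly_monom mult_ac)
    also have "(\<Sum>i\<le>N. z ^ N * cnj (coeff q i * z ^ i)) = z ^ N * cnj (\<Sum>i\<le>N. coeff q i * z ^ i)"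
      by (simp add: sum_distrib_left)
    also have "(\<Sum>i\<le>N. coeff q i * z ^ i) = poly q z"
      unfolding poly_altdef using assms by (intro sum.mono_neutral_right) (auto simp: coeff_eq_0)
    finally show ?thesis .
  qed
  ultimately show ?thesis by blast
qed

text \<open>If $|p| = |q|$ on the circle, then $p p^* = q q^*$ for the reflected polynomials $p^*$, $q^*$; coprimality
  of $p$ and $q$ turns this into $q \sim p^*$, so that $p/q$ is a quotient of Blaschke products.\<close>

lemma coprime_equal_modulus_blaschke:
  fixes p q :: "complex poly"
  assumes cop: "coprime p q" and deg: "degree q \<le> degree p"
    and mod: "\<And>z. norm z = 1 \<Longrightarrow> norm (poly p z) = norm (poly q z)"
  shows "\<exists>r \<kappa>. norm \<kappa> = norm (lead_coeff p) \<and> \<kappa> \<noteq> 0 \<and> (\<forall>i<degree p. norm (r i) \<noteq> 1) \<and>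
    (\<forall>z. poly p z = lead_coeff p * (\<Prod>i<degree p. z - r i)) \<and>
    (\<forall>z. poly q z = \<kappa> * (\<Prod>i<degree p. 1 - cnj (r i) * z))"
proof -
  define N where "N = degree p"
  have nocommon: "\<not> (poly p z = 0 \<and> poly q z = 0)" for z
  proof
    assume "poly p z = 0 \<and> poly q z = 0"
    then have "[:-z, 1:] dvd p" "[:-z, 1:] dvd q" by (auto simp: poly_eq_0_iff_dvd)
    then have "is_unit [:-z, 1:]" using cop coprime_common_divisor by blast
    then show False by (simp add: is_unit_iff_degree)
  qed
  have nz: "poly p z \<noteq> 0" "poly q z \<noteq> 0" if "norm z = 1" for z
    using nocommon[of z] mod[OF that] by auto
  have p0: "p \<noteq> 0" using nz(1)[of 1] by auto
  obtain s where s: "degree s \<le> N" "\<And>z. norm z = 1 \<Longrightarrow> poly s z = z ^ N * cnj (poly p z)"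
    using circle_reflection[of p N] by (auto simp: N_def)
  obtain t where t: "degree t \<le> N" "\<And>z. norm z = 1 \<Longrightarrow> poly t z = z ^ N * cnj (poly q z)"
    using circle_reflection[of q N] deg by (auto simp: N_def)
  have ps: "p * s = q * t"
  proof (rule poly_eq_on_circle)
    fix z :: complex assume z: "norm z = 1"
    have "poly p z * cnj (poly p z) = poly q z * cnj (poly q z)"
      using mod[OF z] by (simp add: complex_norm_square[symmetric])
    then show "poly (p * s) z = poly (q * t) z"
      using s(2)[OF z] t(2)[OF z] by (metis mult.left_commute poly_mult)
  qed
  have "p dvd t" using ps cop by (metis coprime_dvd_mult_right_iff dvd_triv_left)
  then obtain c where c: "t = p * c" by blast
  have "poly t 1 \<noteq> 0" using t(2)[of 1] nz(2)[of 1] by simp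
  then have t0: "t \<noteq> 0" by auto
  then have "c \<noteq> 0" using c by auto
  \<comment> \<open>The reflected polynomial t has degree at most N = degree p and is divisible by
    p, so the quotient is constant.\<close>
  then have "degree c = 0" using t(1) c p0 by (simp add: degree_mult_eq N_def)
  then obtain \<mu> where \<mu>: "c = [:\<mu>:]" by (metis degree_eq_zeroE)
  have "p * s = p * smult \<mu> q" using ps c \<mu> by (simp add: mult.commute)
  then have sq: "s = smult \<mu> q" using p0 mult_left_cancel by blast
  have \<mu>0: "\<mu> \<noteq> 0" using \<mu> \<open>c \<noteq> 0\<close> by auto
  have "norm (poly s 1) = norm (poly p 1)" using s(2)[of 1] by simp
  then have "norm \<mu> * norm (poly q 1) = norm (poly q 1)" using sq mod[of 1] by (simp add: norm_mult)
  then have \<mu>1: "norm \<mu> = 1" using nz(2)[of 1] by simp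
  obtain r where r: "smult (lead_coeff p) (\<Prod>i<degree p. [:- r i, 1:]) = p"
    using complex_poly_decompose'[of p] by blast
  have pr: "poly p z = lead_coeff p * (\<Prod>i<N. z - r i)" for z
    by (subst r[symmetric]) (simp add: poly_prod N_def)
  define \<kappa> where "\<kappa> = cnj (lead_coeff p) / \<mu>"
  have q_eq: "smult \<kappa> (\<Prod>i<N. [:1, - cnj (r i):]) = q"
  proof (rule poly_eq_on_circle)
    fix z :: complex assume z: "norm z = 1"
    have zc: "z * cnj z = 1" using z complex_norm_square[of z] by simp
    have "z ^ N * cnj (poly p z) = cnj (lead_coeff p) * ((\<Prod>i<N. z) * (\<Prod>i<N. cnj (z - r i)))"
      by (simp add: pr)
    also have "(\<Prod>i<N. z) * (\<Prod>i<N. cnj (z - r i)) = (\<Prod>i<N. z * cnj (z - r i))"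
      by (simp only: prod.distrib)
    also have "\<dots> = (\<Prod>i<N. 1 - cnj (r i) * z)" using zc by (intro prod.cong) (auto simp: algebra_simps)
    finally have "poly s z = cnj (lead_coeff p) * (\<Prod>i<N. 1 - cnj (r i) * z)" using s(2)[OF z] by simp
    then have "poly q z = \<kappa> * (\<Prod>i<N. 1 - cnj (r i) * z)" using sq \<mu>0 by (simp add: \<kappa>_def field_simps)
    then show "poly (smult \<kappa> (\<Prod>i<N. [:1, - cnj (r i):])) z = poly q z"
      by (simp add: poly_prod mult.commute)
  qed
  have qr: "poly q z = \<kappa> * (\<Prod>i<N. 1 - cnj (r i) * z)" for z
    by (subst q_eq[symmetric]) (simp add: poly_prod mult.commute)
  have "norm (r i) \<noteq> 1" if "i < N" for i
  proof
    assume "norm (r i) = 1"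
    moreover have "poly p (r i) = 0" unfolding pr using that by auto
    ultimately show False using nz(1) by blast
  qed
  moreover have "norm \<kappa> = norm (lead_coeff p)" using \<mu>1 by (simp add: \<kappa>_def norm_divide)
  moreover have "\<kappa> \<noteq> 0" using p0 \<mu>0 by (simp add: \<kappa>_def)
  ultimately show ?thesis using pr qr unfolding N_def by blast
qed

section \<open>Degree and winding number of quotients of polynomials\<close>

lemma rat_degree_eq:
  fixes p q :: "complex poly"
  assumes "q \<noteq> 0"
  shows "rat_degree p q = max (degree p) (degree q) - degree (gcd p q)"
proof -
  have d: "gcd p q \<noteq> 0" using assms by simp
  have deg: "degree (u div gcd p q) = degree u - degree (gcd p q)" if "gcd p q dvd u" for u
  proof (cases "u = 0")
    case False
    have "u = u div gcd p q * gcd p q" using that by simp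
    then have "degree u = degree (u div gcd p q) + degree (gcd p q)"
      using False d by (metis degree_mult_eq mult_zero_left)
    then show ?thesis by simp
  qed simp
  show ?thesis unfolding rat_degree_def by (simp add: deg)
qed

text \<open>Linear combinations can only lower the larger degree and enlarge the gcd. The inverse
  matrix gives the opposite inequalities, so both degrees are unchanged.\<close>

lemma rat_degree_linear:
  fixes p q :: "complex poly" and \<alpha> \<beta> \<gamma> \<delta> :: complex
  assumes det: "\<alpha> * \<delta> - \<beta> * \<gamma> \<noteq> 0" and q: "q \<noteq> 0" and q': "smult \<gamma> p + smult \<delta> q \<noteq> 0"
  shows "rat_degree (smult \<alpha> p + smult \<beta> q) (smult \<gamma> p + smult \<delta> q) = rat_degree p q"
proof -
  define p' q1 where "p' = smult \<alpha> p + smult \<beta> q" and "q1 = smult \<gamma> p + smult \<delta> q"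
  define e where "e = \<alpha> * \<delta> - \<beta> * \<gamma>"
  have "smult \<delta> p' - smult \<beta> q1 = smult e p" "smult \<alpha> q1 - smult \<gamma> p' = smult e q"
    by (simp_all add: p'_def q1_def e_def smult_add_right smult_diff_left algebra_simps)
  then have inv: "p = smult (\<delta> / e) p' + smult (- \<beta> / e) q1" "q = smult (- \<gamma> / e) p' + smult (\<alpha> / e) q1"
  proof -
    assume 1: "smult \<delta> p' - smult \<beta> q1 = smult e p" and 2: "smult \<alpha> q1 - smult \<gamma> p' = smult e q"
    have e: "e \<noteq> 0" using det by (simp add: e_def)
    have "p = smult (1 / e) (smult \<delta> p' - smult \<beta> q1)" unfolding 1 using e by simp
    then show "p = smult (\<delta> / e) p' + smult (- \<beta> / e) q1" by (simp add: smult_diff_right)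
    have "q = smult (1 / e) (smult \<alpha> q1 - smult \<gamma> p')" unfolding 2 using e by simp
    then show "q = smult (- \<gamma> / e) p' + smult (\<alpha> / e) q1" by (simp add: smult_diff_right)
  qed
  have le: "max (degree (smult a u + smult b v)) (degree (smult c u + smult d v)) \<le> max (degree u) (degree v)"
    for a b c d :: complex and u v :: "complex poly"
    by (auto intro!: degree_add_le order_trans[OF degree_smult_le])
  have "max (degree p') (degree q1) = max (degree p) (degree q)"
    using le[of \<alpha> p \<beta> q \<gamma> \<delta>] le[of "\<delta> / e" p' "- \<beta> / e" q1 "- \<gamma> / e" "\<alpha> / e"]
    unfolding inv[symmetric] p'_def[symmetric] q1_def[symmetric] by (rule antisym)
  moreover have dv: "gcd u v dvd gcd (smult a u + smult b v) (smult c u + smult d v)"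
    for a b c d :: complex and u v :: "complex poly"
    by (intro gcd_greatest dvd_add dvd_smult) auto
  have "gcd p q dvd gcd p' q1" "gcd p' q1 dvd gcd p q"
    using dv[of p q \<alpha> \<beta> \<gamma> \<delta>] dv[of p' q1 "\<delta> / e" "- \<beta> / e" "- \<gamma> / e" "\<alpha> / e"]
    unfolding inv[symmetric] p'_def[symmetric] q1_def[symmetric] by auto
  moreover have "gcd p q \<noteq> 0" "gcd p' q1 \<noteq> 0" using q q' by (auto simp: q1_def)
  ultimately have "degree (gcd p q) = degree (gcd p' q1)" by (intro antisym dvd_imp_degree_le) auto
  then show ?thesis
    using \<open>max (degree p') (degree q1) = max (degree p) (degree q)\<close> rat_degree_eq[OF q, of p] rat_degree_eq[OF q', of p']
    unfolding p'_def[symmetric] q1_def[symmetric] by simp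
qed

text \<open>Factor by factor, from |1 - cnj w x|^2 - |x - w|^2 = (1 - |x|^2) (1 - |w|^2). At least
  one factor is needed for strictness.\<close>

lemma blaschke_product_less:
  fixes r :: "nat \<Rightarrow> complex"
  assumes x: "norm x < 1" and r: "\<And>i. i < N \<Longrightarrow> norm (r i) < 1" and N: "0 < N"
  shows "(\<Prod>i<N. norm (x - r i)) < (\<Prod>i<N. norm (1 - cnj (r i) * x))"
proof -
  have lt: "norm (x - w) < norm (1 - cnj w * x)" if w: "norm w < 1" for w
  proof (rule power2_less_imp_less)
    have "(norm (1 - cnj w * x))\<^sup>2 - (norm (x - w))\<^sup>2 = (1 - (norm x)\<^sup>2) * (1 - (norm w)\<^sup>2)"
      by (simp only: cmod_power2) (simp add: power2_eq_square algebra_simps)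
    moreover have "(norm x)\<^sup>2 < 1" "(norm w)\<^sup>2 < 1" using x w by (simp_all add: abs_square_less_1)
    then have "(1 - (norm x)\<^sup>2) * (1 - (norm w)\<^sup>2) > 0" by simp
    ultimately show "(norm (x - w))\<^sup>2 < (norm (1 - cnj w * x))\<^sup>2" by simp
  qed simp
  have "0 < norm (1 - cnj (r i) * x)" if "i < N" for i
    using lt[OF r[OF that]] norm_ge_zero[of "x - r i"] by linarith
  then show ?thesis
    using lt r N by (intro prod_mono_strict[of 0]) (auto intro: less_imp_le)
qed

text \<open>The difference of the two sides vanishes at 0 and has a potential, namely the same
  combination of the three potentials. Working with potentials avoids showing that
  \<open>imag_period_polys\<close> is closed under real combinations.\<close>

lemma potential_basis:
  assumes a: "a \<in> spectral_polys g"
    and c1: "c1 \<in> imag_period_polys g a" "poly c1 0 = 1"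
    and c2: "c2 \<in> imag_period_polys g a" "poly c2 0 = \<i>"
    and b: "b \<in> imag_period_polys g a"
  shows "b = smult (of_real (Re (poly b 0))) c1 + smult (of_real (Im (poly b 0))) c2"
proof -
  obtain h where h: "potential a b h" using potential_exists[OF a b] by blast
  obtain h1 where h1: "potential a c1 h1" using potential_exists[OF a c1(1)] by blast
  obtain h2 where h2: "potential a c2 h2" using potential_exists[OF a c2(1)] by blast
  define s t where "s = Re (poly b 0)" and "t = Im (poly b 0)"
  let ?d = "smult (of_real 1) b + smult (of_real (- 1)) (smult (of_real s) c1 + smult (of_real t) c2)"
  note pot = potential_lincomb[OF h potential_lincomb[OF h1 h2, of s t], of 1 "- 1"]
  have "poly ?d 0 = 0" by (simp add: c1(2) c2(2) s_def t_def complex_eq_iff)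
  moreover have "smult (of_real 1) b + smult (of_real (- 1)) u = b - u" for u by simp
  ultimately have "b - (smult (of_real s) c1 + smult (of_real t) c2) = 0"
    using potential_zero[OF a pot] by metis
  then show ?thesis unfolding s_def t_def by (rule eq_iff_diff_eq_0[THEN iffD2])
qed

text \<open>The common factor d may vanish on the circle, so one cannot divide pointwise. With
  reflected polynomials the assumption becomes a polynomial identity from which d and its reflection
  cancel.\<close>

lemma equal_modulus_cancel:
  fixes p q d :: "complex poly"
  assumes d: "d \<noteq> 0" and mod: "\<And>z. norm z = 1 \<Longrightarrow> norm (poly (p * d) z) = norm (poly (q * d) z)"
    and z: "norm z = 1"
  shows "norm (poly p z) = norm (poly q z)"
proof -
  define N where "N = max (degree p) (degree q)"
  obtain s where s: "\<And>z. norm z = 1 \<Longrightarrow> poly s z = z ^ N * cnj (poly p z)"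
    using circle_reflection[of p N] by (auto simp: N_def)
  obtain t where t: "\<And>z. norm z = 1 \<Longrightarrow> poly t z = z ^ N * cnj (poly q z)"
    using circle_reflection[of q N] by (auto simp: N_def)
  obtain e where e: "\<And>z. norm z = 1 \<Longrightarrow> poly e z = z ^ degree d * cnj (poly d z)"
    using circle_reflection[of d "degree d"] by auto
  have sq: "poly u z * cnj (poly u z) = of_real ((norm (poly u z))\<^sup>2)" for u z
    by (simp only: complex_norm_square)
  have "e \<noteq> 0"
  proof
    assume "e = 0"
    then have "poly d z = poly 0 z" if "norm z = 1" for z using e[OF that] that by auto
    then show False using d poly_eq_on_circle by blast
  qed
  moreover have "d * e * (p * s - q * t) = 0"
  proof (rule poly_eq_on_circle)
    fix z :: complex assume z: "norm z = 1"
    have "poly (p * d) z * cnj (poly (p * d) z) = poly (q * d) z * cnj (poly (q * d) z)"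
      unfolding sq mod[OF z] ..
    then have "poly p z * poly d z * (cnj (poly p z) * cnj (poly d z)) =
        poly q z * poly d z * (cnj (poly q z) * cnj (poly d z))" by simp
    then have "z ^ degree d * z ^ N * (poly p z * poly d z * (cnj (poly p z) * cnj (poly d z)) -
        poly q z * poly d z * (cnj (poly q z) * cnj (poly d z))) = 0" by simp
    then show "poly (d * e * (p * s - q * t)) z = poly 0 z"
      by (simp add: s[OF z] t[OF z] e[OF z] algebra_simps)
  qed
  ultimately have "p * s = q * t" using d by simp
  then have "poly p z * poly s z = poly q z * poly t z" by (metis poly_mult)
  then have eq: "z ^ N * (poly p z * cnj (poly p z)) = z ^ N * (poly q z * cnj (poly q z))"
    by (simp add: s[OF z] t[OF z] mult_ac)
  have "z ^ N \<noteq> 0" using z by auto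
  from eq[unfolded mult_left_cancel[OF this]]
  have "poly p z * cnj (poly p z) = poly q z * cnj (poly q z)" .
  then have "(norm (poly p z))\<^sup>2 = (norm (poly q z))\<^sup>2" unfolding sq of_real_eq_iff .
  then show ?thesis by simp
qed

text \<open>Here m counts the roots of the reduced numerator inside the disc. The k roots outside
  reflect to poles inside. For k = 0 the reduced quotient is a finite Blaschke product, of modulus
  below 1 in the disc.\<close>

lemma circle_degree_rat_fun:
  fixes P Q :: "complex poly"
  assumes mod: "\<And>z. norm z = 1 \<Longrightarrow> norm (poly P z) = norm (poly Q z)"
    and deg: "degree Q \<le> degree P" and P0: "poly P 0 = 0" and Q0: "poly Q 0 \<noteq> 0"
  shows "\<exists>m k. rat_degree P Q = m + k \<and> m \<ge> 1 \<and> circle_degree (rat_fun P Q) = int m - int k \<and>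
    rat_degree P Q \<le> degree P \<and>
    (k = 0 \<longrightarrow> (\<forall>x. norm x < 1 \<longrightarrow> poly Q x \<noteq> 0 \<longrightarrow> norm (poly P x) < norm (poly Q x)))"
proof -
  define D where "D = gcd P Q"
  define p q where "p = P div D" and "q = Q div D"
  have Qnz: "Q \<noteq> 0" using Q0 by auto
  have Dnz: "D \<noteq> 0" using Qnz by (simp add: D_def)
  have PD: "P = p * D" and QD: "Q = q * D" by (simp_all add: p_def q_def D_def)
  have Pnz: "P \<noteq> 0"
  proof
    assume "P = 0"
    then have "poly Q z = poly 0 z" if "norm z = 1" for z using mod[OF that] by simp
    then show False using Qnz poly_eq_on_circle by blast
  qed
  have pnz: "p \<noteq> 0" and qnz: "q \<noteq> 0" using Pnz Qnz PD QD by auto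
  have cop: "coprime p q" unfolding p_def q_def D_def using Qnz by (intro div_gcd_coprime) auto
  have degP: "degree P = degree p + degree D" and degQ: "degree Q = degree q + degree D"
    unfolding PD QD using pnz qnz Dnz by (simp_all add: degree_mult_eq)
  define N where "N = degree p"
  have rd: "rat_degree P Q = N"
    using deg degP degQ unfolding rat_degree_def D_def[symmetric] p_def[symmetric] q_def[symmetric] N_def by simp
  have degqp: "degree q \<le> degree p" using deg degP degQ by simp
  have "norm (poly (p * D) z) = norm (poly (q * D) z)" if "norm z = 1" for z
    using mod[OF that] PD QD by simp
  note modpq = equal_modulus_cancel[OF Dnz this]
  obtain r \<kappa> where \<kappa>: "norm \<kappa> = norm (lead_coeff p)" "\<kappa> \<noteq> 0" and r: "\<forall>i<N. norm (r i) \<noteq> 1"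
    and p: "\<forall>z. poly p z = lead_coeff p * (\<Prod>i<N. z - r i)"
    and q: "\<forall>z. poly q z = \<kappa> * (\<Prod>i<N. 1 - cnj (r i) * z)"
    using coprime_equal_modulus_blaschke[OF cop degqp modpq] unfolding N_def by blast
  define A where "A = {i. i < N \<and> norm (r i) < 1}"
  define B where "B = {i. i < N \<and> \<not> norm (r i) < 1}"
  have AB: "finite A" "finite B" "A \<inter> B = {}" "{..<N} = A \<union> B" by (auto simp: A_def B_def)
  have N: "N = card A + card B" using card_Un_disjoint[OF AB(1,2,3)] AB(4) by (metis card_lessThan)
  have fnz: "lead_coeff p / \<kappa> \<noteq> 0" using pnz \<kappa>(2) by simp
  have fun_eq: "rat_fun P Q = (\<lambda>z. lead_coeff p / \<kappa> * (\<Prod>i<N. (z - r i) / (1 - cnj (r i) * z)))"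
    unfolding rat_fun_def D_def[symmetric] p_def[symmetric] q_def[symmetric]
    by (rule ext) (simp add: p q prod_dividef)
  have "winding_number (rat_fun P Q \<circ> circlepath 0 1) 0 = of_int (\<Sum>i<N. if norm (r i) < 1 then 1 else - 1)"
    unfolding fun_eq using r by (intro winding_number_blaschke fnz) auto
  also have "(\<Sum>i<N. if norm (r i) < 1 then 1 else - 1 :: int) =
      (\<Sum>i\<in>A. if norm (r i) < 1 then 1 else - 1) + (\<Sum>i\<in>B. if norm (r i) < 1 then 1 else - 1)"
    unfolding AB(4) by (rule sum.union_disjoint[OF AB(1,2,3)])
  also have "\<dots> = (\<Sum>i\<in>A. 1) + (\<Sum>i\<in>B. - 1)"
    by (intro arg_cong2[where f = "(+)"] sum.cong) (auto simp: A_def B_def)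
  also have "\<dots> = int (card A) - int (card B)" by simp
  finally have "winding_number (rat_fun P Q \<circ> circlepath 0 1) 0 = of_int (int (card A) - int (card B))" .
  then have cd: "circle_degree (rat_fun P Q) = int (card A) - int (card B)"
    unfolding circle_degree_def by (intro the_equality) (simp_all only: of_int_eq_iff)
  \<comment> \<open>The zero of P at 0 is not cancelled because Q does not vanish there; it supplies
    the root that gives m >= 1.\<close>
  have "poly D 0 \<noteq> 0" using Q0 QD by auto
  then have "poly p 0 = 0" using P0 PD by simp
  then have "\<exists>i<N. r i = 0" using p pnz by auto
  then have "A \<noteq> {}" by (auto simp: A_def)
  then have cardA: "card A \<ge> 1" using AB(1) by (simp add: Suc_leI card_gt_0_iff)
  have "norm (poly P x) < norm (poly Q x)" if k: "card B = 0" and x: "norm x < 1" "poly Q x \<noteq> 0" for x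
  proof -
    have "B = {}" using k AB(2) by simp
    then have "norm (r i) < 1" if "i < N" for i using that by (auto simp: B_def)
    then have "(\<Prod>i<N. norm (x - r i)) < (\<Prod>i<N. norm (1 - cnj (r i) * x))"
      using x N cardA by (intro blaschke_product_less) auto
    then have "norm (poly p x) < norm (poly q x)"
      using \<kappa> pnz by (simp add: p q norm_mult prod_norm)
    moreover have "norm (poly D x) > 0" using x(2) QD by auto
    ultimately show ?thesis by (simp add: PD QD norm_mult)
  qed
  then show ?thesis using rd N cd cardA degP N_def
    by (intro exI[of _ "card A"] exI[of _ "card B"]) auto
qed

theorem theorem3p2:
  fixes g :: nat and a b\<^sub>1 b\<^sub>2 c\<^sub>1 c\<^sub>2 :: "complex poly"
  assumes "a \<in> spectral_polys g"
    and "b\<^sub>1 \<in> imag_period_polys g a" "b\<^sub>2 \<in> imag_period_polys g a" "real_independent b\<^sub>1 b\<^sub>2"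
    and "c\<^sub>1 \<in> imag_period_polys g a" "poly c\<^sub>1 0 = 1"
    and "c\<^sub>2 \<in> imag_period_polys g a" "poly c\<^sub>2 0 = \<i>"
  shows "(g = 0 \<longleftrightarrow> rat_degree b\<^sub>1 b\<^sub>2 = 1)
    \<and> (g = 0 \<longleftrightarrow> int (rat_degree b\<^sub>1 b\<^sub>2) = circle_degree (f_tilde c\<^sub>1 c\<^sub>2))
    \<and> (g > 0 \<longrightarrow> \<bar>circle_degree (f_tilde c\<^sub>1 c\<^sub>2)\<bar> \<le> int (rat_degree b\<^sub>1 b\<^sub>2) - 2)"
proof -
  note a = assms(1)
  define P Q where "P = c\<^sub>1 + smult \<i> c\<^sub>2" and "Q = c\<^sub>1 - smult \<i> c\<^sub>2"
  have P0: "poly P 0 = 0" and Q0: "poly Q 0 \<noteq> 0" by (simp_all add: P_def Q_def assms)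
  have real: "c\<^sub>1 \<in> real_polys (g + 1)" "c\<^sub>2 \<in> real_polys (g + 1)"
    using assms(5,7) by (auto simp: imag_period_polys_def)
  have c2nz: "c\<^sub>2 \<noteq> 0" using assms(8) by auto
  \<comment> \<open>On the circle every c in \<open>real_polys (g + 1)\<close> satisfies c(z) =
    z^(g+1) cnj (c(z)), hence Q(z) = z^(g+1) cnj (P(z)).\<close>
  have mod: "norm (poly P z) = norm (poly Q z)" if z: "norm z = 1" for z
  proof -
    have zc: "z * cnj z = 1" using z complex_norm_square[of z] by simp
    have z0: "z \<noteq> 0" "cnj z \<noteq> 0" using zc by auto
    then have inv: "inverse (cnj z) = z" using zc by (simp add: field_simps)
    have refl: "poly c z = cnj (poly c z) / cnj z ^ (g + 1)" if "c \<in> real_polys (g + 1)" for c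
      using poly_real_polys_reflect[OF that z0(1)] unfolding inv .
    have "poly Q z = (cnj (poly c\<^sub>1 z) - \<i> * cnj (poly c\<^sub>2 z)) / cnj z ^ (g + 1)"
      using refl[OF real(1)] refl[OF real(2)] unfolding Q_def
      by (metis (no_types, lifting) diff_divide_distrib poly_diff poly_smult times_divide_eq_right)
    also have "cnj (poly c\<^sub>1 z) - \<i> * cnj (poly c\<^sub>2 z) = cnj (poly P z)" by (simp add: P_def)
    finally show ?thesis using z by (simp add: norm_divide norm_power norm_mult)
  qed
  have degs: "degree c\<^sub>1 \<le> g + 1" "degree c\<^sub>2 \<le> g + 1" using real by (auto simp: real_polys_def)
  have top: "coeff c (g + 1) = cnj (poly c 0)" if "c \<in> real_polys (g + 1)" for c
  proof -
    have "coeff c (g + 1 - 0) = cnj (coeff c 0)" using that unfolding real_polys_def by blast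
    then show ?thesis by (simp add: poly_0_coeff_0)
  qed
  \<comment> \<open>The top coefficient is cnj 1 + i cnj i = 2. So P has the full degree g + 1,
    which the degree of Q cannot exceed.\<close>
  have "coeff P (g + 1) \<noteq> 0" using top[OF real(1)] top[OF real(2)] by (simp add: P_def assms)
  then have "g + 1 \<le> degree P" by (rule le_degree)
  moreover have "degree P \<le> g + 1" unfolding P_def using degs
    by (intro degree_add_le) (auto intro: order_trans[OF degree_smult_le])
  ultimately have degP: "degree P = g + 1" by simp
  have degQ: "degree Q \<le> degree P" unfolding degP Q_def using degs
    by (intro degree_diff_le) (auto intro: order_trans[OF degree_smult_le])
  obtain m k where mk: "rat_degree P Q = m + k" "m \<ge> 1" "circle_degree (rat_fun P Q) = int m - int k"
    "rat_degree P Q \<le> degree P"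
    "k = 0 \<longrightarrow> (\<forall>x. norm x < 1 \<longrightarrow> poly Q x \<noteq> 0 \<longrightarrow> norm (poly P x) < norm (poly Q x))"
    using circle_degree_rat_fun[OF mod degQ P0 Q0] by blast
  define s1 t1 s2 t2 where "s1 = Re (poly b\<^sub>1 0)" and "t1 = Im (poly b\<^sub>1 0)"
    and "s2 = Re (poly b\<^sub>2 0)" and "t2 = Im (poly b\<^sub>2 0)"
  have b1: "b\<^sub>1 = smult (of_real s1) c\<^sub>1 + smult (of_real t1) c\<^sub>2"
    unfolding s1_def t1_def by (rule potential_basis[OF a assms(5-8,2)])
  have b2: "b\<^sub>2 = smult (of_real s2) c\<^sub>1 + smult (of_real t2) c\<^sub>2"
    unfolding s2_def t2_def by (rule potential_basis[OF a assms(5-8,3)])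
  have indep: "s = 0 \<and> t = 0" if "smult (of_real s) b\<^sub>1 + smult (of_real t) b\<^sub>2 = 0" for s t :: real
    using assms(4) that unfolding real_independent_def by blast
  \<comment> \<open>Eliminating c2 or c1 leaves a multiple of the determinant. Were it 0,
    independence would make all four coordinates 0, and then b1 = 0.\<close>
  have det: "s1 * t2 - t1 * s2 \<noteq> 0"
  proof
    assume det0: "s1 * t2 - t1 * s2 = 0"
    have "smult (of_real t2) b\<^sub>1 + smult (of_real (- t1)) b\<^sub>2 = smult (of_real (s1 * t2 - t1 * s2)) c\<^sub>1"
      by (simp add: b1 b2 smult_add_right smult_diff_left algebra_simps)
    then have 1: "t2 = 0 \<and> - t1 = 0" using det0 by (intro indep) simp
    have "smult (of_real s2) b\<^sub>1 + smult (of_real (- s1)) b\<^sub>2 = smult (of_real (t1 * s2 - s1 * t2)) c\<^sub>2"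
      by (simp add: b1 b2 smult_add_right smult_diff_left algebra_simps)
    moreover have "t1 * s2 - s1 * t2 = 0" using det0 by simp
    ultimately have 2: "s2 = 0 \<and> - s1 = 0" by (intro indep) (simp only: of_real_0 smult_0_left)
    have "smult (of_real 1) b\<^sub>1 + smult (of_real 0) b\<^sub>2 = 0" using 1 2 by (simp add: b1)
    from indep[OF this] show False by simp
  qed
  have "b\<^sub>2 \<noteq> 0" using indep[of 0 1] by auto
  moreover have "complex_of_real s1 * complex_of_real t2 - complex_of_real t1 * complex_of_real s2 \<noteq> 0"
    using det by (metis of_real_0 of_real_diff of_real_eq_iff of_real_mult)
  ultimately have rb: "rat_degree b\<^sub>1 b\<^sub>2 = rat_degree c\<^sub>1 c\<^sub>2"
    using rat_degree_linear[OF _ c2nz, of "of_real s1" "of_real t2" "of_real t1" "of_real s2" c\<^sub>1]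
    unfolding b1[symmetric] b2[symmetric] by blast
  have Qnz: "Q \<noteq> 0" using Q0 by auto
  have "rat_degree (smult 1 c\<^sub>1 + smult \<i> c\<^sub>2) (smult 1 c\<^sub>1 + smult (- \<i>) c\<^sub>2) = rat_degree c\<^sub>1 c\<^sub>2"
    by (rule rat_degree_linear[OF _ c2nz]) (use Qnz in \<open>auto simp: Q_def\<close>)
  then have rP: "rat_degree b\<^sub>1 b\<^sub>2 = rat_degree P Q" by (simp add: rb P_def Q_def)
  have ft: "f_tilde c\<^sub>1 c\<^sub>2 = rat_fun P Q" by (simp add: f_tilde_def P_def Q_def)
  have k: "k \<ge> 1" if g: "g > 0"
  proof (rule ccontr)
    assume "\<not> k \<ge> 1"
    then have lt: "norm (poly P x) < norm (poly Q x)" if "norm x < 1" "poly Q x \<noteq> 0" for x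
      using mk(5) that by simp
    obtain h1 where h1: "potential a c\<^sub>1 h1" using potential_exists[OF a assms(5)] by blast
    obtain h2 where h2: "potential a c\<^sub>2 h2" using potential_exists[OF a assms(7)] by blast
    obtain x where "norm x < 1" "poly Q x \<noteq> 0" "norm (poly Q x) \<le> norm (poly P x)"
      using not_dominated_in_disc[OF a g h1 h2 assms(6,8)] unfolding P_def Q_def by blast
    then show False using lt by force
  qed
  show ?thesis
  proof (cases "g = 0")
    case True
    \<comment> \<open>For g = 0 the degree m + k is at most degree P = 1, while m >= 1.\<close>
    then have "m = 1" "k = 0" using mk degP by auto
    then show ?thesis using True mk rP ft by simp
  next
    case False
    \<comment> \<open>With m, k >= 1 the degree m + k is at least 2 and differs from m - k, and |m -
      k| <= m + k - 2.\<close>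
    then show ?thesis using k mk rP ft by auto
  qed
qed

end
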